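(* Let $\mathbb{H}$ be the Heisenberg group with the Korányi metric, $\pi:\mathbb{H}\to\mathbb{C}$ the vertical projection $\pi(u,s)=u$, and let $E$ and $\mu$ be the random Poisson cut-out set and cut-out measure of intensity parameter $\gamma\in\,]0,4[$ described in the context, with $\beta=4-\gamma$. Then, almost surely on the event $\{\mu\neq 0\}$: (1) if $\beta>2$, the push-forward measure $\pi\mu$ is absolutely continuous with respect to Lebesgue measure on $\mathbb{C}\cong\mathbb{R}^2$, and $\pi(E)$ has non-empty interior; (2) if $\beta\le 2$, then $\dim(\pi\mu)=\dim_{\mathrm H}(\pi(E))=\beta$.
   Context: $\mathbb{H}=\mathbb{C}\times\mathbb{R}$ with group law $(u,s)\cdot(v,t)=(u+v,s+t+\mathrm{Im}(\bar u v))$ and Korányi metric $d(p,q)=\|q^{-1}\cdot p\|$, where $\|(u,s)\|=(|u|^4+4s^2)^{1/4}$. The center is $Z=\{0\}\times\mathbb{R}$, and $\mathbb{H}/Z$ is identified with $\mathbb{C}$ (Euclidean metric) via $\pi(u,s)=u$. Let $\mathcal H$ be Lebesgue measure on $\mathbb{R}^3\cong\mathbb{H}$ normalized so that $\mathcal H(B(x,r))=r^4$ for all Korányi balls. Let $\mathcal Y=\{(x_i,r_i):i\in I\}$ be a Poisson point process on $\mathbb{H}\times\,]0,1[$ with intensity $\gamma\,\mathcal H\otimes r^{-5}\,\mathrm dr$, i.e. a random set such that for each Borel $\mathcal A$ the number of points in $\mathcal A$ is Poisson with mean equal to the intensity measure of $\mathcal A$, with independence over disjoint sets. Let $\Omega$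 be the closed unit Korányi ball centered at $0$, $E=\Omega\setminus\bigcup_{i}B(x_i,r_i)$, $E_n=\Omega\setminus\bigcup_{r_i\ge 2^{-n}}B(x_i,r_i)$, $\mu_n=\beta_n\mathbf 1_{E_n}$ where $\beta_n=1/\mathbb P(x\in E_n)$ (independent of $x\in\Omega$), and let $\mu$ be the (almost surely existing) weak* limit of the measures $\mu_n\mathcal H$. Hausdorff dimensions in $\mathbb{H}$ are with respect to the Korányi metric. For a measure $\nu$, $\dim(\nu)=\inf\{\dim_{\mathrm H}(A):\nu(A)>0\}$. *)

theory Defs
  imports "HOL-Probability.Probability"
begin

type_synonym heis = "complex \<times> real"

definition heis_mult :: "heis \<Rightarrow> heis \<Rightarrow> heis" where
  "heis_mult p q = (fst p + fst q, snd p + snd q + Im (cnj (fst p) * fst q))"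

definition heis_inv :: "heis \<Rightarrow> heis" where
  "heis_inv p = (- fst p, - snd p)"

definition kor_norm :: "heis \<Rightarrow> real" where
  "kor_norm p = (cmod (fst p) ^ 4 + 4 * (snd p)\<^sup>2) powr (1/4)"

definition kor_dist :: "heis \<Rightarrow> heis \<Rightarrow> real" where
  "kor_dist p q = kor_norm (heis_mult (heis_inv q) p)"

definition kor_ball :: "heis \<Rightarrow> real \<Rightarrow> heis set" where
  "kor_ball x r = {y. kor_dist y x < r}"

definition kor_cball :: "heis \<Rightarrow> real \<Rightarrow> heis set" where
  "kor_cball x r = {y. kor_dist y x \<le> r}"

definition Omega :: "heis set" where
  "Omega = kor_cball 0 1"

text \<open>Lebesgue measure on R^3 = H normalised so that Koranyi balls of radius r have measure r^4.\<close>
definition Hmeas :: "heis measure" where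
  "Hmeas = density lborel (\<lambda>_. inverse (emeasure lborel (kor_cball 0 1)))"

definition cutout_intensity :: "real \<Rightarrow> (heis \<times> real) measure" where
  "cutout_intensity \<gamma> = density (Hmeas \<Otimes>\<^sub>M lborel)
     (\<lambda>(x, r). indicator {0<..<1} r * ennreal (\<gamma> * r powr (-5)))"

definition poisson_pp :: "'w measure \<Rightarrow> ('w \<Rightarrow> 'b set) \<Rightarrow> 'b measure \<Rightarrow> bool" where
  "poisson_pp M Y \<nu> \<longleftrightarrow> prob_space M \<and>
     (\<forall>\<omega>\<in>space M. Y \<omega> \<subseteq> space \<nu>) \<and>
     (\<forall>A\<in>sets \<nu>. emeasure \<nu> A < \<infinity> \<longrightarrow>
        (\<forall>k::nat. {\<omega>\<in>space M. finite (Y \<omega> \<inter> A) \<and> card (Y \<omega> \<inter> A) = k} \<in> sets M \<and>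
           measure M {\<omega>\<in>space M. finite (Y \<omega> \<inter> A) \<and> card (Y \<omega> \<inter> A) = k}
             = exp (- measure \<nu> A) * measure \<nu> A ^ k / fact k)) \<and>
     (\<forall>(As :: nat \<Rightarrow> 'b set) n.
        (\<forall>i<n. As i \<in> sets \<nu> \<and> emeasure \<nu> (As i) < \<infinity>) \<and> disjoint_family_on As {..<n} \<longrightarrow>
        prob_space.indep_vars M (\<lambda>_. count_space UNIV) (\<lambda>i \<omega>. card (Y \<omega> \<inter> As i)) {..<n})"

definition cutout_set :: "('w \<Rightarrow> (heis \<times> real) set) \<Rightarrow> 'w \<Rightarrow> heis set" where
  "cutout_set Y \<omega> = Omega - (\<Union>(x, r)\<in>Y \<omega>. kor_ball x r)"

definition cutout_set_n :: "('w \<Rightarrow> (heis \<times> real) set) \<Rightarrow> nat \<Rightarrow> 'w \<Rightarrow> heis set" where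
  "cutout_set_n Y n \<omega> = Omega - (\<Union>(x, r)\<in>{(x, r)\<in>Y \<omega>. r \<ge> 2 powr (- real n)}. kor_ball x r)"

text \<open>beta_n = 1 / P(x in E_n); this is independent of x in Omega, we use x = 0.\<close>
definition cutout_beta :: "'w measure \<Rightarrow> ('w \<Rightarrow> (heis \<times> real) set) \<Rightarrow> nat \<Rightarrow> real" where
  "cutout_beta M Y n = 1 / measure M {\<omega>\<in>space M. 0 \<in> cutout_set_n Y n \<omega>}"

definition cutout_meas_n :: "'w measure \<Rightarrow> ('w \<Rightarrow> (heis \<times> real) set) \<Rightarrow> nat \<Rightarrow> 'w \<Rightarrow> heis measure" where
  "cutout_meas_n M Y n \<omega> =
     density Hmeas (\<lambda>y. ennreal (cutout_beta M Y n) * indicator (cutout_set_n Y n \<omega>) y)"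

definition weak_star_conv :: "(nat \<Rightarrow> 'a::topological_space measure) \<Rightarrow> 'a measure \<Rightarrow> bool" where
  "weak_star_conv m \<mu> \<longleftrightarrow>
     (\<forall>f :: 'a \<Rightarrow> real. continuous_on UNIV f \<and> (\<exists>K. compact K \<and> (\<forall>x. x \<notin> K \<longrightarrow> f x = 0)) \<longrightarrow>
        (\<lambda>n. \<integral>x. f x \<partial>(m n)) \<longlonglongrightarrow> (\<integral>x. f x \<partial>\<mu>))"

definition hausdorff_content :: "real \<Rightarrow> real \<Rightarrow> 'a::metric_space set \<Rightarrow> ennreal" where
  "hausdorff_content s \<delta> A =
     (INF U \<in> {U :: nat \<Rightarrow> 'a set. A \<subseteq> (\<Union>n. U n) \<and> (\<forall>n. bounded (U n) \<and> diameter (U n) \<le> \<delta>)}.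
        \<Sum>n. ennreal (diameter (U n) powr s))"

definition hausdorff_measure :: "real \<Rightarrow> 'a::metric_space set \<Rightarrow> ennreal" where
  "hausdorff_measure s A = (SUP \<delta>\<in>{0<..}. hausdorff_content s \<delta> A)"

definition hausdorff_dim :: "'a::metric_space set \<Rightarrow> real" where
  "hausdorff_dim A = Inf {s. s \<ge> 0 \<and> hausdorff_measure s A = 0}"

definition measure_dim :: "'a::metric_space measure \<Rightarrow> real" where
  "measure_dim \<nu> = Inf {hausdorff_dim A | A. A \<in> sets \<nu> \<and> emeasure \<nu> A > 0}"

end

theory Submission
  imports Defs "HOL-Real_Asymp.Real_Asymp"
begin

text \<open>A point \<open>y\<close> survives stage \<open>n\<close> with probability \<open>2 powr (- \<gamma> * n)\<close>, and two points survive together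
  with probability at most \<open>2 powr (- 2 * \<gamma> * n) * (2 / kor_dist x y) powr \<gamma>\<close>. Covering \<open>Omega\<close> by about
  \<open>\<delta> powr (-4)\<close> Koranyi balls of radius \<open>\<delta>\<close>, each meeting the cut-out set with probability of order \<open>\<delta> powr \<gamma>\<close>,
  bounds the dimension from above by \<open>4 - \<gamma>\<close>.

  For \<open>\<gamma> \<ge> 2\<close> the two-point bound makes the expected \<open>t\<close>-energy of the projected measure finite for every
  \<open>t < 4 - \<gamma>\<close>: along a fibre the kernel is integrated against the vertical coordinate, which absorbs the exponent \<open>2\<close>.
  Hence sets of positive mass have dimension at least \<open>4 - \<gamma>\<close>.

  For \<open>\<gamma> < 2\<close> the normalised length of the surviving part of the fibre over \<open>u\<close> is a martingale in \<open>n\<close>. Given the coarser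
  balls, its increment is a sum of centred terms over vertical intervals of length \<open>2 / 4 ^ n\<close>, and
  terms of nonadjacent intervals are independent. Hoeffding's inequality makes
  large increments doubly exponentially unlikely, so with Hoelder continuity in \<open>u\<close> a union bound over a
  fine grid gives uniform convergence. The limits being bounded yields absolute continuity, and the
  set where the continuous limit density is positive lies in the projection of the cut-out set.\<close>

section \<open>The Koranyi metric and its balls\<close>

text \<open>The threshold \<gamma> = 2 comes from the scaling of the fibres: a piece of length
  \<open>2 / 4 ^ n\<close> has normalised mass at most of order
  \<open>2 powr ((\<gamma> - 2) * n)\<close>, so a fibre of total mass of order one fluctuates with
  variance at most of this order. Pointwise convergence would not suffice: an interior point of the
  projection needs uncountably many fibres to survive at once. The limit measure is given at each
  sample point only as some weak limit, with no measurability in it. All probabilistic statements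
  therefore concern stage-\<open>n\<close> objects, and the limit enters solely through lower
  semicontinuity of mass on open sets, at a fixed sample point. This is why squares are taken open
  and why the exceptional null set is fixed before the limit measure. For \<gamma> \<ge> 2 the
  exponent is split as \<open>2 * a + 2 * b\<close>: \<open>a\<close> for each planar coordinate,
  and \<open>b\<close> counted twice since vertical lengths scale like squares of Koranyi lengths.
  With \<open>b = (\<gamma> + t) / 4\<close> the vertical integrability condition
  \<open>b < 1\<close> is exactly \<open>t < 4 - \<gamma>\<close>, so projecting costs no
  dimension.\<close>

lemma kor_dist_eq:
  "kor_dist (u, t) (v, s) = (cmod (u - v) ^ 4 + 4 * (t - s - Im (cnj v * u))\<^sup>2) powr (1/4)"
  by (simp add: kor_dist_def kor_norm_def heis_mult_def heis_inv_def algebra_simps)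

lemma kor_norm_nonneg [simp]: "kor_norm p \<ge> 0"
  by (simp add: kor_norm_def)

lemma kor_dist_nonneg [simp]: "kor_dist p q \<ge> 0"
  by (simp add: kor_dist_def)

lemma powr_quarter_power4: "x \<ge> 0 \<Longrightarrow> ((x::real) powr (1/4)) ^ 4 = x"
  by (cases "x = 0") (simp_all add: powr_power)

lemma power4_le_imp_le: "a ^ 4 \<le> b ^ 4 \<Longrightarrow> 0 \<le> b \<Longrightarrow> a \<le> (b::real)"
  by (rule power_le_imp_le_base[of a 3 b]) (simp_all add: eval_nat_numeral)

lemma kor_norm_power4: "kor_norm p ^ 4 = cmod (fst p) ^ 4 + 4 * (snd p)\<^sup>2"
  unfolding kor_norm_def by (rule powr_quarter_power4) simp

lemma kor_dist_power4:
  "kor_dist (u, t) (v, s) ^ 4 = cmod (u - v) ^ 4 + 4 * (t - s - Im (cnj v * u))\<^sup>2"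
  unfolding kor_dist_eq by (rule powr_quarter_power4) simp

lemma kor_dist_le_iff:
  "r \<ge> 0 \<Longrightarrow> kor_dist p q \<le> r \<longleftrightarrow> kor_dist p q ^ 4 \<le> r ^ 4"
  by (rule power_mono_iff[symmetric]) auto

lemma kor_dist_less_iff:
  "r \<ge> 0 \<Longrightarrow> kor_dist p q < r \<longleftrightarrow> kor_dist p q ^ 4 < r ^ 4"
  by (meson kor_dist_nonneg linorder_not_le power_mono power_strict_mono zero_less_numeral kor_dist_le_iff)

lemma kor_dist_sym: "kor_dist p q = kor_dist q p"
proof -
  obtain u t v s where [simp]: "p = (u, t)" "q = (v, s)" by (cases p, cases q) auto
  have "(t - s - Im (cnj v * u))\<^sup>2 = (s - t - Im (cnj u * v))\<^sup>2" by (simp add: power2_eq_square algebra_simps)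
  then show ?thesis
    unfolding kor_dist_eq \<open>p = (u, t)\<close> \<open>q = (v, s)\<close> norm_minus_commute[of u v] by (simp only:)
qed

text \<open>Cygan's argument: the complex number \<open>|u|^2 + 2 i s\<close> attached to
  \<open>(u, s)\<close> has modulus \<open>kor_norm ^ 2\<close>, and the number attached to a
  product is \<open>a + b + 2 * (cnj u * v)\<close>. The ordinary triangle inequality then bounds
  the squared norm of the product by the square of the sum of the norms.\<close>

lemma kor_norm_mult_le: "kor_norm (heis_mult p q) \<le> kor_norm p + kor_norm q"
proof -
  obtain u s v t where [simp]: "p = (u, s)" "q = (v, t)" by (cases p, cases q) auto
  define a where "a = Complex ((cmod u)\<^sup>2) (2 * s)"
  define b where "b = Complex ((cmod v)\<^sup>2) (2 * t)"
  have na: "cmod a = (kor_norm p)\<^sup>2" if "a = Complex ((cmod (fst p))\<^sup>2) (2 * snd p)" for a p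
  proof -
    have "(cmod a)\<^sup>2 = ((kor_norm p)\<^sup>2)\<^sup>2"
      unfolding that cmod_power2[of "Complex _ _"] using kor_norm_power4[of p]
      by (simp add: power_mult_distrib flip: power_mult)
    then show ?thesis by (simp only: power2_eq_iff_nonneg norm_ge_zero zero_le_power2)
  qed
  have "(cmod (u + v))\<^sup>2 = (cmod u)\<^sup>2 + (cmod v)\<^sup>2 + 2 * Re (cnj u * v)"
    unfolding cmod_power2 by (simp add: power2_eq_square algebra_simps)
  then have "Complex ((cmod (fst (heis_mult p q)))\<^sup>2) (2 * snd (heis_mult p q)) = a + b + 2 * (cnj u * v)"
    by (simp add: a_def b_def heis_mult_def complex_eq_iff algebra_simps)
  then have "(kor_norm (heis_mult p q))\<^sup>2 = cmod (a + b + 2 * (cnj u * v))"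
    using na[OF refl, of "heis_mult p q"] by simp
  also have "\<dots> \<le> cmod a + cmod b + 2 * (cmod u * cmod v)"
    by (rule norm_triangle_le) (simp add: norm_triangle_ineq norm_mult)
  also have "\<dots> = (kor_norm p)\<^sup>2 + (kor_norm q)\<^sup>2 + 2 * (cmod u * cmod v)"
    using na[of a p] na[of b q] by (simp add: a_def b_def)
  also have "cmod u * cmod v \<le> kor_norm p * kor_norm q"
  proof (rule mult_mono)
    have "cmod (fst p) ^ 4 \<le> kor_norm p ^ 4" for p by (simp add: kor_norm_power4)
    then have *: "cmod (fst p) \<le> kor_norm p" for p
      by (rule power4_le_imp_le) simp
    show "cmod u \<le> kor_norm p" "cmod v \<le> kor_norm q" using *[of p] *[of q] by auto
  qed auto
  finally have "(kor_norm (heis_mult p q))\<^sup>2 \<le> (kor_norm p + kor_norm q)\<^sup>2"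
    by (simp add: power2_eq_square algebra_simps)
  then show ?thesis by (rule power2_le_imp_le) simp
qed

lemma kor_dist_triangle: "kor_dist p r \<le> kor_dist p q + kor_dist q r"
proof -
  have "heis_mult (heis_inv r) p = heis_mult (heis_mult (heis_inv r) q) (heis_mult (heis_inv q) p)"
    by (simp add: heis_mult_def heis_inv_def prod_eq_iff algebra_simps)
  then show ?thesis
    unfolding kor_dist_def using kor_norm_mult_le by (metis add.commute)
qed

text \<open>The projection is 1-Lipschitz, so Koranyi covers of the cut-out set project to covers of
  its image without loss of scale.\<close>

lemma cmod_le_kor_dist: "cmod (fst p - fst q) \<le> kor_dist p q"
proof -
  have "cmod (fst p - fst q) ^ 4 \<le> kor_dist p q ^ 4"
    using kor_dist_power4[of "fst p" "snd p" "fst q" "snd q"] by simp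
  then show ?thesis by (rule power4_le_imp_le) simp
qed

text \<open>Topology, Borel sets and compactness all refer to the product topology; continuity of
  the metric in it makes Koranyi balls open or closed there.\<close>

lemma continuous_on_kor_dist [continuous_intros]:
  assumes "continuous_on S f" "continuous_on S g"
  shows "continuous_on S (\<lambda>x. kor_dist (f x) (g x))"
proof -
  have "continuous_on S (\<lambda>x. (cmod (fst (f x) - fst (g x)) ^ 4 +
      4 * (snd (f x) - snd (g x) - Im (cnj (fst (g x)) * fst (f x)))\<^sup>2) powr (1/4))"
    by (intro continuous_on_powr' continuous_intros assms) auto
  moreover have "kor_dist p q = (cmod (fst p - fst q) ^ 4 + 4 * (snd p - snd q - Im (cnj (fst q) * fst p))\<^sup>2) powr (1/4)" for p q
    using kor_dist_eq[of "fst p" "snd p" "fst q" "snd q"] by simp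
  ultimately show ?thesis by simp
qed

lemma borel_measurable_kor_dist [measurable (raw)]:
  assumes [measurable]: "f \<in> borel_measurable M" "g \<in> borel_measurable M"
  shows "(\<lambda>x. kor_dist (f x) (g x)) \<in> borel_measurable M"
proof -
  have "(\<lambda>z. kor_dist (fst z) (snd z)) \<in> borel_measurable (borel :: (heis \<times> heis) measure)"
    by (intro borel_measurable_continuous_onI continuous_intros)
  from measurable_compose[OF borel_measurable_Pair[OF assms] this] show ?thesis by simp
qed

lemma open_kor_ball: "open (kor_ball x r)"
  unfolding kor_ball_def by (intro open_Collect_less continuous_intros)

lemma closed_kor_cball: "closed (kor_cball x r)"
  unfolding kor_cball_def by (intro closed_Collect_le continuous_intros)

lemma mem_Omega_iff: "(u, t) \<in> Omega \<longleftrightarrow> cmod u ^ 4 + 4 * t\<^sup>2 \<le> 1"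
proof -
  have "kor_dist (u, t) (0, 0) \<le> 1 \<longleftrightarrow> kor_dist (u, t) (0, 0) ^ 4 \<le> 1 ^ 4"
    by (rule kor_dist_le_iff) simp
  then show ?thesis by (simp add: Omega_def kor_cball_def zero_prod_def kor_dist_power4)
qed

lemma Omega_bounds:
  assumes "(u, t) \<in> Omega" shows "cmod u \<le> 1" "\<bar>t\<bar> \<le> 1/2"
proof -
  have *: "cmod u ^ 4 + 4 * t\<^sup>2 \<le> 1" using assms by (simp add: mem_Omega_iff)
  have "cmod u ^ 4 \<le> 1 ^ 4" using * by (smt (verit) power_one zero_le_power2)
  then show "cmod u \<le> 1" by (rule power4_le_imp_le) simp
  have "0 \<le> cmod u ^ 4" by simp
  then have "t\<^sup>2 \<le> 1/4" using * by linarith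
  then have "t\<^sup>2 \<le> (1/2)\<^sup>2" by (simp add: power2_eq_square)
  then show "\<bar>t\<bar> \<le> 1/2" by (metis abs_le_square_iff abs_of_nonneg zero_le_divide_1_iff zero_le_numeral)
qed

lemma compact_Omega: "compact Omega"
proof (rule compact_Int_closed[of "cball 0 1 \<times> {-1/2..1/2}" Omega, THEN back_subst[of compact]])
  show "compact (cball (0::complex) 1 \<times> {-1/2..1/2::real})" by (intro compact_Times) auto
  show "closed Omega" unfolding Omega_def by (rule closed_kor_cball)
  show "cball 0 1 \<times> {-1/2..1/2} \<inter> Omega = Omega"
    using Omega_bounds by (fastforce simp: abs_le_iff)
qed

lemma zero_in_Omega: "0 \<in> Omega"
  using mem_Omega_iff[of 0 0] by (simp add: zero_prod_def)

lemma kor_dist_Omega: assumes "p \<in> Omega" "q \<in> Omega" shows "kor_dist p q \<le> 2"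
  using kor_dist_triangle[of p q 0] assms by (simp add: Omega_def kor_cball_def kor_dist_sym[of 0])

lemma sets_Hmeas [measurable_cong, simp]: "sets Hmeas = sets borel"
  by (simp add: Hmeas_def)

lemma space_Hmeas [simp]: "space Hmeas = UNIV"
  by (simp add: Hmeas_def)

section \<open>Slicing over the plane and the volume of Koranyi balls\<close>

lemma emeasure_lborel_fibres:
  assumes [measurable]: "A \<in> sets (borel :: ('a::euclidean_space \<times> 'b::euclidean_space) measure)"
  shows "emeasure lborel A = (\<integral>\<^sup>+u. emeasure lborel {t. (u, t) \<in> A} \<partial>lborel)"
proof -
  have "emeasure lborel A = emeasure (lborel \<Otimes>\<^sub>M lborel) A" by (simp only: lborel_prod)
  also have "\<dots> = (\<integral>\<^sup>+u. emeasure lborel (Pair u -` A) \<partial>lborel)"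
    by (rule lborel.emeasure_pair_measure_alt) (simp only: lborel_prod sets_lborel assms)
  finally show ?thesis by (simp add: vimage_def)
qed

lemma nn_integral_lborel_fibres:
  assumes [measurable]: "f \<in> borel_measurable (borel :: ('a::euclidean_space \<times> 'b::euclidean_space) measure)"
  shows "(\<integral>\<^sup>+p. f p \<partial>lborel) = (\<integral>\<^sup>+u. \<integral>\<^sup>+t. f (u, t) \<partial>lborel \<partial>lborel)"
  by (subst lborel_prod[symmetric], rule lborel.nn_integral_fst[symmetric]) (simp only: lborel_prod measurable_lborel2 measurable_lborel1 assms)

text \<open>The equation of the ball is quadratic in \<open>t\<close>. The twist moves only the
  centre of the slice; its length depends on \<open>u - v\<close> and \<open>r\<close> alone, which
  is all that the volume computation needs.\<close>

lemma kor_cball_fibre: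
  assumes "r \<ge> 0"
  shows "{t. (u, t) \<in> kor_cball (v, s) r} =
    (if cmod (u - v) \<le> r then {s + Im (cnj v * u) - sqrt (r ^ 4 - cmod (u - v) ^ 4) / 2 ..
      s + Im (cnj v * u) + sqrt (r ^ 4 - cmod (u - v) ^ 4) / 2} else {})"
proof -
  define c where "c = s + Im (cnj v * u)"
  have 1: "(u, t) \<in> kor_cball (v, s) r \<longleftrightarrow> (2 * (t - c))\<^sup>2 \<le> r ^ 4 - cmod (u - v) ^ 4" for t
  proof -
    have "4 * (t - s - Im (cnj v * u))\<^sup>2 = (2 * (t - c))\<^sup>2" by (simp add: c_def power2_eq_square algebra_simps)
    then show ?thesis using assms kor_dist_le_iff[OF assms, of "(u, t)" "(v, s)"]
      unfolding kor_cball_def kor_dist_power4 by auto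
  qed
  have 2: "cmod (u - v) \<le> r \<longleftrightarrow> 0 \<le> r ^ 4 - cmod (u - v) ^ 4"
    using assms power_mono_iff[of "cmod (u - v)" r 4] by auto
  show ?thesis
  proof (cases "cmod (u - v) \<le> r")
    case True
    have "(2 * (t - c))\<^sup>2 \<le> r ^ 4 - cmod (u - v) ^ 4 \<longleftrightarrow> \<bar>2 * (t - c)\<bar> \<le> sqrt (r ^ 4 - cmod (u - v) ^ 4)" for t
      using real_sqrt_le_iff[of "(2 * (t - c))\<^sup>2" "r ^ 4 - cmod (u - v) ^ 4"] by simp
    moreover have "\<bar>2 * (t - c)\<bar> \<le> q \<longleftrightarrow> t \<in> {c - q / 2 .. c + q / 2}" for t q :: real
      by auto
    ultimately show ?thesis unfolding c_def[symmetric] 1 using True by auto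
  next
    case False
    then have "r ^ 4 - cmod (u - v) ^ 4 < 0" using 2 by auto
    then have "\<not> (2 * (t - c))\<^sup>2 \<le> r ^ 4 - cmod (u - v) ^ 4" for t
      using zero_le_power2[of "2 * (t - c)"] by linarith
    then show ?thesis unfolding c_def[symmetric] 1 using False by simp
  qed
qed

text \<open>A planar translation removes the centre. The dilation by \<open>r\<close> then
  contributes one factor \<open>r ^ 2\<close> from the plane and another from the length of the
  slices.\<close>

lemma emeasure_lborel_kor_cball:
  assumes "r \<ge> 0"
  shows "emeasure lborel (kor_cball x r) = ennreal (r ^ 4) * emeasure lborel (kor_cball 0 1)"
proof -
  have [measurable]: "kor_cball x r \<in> sets borel" for x r
    by (intro borel_closed closed_kor_cball)
  define \<phi> where "\<phi> r w = (if cmod w \<le> r then ennreal (sqrt (r ^ 4 - cmod w ^ 4)) else 0)" for r w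
  have [measurable]: "\<phi> r \<in> borel_measurable borel" for r unfolding \<phi>_def by measurable
  have trans: "(\<integral>\<^sup>+u. f (u - v) \<partial>lborel) = (\<integral>\<^sup>+u. f u \<partial>lborel)" if [measurable]: "f \<in> borel_measurable borel" for f and v :: complex
    by (subst (2) lborel_distr_plus[symmetric, of "-v"]) (simp add: nn_integral_distr)
  have gen: "emeasure lborel (kor_cball x r) = (\<integral>\<^sup>+u. \<phi> r u \<partial>lborel)" if "r \<ge> 0" for x r
  proof (cases x)
    case (Pair v s)
    have "emeasure lborel {t. (u, t) \<in> kor_cball (v, s) r} = \<phi> r (u - v)" for u
    proof -
      have "0 \<le> r ^ 4 - cmod (u - v) ^ 4" if "cmod (u - v) \<le> r" using that by (simp add: power_mono)
      then show ?thesis using \<open>r \<ge> 0\<close> unfolding kor_cball_fibre[OF \<open>r \<ge> 0\<close>] \<phi>_def by auto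
    qed
    then show ?thesis unfolding Pair by (simp add: emeasure_lborel_fibres trans)
  qed
  show ?thesis
  proof (cases "r = 0")
    case True
    have "AE u in lborel. \<phi> 0 u = 0" using AE_lborel_singleton[of 0] by eventually_elim (auto simp: \<phi>_def)
    then have "(\<integral>\<^sup>+u. \<phi> 0 u \<partial>lborel) = 0" by (subst nn_integral_0_iff_AE) auto
    then show ?thesis using gen[of r x] True by simp
  next
    case False
    then have r: "r > 0" using assms by simp
    have "(\<integral>\<^sup>+u. \<phi> r u \<partial>lborel) = (\<integral>\<^sup>+u. ennreal (r\<^sup>2) * \<phi> r (r *\<^sub>R u) \<partial>lborel)"
      using r by (subst lborel_affine[of r 0]) (auto simp: nn_integral_density nn_integral_distr )
    also have "\<dots> = (\<integral>\<^sup>+u. ennreal (r\<^sup>2) * (ennreal (r\<^sup>2) * \<phi> 1 u) \<partial>lborel)"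
    proof (intro nn_integral_cong arg_cong2[of _ _ _ _ "(*)"] refl)
      fix u :: complex
      show "\<phi> r (r *\<^sub>R u) = ennreal (r\<^sup>2) * \<phi> 1 u"
      proof -
        have "sqrt (r ^ 4 - r ^ 4 * cmod u ^ 4) = r\<^sup>2 * sqrt (1 - cmod u ^ 4)"
          using real_sqrt_mult[of "(r\<^sup>2)\<^sup>2" "1 - cmod u ^ 4"] real_sqrt_abs[of "r\<^sup>2"]
          by (simp add: algebra_simps flip: power_mult)
        then show ?thesis using r by (simp add: \<phi>_def power_mult_distrib mult_le_cancel_left1 ennreal_mult')
      qed
    qed
    also have "\<dots> = ennreal (r ^ 4) * (\<integral>\<^sup>+u. \<phi> 1 u \<partial>lborel)"
      by (simp add: nn_integral_cmult mult.assoc[symmetric] flip: ennreal_mult power_add)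
    finally show ?thesis using gen[of r x] gen[of 1 0] assms by simp
  qed
qed

text \<open>Both degenerate values have to be excluded, since \<open>inverse\<close> in
  \<open>Hmeas\<close> would turn them into an infinite or a zero density. Positivity comes from a
  product ball around \<open>0\<close> inside the open Koranyi ball.\<close>

lemma emeasure_lborel_kor_cball_unit:
  "emeasure lborel (kor_cball 0 1) \<noteq> 0" "emeasure lborel (kor_cball 0 1) \<noteq> \<infinity>"
proof -
  have "emeasure lborel (kor_cball 0 1) < \<infinity>"
    using compact_Omega unfolding Omega_def by (intro emeasure_bounded_finite compact_imp_bounded)
  then show "emeasure lborel (kor_cball 0 1) \<noteq> \<infinity>" by simp
  have "open (kor_ball 0 1)" by (rule open_kor_ball)
  moreover have "0 \<in> kor_ball 0 1"
    by (simp add: kor_ball_def kor_dist_def kor_norm_def heis_mult_def heis_inv_def)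
  ultimately obtain e where e: "e > 0" "ball 0 e \<subseteq> kor_ball 0 1" by (meson openE)
  have "0 < emeasure lborel (ball (0::heis) e)" using e by (simp add: emeasure_ball unit_ball_vol_pos)
  also have "\<dots> \<le> emeasure lborel (kor_cball 0 1)"
    using e by (intro emeasure_mono) (auto simp: kor_ball_def kor_cball_def borel_closed closed_kor_cball less_imp_le)
  finally show "emeasure lborel (kor_cball 0 1) \<noteq> 0" by simp
qed

definition Hmeas_const :: real where "Hmeas_const = 1 / measure lborel (kor_cball 0 1)"

lemma Hmeas_const_pos: "Hmeas_const > 0"
  using emeasure_lborel_kor_cball_unit
  by (simp add: Hmeas_const_def measure_def enn2real_positive_iff top.not_eq_extremum zero_less_iff_neq_zero)

lemma Hmeas_eq: "Hmeas = density lborel (\<lambda>_. ennreal Hmeas_const)"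
proof -
  have "inverse (emeasure lborel (kor_cball 0 1)) = ennreal Hmeas_const"
    using emeasure_lborel_kor_cball_unit Hmeas_const_pos
    by (simp add: Hmeas_const_def emeasure_eq_ennreal_measure inverse_ennreal divide_inverse )
  then show ?thesis by (simp add: Hmeas_def)
qed

lemma nn_integral_Hmeas:
  assumes [measurable]: "f \<in> borel_measurable borel"
  shows "(\<integral>\<^sup>+p. f p \<partial>Hmeas) = ennreal Hmeas_const * (\<integral>\<^sup>+u. \<integral>\<^sup>+t. f (u, t) \<partial>lborel \<partial>lborel)"
  by (simp add: Hmeas_eq nn_integral_density nn_integral_cmult nn_integral_lborel_fibres)

lemma emeasure_Hmeas: "A \<in> sets borel \<Longrightarrow> emeasure Hmeas A = ennreal Hmeas_const * emeasure lborel A"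
  by (simp add: Hmeas_eq emeasure_density nn_integral_cmult)

lemma emeasure_Hmeas_kor_cball: "r \<ge> 0 \<Longrightarrow> emeasure Hmeas (kor_cball x r) = ennreal (r ^ 4)"
proof -
  assume r: "r \<ge> 0"
  have "emeasure Hmeas (kor_cball x r) = ennreal Hmeas_const * (ennreal (r ^ 4) * emeasure lborel (kor_cball 0 1))"
    using r by (simp add: emeasure_Hmeas borel_closed closed_kor_cball emeasure_lborel_kor_cball[of r x])
  also have "emeasure lborel (kor_cball 0 1) = ennreal (1 / Hmeas_const)"
    using emeasure_lborel_kor_cball_unit by (simp add: Hmeas_const_def emeasure_eq_ennreal_measure)
  finally show ?thesis using Hmeas_const_pos r by (simp flip: ennreal_mult')
qed

text \<open>The cut-out balls are open. They are exhausted by concentric closed balls, whose measure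
  is known.\<close>

lemma emeasure_Hmeas_kor_ball:
  assumes "r \<ge> 0" shows "emeasure Hmeas (kor_ball x r) = ennreal (r ^ 4)"
proof (cases "r = 0")
  case True
  then have "kor_ball x r = {}" by (auto simp: kor_ball_def not_less)
  then show ?thesis using True by simp
next
  case False
  then have r: "r > 0" using assms by simp
  have [measurable]: "kor_cball x r \<in> sets borel" "kor_ball x r \<in> sets borel" for r
    by (auto intro: borel_closed closed_kor_cball borel_open open_kor_ball)
  show ?thesis
  proof (rule antisym)
    show "emeasure Hmeas (kor_ball x r) \<le> ennreal (r ^ 4)"
      unfolding emeasure_Hmeas_kor_cball[OF assms, symmetric, of x]
      by (intro emeasure_mono) (auto simp: kor_ball_def kor_cball_def)
    have "(\<lambda>n. ennreal ((r * (1 - 1 / real (Suc n))) ^ 4)) \<longlonglongrightarrow> ennreal ((r * (1 - 0)) ^ 4)"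
      by (intro tendsto_intros LIMSEQ_inverse_real_of_nat[unfolded inverse_eq_divide])
    then have "(\<lambda>n. ennreal ((r * (1 - 1 / real (Suc n))) ^ 4)) \<longlonglongrightarrow> ennreal (r ^ 4)" by simp
    then show "ennreal (r ^ 4) \<le> emeasure Hmeas (kor_ball x r)"
    proof (rule LIMSEQ_le_const2, intro exI allI impI)
      fix n
      have *: "r * (1 - 1 / real (Suc n)) < r" "r * (1 - 1 / real (Suc n)) \<ge> 0" using r by (auto simp: field_simps)
      have "emeasure Hmeas (kor_cball x (r * (1 - 1 / real (Suc n)))) \<le> emeasure Hmeas (kor_ball x r)"
        using * by (intro emeasure_mono) (auto simp: kor_ball_def kor_cball_def)
      then show "ennreal ((r * (1 - 1 / real (Suc n))) ^ 4) \<le> emeasure Hmeas (kor_ball x r)"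
        using emeasure_Hmeas_kor_cball[OF *(2)] by simp
    qed
  qed
qed

lemma sigma_finite_Hmeas: "sigma_finite_measure Hmeas"
  unfolding Hmeas_eq by (subst sigma_finite_measure.sigma_finite_iff_density_finite[OF sigma_finite_lborel]) auto

section \<open>Void events of the Poisson process\<close>

lemma borel_heis_real: "borel \<Otimes>\<^sub>M borel = (borel :: (heis \<times> real) measure)"
  by (rule borel_prod)

lemma heis_real_pred:
  assumes "Measurable.pred (borel \<Otimes>\<^sub>M borel) P"
  shows "{p :: heis \<times> real. P p} \<in> sets borel"
  using assms unfolding pred_def borel_heis_real by simp

lemma sets_Hmeas_lborel: "sets (Hmeas \<Otimes>\<^sub>M lborel) = sets (borel :: (heis \<times> real) measure)"
  unfolding borel_heis_real[symmetric] by (rule sets_pair_measure_cong) simp_all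

lemma sets_cutout_intensity [measurable_cong, simp]: "sets (cutout_intensity \<gamma>) = sets borel"
  unfolding cutout_intensity_def sets_density sets_Hmeas_lborel ..

lemma space_cutout_intensity [simp]: "space (cutout_intensity \<gamma>) = UNIV"
  by (simp add: cutout_intensity_def space_pair_measure)

lemma cutout_density_measurable [measurable]:
  "(\<lambda>(x, r). indicator {0<..<1} r * ennreal (\<gamma> * r powr (-5))) \<in> borel_measurable (Hmeas \<Otimes>\<^sub>M lborel)"
  by measurable

lemma sigma_finite_cutout_intensity: "sigma_finite_measure (cutout_intensity \<gamma>)"
proof -
  interpret H: sigma_finite_measure Hmeas by (rule sigma_finite_Hmeas)
  interpret P: pair_sigma_finite Hmeas "lborel :: real measure" ..
  show ?thesis
    unfolding cutout_intensity_def
    by (subst P.sigma_finite_iff_density_finite)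
       (auto simp: indicator_def intro!: AE_I2 ennreal_mult_less_top[THEN iffD2, THEN less_imp_neq])
qed

lemma emeasure_cutout_intensity:
  assumes [measurable]: "A \<in> sets borel"
  shows "emeasure (cutout_intensity \<gamma>) A =
    (\<integral>\<^sup>+r. indicator {0<..<1} r * ennreal (\<gamma> * r powr (-5)) * emeasure Hmeas {x. (x, r) \<in> A} \<partial>lborel)"
proof -
  interpret H: sigma_finite_measure Hmeas by (rule sigma_finite_Hmeas)
  interpret P: pair_sigma_finite Hmeas "lborel :: real measure" ..
  have mA [measurable]: "A \<in> sets (Hmeas \<Otimes>\<^sub>M lborel)"
    using assms unfolding sets_Hmeas_lborel .
  have "emeasure (cutout_intensity \<gamma>) A = (\<integral>\<^sup>+p. (\<lambda>(x, r). indicator {0<..<1} r * ennreal (\<gamma> * r powr (-5)) * indicator A (x, r)) p \<partial>(Hmeas \<Otimes>\<^sub>M lborel))"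
    unfolding cutout_intensity_def
    by (subst emeasure_density[OF cutout_density_measurable mA]) (auto intro!: nn_integral_cong)
  also have "\<dots> = (\<integral>\<^sup>+r. \<integral>\<^sup>+x. indicator {0<..<1} r * ennreal (\<gamma> * r powr (-5)) * indicator A (x, r) \<partial>Hmeas \<partial>lborel)"
    by (subst P.nn_integral_snd[symmetric]) simp_all
  also have "\<dots> = (\<integral>\<^sup>+r. indicator {0<..<1} r * ennreal (\<gamma> * r powr (-5)) * emeasure Hmeas {x. (x, r) \<in> A} \<partial>lborel)"
  proof (rule nn_integral_cong)
    fix r :: real
    have 1: "{x. (x, r) \<in> A} = (\<lambda>x. (x, r)) -` A \<inter> space Hmeas" by auto
    have m: "{x. (x, r) \<in> A} \<in> sets Hmeas"
      unfolding 1 by (rule measurable_sets[OF _ mA]) simp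
    have "(\<integral>\<^sup>+x. indicator {0<..<1} r * ennreal (\<gamma> * r powr (-5)) * indicator A (x, r) \<partial>Hmeas)
       = (\<integral>\<^sup>+x. indicator {0<..<1} r * ennreal (\<gamma> * r powr (-5)) * indicator {x. (x, r) \<in> A} x \<partial>Hmeas)"
      by (intro nn_integral_cong) (auto simp: indicator_def)
    also have "\<dots> = indicator {0<..<1} r * ennreal (\<gamma> * r powr (-5)) * emeasure Hmeas {x. (x, r) \<in> A}"
      using m by (rule nn_integral_cmult_indicator)
    finally show "(\<integral>\<^sup>+x. indicator {0<..<1} r * ennreal (\<gamma> * r powr (-5)) * indicator A (x, r) \<partial>Hmeas)
       = indicator {0<..<1} r * ennreal (\<gamma> * r powr (-5)) * emeasure Hmeas {x. (x, r) \<in> A}" .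
  qed
  finally show ?thesis .
qed

text \<open>A region over \<open>y\<close> whose slice at radius \<open>r\<close> is a ball of
  radius \<open>\<rho> r\<close>. Three profiles occur: \<open>r\<close> itself for the balls
  containing \<open>y\<close>, \<open>r\<close> minus a constant for the balls containing a whole
  neighbourhood of \<open>y\<close>, and a constant for all balls centred near the origin.\<close>

lemma cutout_intensity_radial:
  assumes R [measurable]: "R \<in> sets borel" and \<rho> [measurable]: "\<rho> \<in> borel_measurable borel"
    and nn: "\<And>r. r \<in> R \<Longrightarrow> 0 < r \<Longrightarrow> r < 1 \<Longrightarrow> 0 \<le> \<rho> r" and "\<gamma> > 0"
  shows "{p. snd p \<in> R \<and> kor_dist y (fst p) < \<rho> (snd p)} \<in> sets borel"
    and "emeasure (cutout_intensity \<gamma>) {p. snd p \<in> R \<and> kor_dist y (fst p) < \<rho> (snd p)} =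
      (\<integral>\<^sup>+r. ennreal (\<gamma> * r powr (-5) * \<rho> r ^ 4) * indicator (R \<inter> {0<..<1}) r \<partial>lborel)"
proof -
  show *: "{p. snd p \<in> R \<and> kor_dist y (fst p) < \<rho> (snd p)} \<in> sets (borel :: (heis \<times> real) measure)"
    by (rule heis_real_pred) measurable
  show "emeasure (cutout_intensity \<gamma>) {p. snd p \<in> R \<and> kor_dist y (fst p) < \<rho> (snd p)} =
      (\<integral>\<^sup>+r. ennreal (\<gamma> * r powr (-5) * \<rho> r ^ 4) * indicator (R \<inter> {0<..<1}) r \<partial>lborel)"
    unfolding emeasure_cutout_intensity[OF *]
  proof (rule nn_integral_cong)
    fix r :: real
    have "emeasure Hmeas {x. kor_dist y x < \<rho> r} = ennreal (\<rho> r ^ 4)" if "r \<in> R" "0 < r" "r < 1"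
      using emeasure_Hmeas_kor_ball[OF nn[OF that], of y] by (simp add: kor_ball_def kor_dist_sym[of _ y])
    then show "indicator {0<..<1} r * ennreal (\<gamma> * r powr - 5) *
         emeasure Hmeas {x. (x, r) \<in> {p. snd p \<in> R \<and> kor_dist y (fst p) < \<rho> (snd p)}} =
         ennreal (\<gamma> * r powr - 5 * \<rho> r ^ 4) * indicator (R \<inter> {0<..<1}) r"
      using nn[of r] \<open>\<gamma> > 0\<close> by (auto simp: indicator_def ennreal_mult)
  qed
qed

text \<open>The dual cone of \<open>y\<close> in parameter space: survival of \<open>y\<close>
  becomes emptiness of the process in a fixed set, so events about balls turn into void
  events.\<close>

definition hits :: "heis \<Rightarrow> (heis \<times> real) set" where
  "hits y = {p. kor_dist y (fst p) < snd p}"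

definition radii :: "real set \<Rightarrow> (heis \<times> real) set" where
  "radii R = {p. snd p \<in> R}"

lemma radii_borel [measurable]:
  assumes [measurable]: "R \<in> sets borel"
  shows "radii R \<in> sets borel"
  unfolding radii_def by (rule heis_real_pred) measurable

lemma hits_borel [measurable]: "hits y \<in> sets borel"
  unfolding hits_def by (rule heis_real_pred) measurable

text \<open>Volume \<open>r ^ 4\<close> against density \<open>r powr (-5)\<close> leaves
  \<open>1 / r\<close>: the intensity is scale invariant, and survival probabilities become powers
  of the scale.\<close>

lemma nn_integral_log_scale:
  assumes "0 < a" "a \<le> b" "\<gamma> > 0"
  shows "(\<integral>\<^sup>+r. ennreal (\<gamma> * r powr (-5) * r ^ 4) * indicator {a..<b} r \<partial>lborel) = ennreal (\<gamma> * ln (b / a))"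
proof -
  have "(\<integral>\<^sup>+r. ennreal (\<gamma> * r powr (-5) * r ^ 4) * indicator {a..<b} r \<partial>lborel)
      = (\<integral>\<^sup>+r. ennreal (\<gamma> / r) * indicator {a..b} r \<partial>lborel)"
  proof (rule nn_integral_cong_AE)
    show "AE r in lborel. ennreal (\<gamma> * r powr (-5) * r ^ 4) * indicator {a..<b} r = ennreal (\<gamma> / r) * indicator {a..b} r"
      using AE_lborel_singleton[of b]
    proof eventually_elim
      case (elim r)
      have "r powr (-5) * r ^ 4 = 1 / r" if "r > 0"
        using that by (simp add: powr_minus powr_numeral field_simps eval_nat_numeral)
      then show ?case using elim assms by (auto simp: indicator_def mult.assoc)
    qed
  qed
  also have "\<dots> = ennreal (\<gamma> * ln b - \<gamma> * ln a)"
    by (rule nn_integral_FTC_Icc) (use assms in \<open>auto intro!: derivative_eq_intros simp: divide_simps\<close>)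
  also have "\<gamma> * ln b - \<gamma> * ln a = \<gamma> * ln (b / a)"
    using assms by (simp add: ln_div right_diff_distrib)
  finally show ?thesis .
qed

lemma cutout_intensity_hits:
  assumes "0 < a" "a \<le> b" "b \<le> 1" "\<gamma> > 0"
  shows "emeasure (cutout_intensity \<gamma>) (hits y \<inter> radii {a..<b}) = ennreal (\<gamma> * ln (b / a))"
    and "emeasure (cutout_intensity \<gamma>) (hits y \<inter> radii {a..}) = ennreal (\<gamma> * ln (1 / a))"
proof -
  have *: "hits y \<inter> radii R = {p. snd p \<in> R \<and> kor_dist y (fst p) < snd p}" for R
    by (auto simp: hits_def radii_def)
  have "{a..<b} \<inter> {0<..<1} = {a..<b}" "{a..} \<inter> {0<..<1} = {a..<1}" using assms by auto
  then show "emeasure (cutout_intensity \<gamma>) (hits y \<inter> radii {a..<b}) = ennreal (\<gamma> * ln (b / a))"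
    "emeasure (cutout_intensity \<gamma>) (hits y \<inter> radii {a..}) = ennreal (\<gamma> * ln (1 / a))"
    using assms nn_integral_log_scale[of a b \<gamma>] nn_integral_log_scale[of a 1 \<gamma>]
      cutout_intensity_radial(2)[of "{a..<b}" "\<lambda>r. r" \<gamma> y] cutout_intensity_radial(2)[of "{a..}" "\<lambda>r. r" \<gamma> y]
    unfolding * by simp_all
qed

section \<open>Void probabilities and independence over disjoint regions\<close>

locale poisson_cutout =
  fixes M :: "'w measure" and Y :: "'w \<Rightarrow> (heis \<times> real) set" and \<gamma> :: real
  assumes gamma_pos: "0 < \<gamma>" and pp: "poisson_pp M Y (cutout_intensity \<gamma>)"

sublocale poisson_cutout \<subseteq> prob_space M
  using pp by (simp add: poisson_pp_def)

context poisson_cutout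
begin

abbreviation \<nu> :: "(heis \<times> real) measure" where "\<nu> \<equiv> cutout_intensity \<gamma>"

definition void :: "(heis \<times> real) set \<Rightarrow> 'w set" where
  "void A = {\<omega>\<in>space M. Y \<omega> \<inter> A = {}}"

lemma poisson_count:
  assumes "A \<in> sets borel" "emeasure \<nu> A < \<infinity>"
  shows "{\<omega>\<in>space M. finite (Y \<omega> \<inter> A) \<and> card (Y \<omega> \<inter> A) = k} \<in> events"
    "prob {\<omega>\<in>space M. finite (Y \<omega> \<inter> A) \<and> card (Y \<omega> \<inter> A) = k} = exp (- measure \<nu> A) * measure \<nu> A ^ k / fact k"
  using pp assms unfolding poisson_pp_def by auto

lemma void_finite:
  assumes "A \<in> sets borel" "emeasure \<nu> A < \<infinity>"
  shows "void A \<in> events" "prob (void A) = exp (- measure \<nu> A)"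
proof -
  \<comment> \<open>The conjunct \<open>finite\<close> matters here: \<open>card\<close> of an
    infinite set is \<open>0\<close>.\<close>
  have "void A = {\<omega>\<in>space M. finite (Y \<omega> \<inter> A) \<and> card (Y \<omega> \<inter> A) = 0}"
    unfolding void_def by auto
  then show "void A \<in> events" "prob (void A) = exp (- measure \<nu> A)"
    using poisson_count[OF assms, of 0] by simp_all
qed

lemma void_UN: "I \<noteq> {} \<Longrightarrow> void (\<Union>i\<in>I. A i) = (\<Inter>i\<in>I. void (A i))"
  unfolding void_def by auto

lemma void_Un: "void (A \<union> B) = void A \<inter> void B"
  unfolding void_def by auto

text \<open>Void events form a \<open>\<pi>\<close>-system, so void probabilities alone yield independence of the
  information carried by the process in disjoint regions.\<close>

definition Fgen :: "(heis \<times> real) set \<Rightarrow> 'w set set" where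
  "Fgen R = {void A | A. A \<in> sets borel \<and> A \<subseteq> R \<and> emeasure \<nu> A < \<infinity>}"

definition Fsig :: "(heis \<times> real) set \<Rightarrow> 'w measure" where
  "Fsig R = sigma (space M) (Fgen R)"

lemma Fgen_subset: "Fgen R \<subseteq> events"
  unfolding Fgen_def using void_finite(1) by auto

lemma Fgen_Pow: "Fgen R \<subseteq> Pow (space M)"
  unfolding Fgen_def void_def by auto

lemma space_Fsig [simp]: "space (Fsig R) = space M"
  unfolding Fsig_def by (rule space_measure_of[OF Fgen_Pow])

lemma sets_Fsig: "sets (Fsig R) = sigma_sets (space M) (Fgen R)"
  unfolding Fsig_def by (rule sets_measure_of[OF Fgen_Pow])

lemma sets_Fsig_subset: "sets (Fsig R) \<subseteq> events"
  unfolding sets_Fsig by (rule sets.sigma_sets_subset[OF Fgen_subset])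

text \<open>Void probabilities are given only for regions of finite intensity. By sigma-finiteness
  the void event of any Borel region is a countable intersection of void events of that
  kind.\<close>

lemma void_Fsig:
  assumes "A \<in> sets borel" "A \<subseteq> R"
  shows "void A \<in> sets (Fsig R)"
proof -
  interpret N: sigma_finite_measure \<nu> by (rule sigma_finite_cutout_intensity)
  obtain F :: "nat \<Rightarrow> (heis \<times> real) set" where F: "range F \<subseteq> sets \<nu>" "(\<Union>i. F i) = space \<nu>"
      "\<And>i. emeasure \<nu> (F i) \<noteq> \<infinity>"
    by (rule N.sigma_finite) blast
  have "void (A \<inter> F i) \<in> sets (Fsig R)" for i
  proof -
    have "emeasure \<nu> (A \<inter> F i) \<le> emeasure \<nu> (F i)" using F assms by (intro emeasure_mono) auto
    also have "\<dots> < \<infinity>" using F(3)[of i] by (simp add: top.not_eq_extremum)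
    finally have "void (A \<inter> F i) \<in> Fgen R" using assms F unfolding Fgen_def by auto
    then show ?thesis unfolding sets_Fsig by auto
  qed
  moreover have "void A = (\<Inter>i. void (A \<inter> F i))"
  proof -
    have "A = (\<Union>i. A \<inter> F i)" using F(2) by auto
    then show ?thesis using void_UN[of UNIV "\<lambda>i. A \<inter> F i"] by simp
  qed
  ultimately show ?thesis by auto
qed

lemma void_events [measurable]: "A \<in> sets borel \<Longrightarrow> void A \<in> events"
  using void_Fsig[of A UNIV] sets_Fsig_subset by auto

text \<open>\<open>Y \<omega>\<close> may have points anywhere in the parameter space; this discards
  regions off the support of the intensity, such as radii of at least \<open>1\<close>.\<close>

lemma void_null:
  assumes "A \<in> sets borel" "emeasure \<nu> A = 0"
  shows "AE \<omega> in M. Y \<omega> \<inter> A = {}"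
proof -
  have "prob (void A) = 1" using void_finite[of A] assms by (simp add: measure_def)
  from AE_in_set_eq_1[OF void_events[OF assms(1)], THEN iffD2, OF this]
  show ?thesis by eventually_elim (auto simp: void_def)
qed

lemma Int_stable_Fgen: "Int_stable (Fgen R)"
proof (rule Int_stableI)
  fix a b assume "a \<in> Fgen R" "b \<in> Fgen R"
  then obtain A B where *: "a = void A" "b = void B" "A \<in> sets borel" "A \<subseteq> R" "emeasure \<nu> A < \<infinity>"
     "B \<in> sets borel" "B \<subseteq> R" "emeasure \<nu> B < \<infinity>"
    unfolding Fgen_def by auto
  have "emeasure \<nu> (A \<union> B) \<le> emeasure \<nu> A + emeasure \<nu> B" using * by (intro emeasure_subadditive) auto
  also have "\<dots> < \<infinity>" using * by simp
  finally show "a \<inter> b \<in> Fgen R" unfolding Fgen_def using * void_Un[of A B, symmetric] by blast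
qed

text \<open>An intersection of void events is the void event of the union. For disjoint regions the
  intensity is additive, and the exponential turns the sum into a product; stability under
  intersection extends this to the generated algebras.\<close>

lemma indep_sets_Fsig:
  assumes "disjoint_family_on R J"
  shows "indep_sets (\<lambda>j. sets (Fsig (R j))) J"
  unfolding sets_Fsig
proof (rule indep_sets_sigma[OF _ Int_stable_Fgen], rule indep_setsI)
  show "Fgen (R i) \<subseteq> events" for i by (rule Fgen_subset)
  fix A J' assume J': "J' \<noteq> {}" "J' \<subseteq> J" "finite J'" "\<forall>j\<in>J'. A j \<in> Fgen (R j)"
  then have "\<forall>j\<in>J'. \<exists>B. A j = void B \<and> B \<in> sets borel \<and> B \<subseteq> R j \<and> emeasure \<nu> B < \<infinity>"
    unfolding Fgen_def by blast
  then obtain B where B: "\<And>j. j \<in> J' \<Longrightarrow> A j = void (B j) \<and> B j \<in> sets borel \<and> B j \<subseteq> R j \<and> emeasure \<nu> (B j) < \<infinity>"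
    by metis
  have disj: "disjoint_family_on B J'"
    using assms B J'(2) unfolding disjoint_family_on_def by blast
  have "(\<Inter>j\<in>J'. A j) = void (\<Union>j\<in>J'. B j)" using J' B by (simp add: void_UN)
  moreover have "emeasure \<nu> (\<Union>j\<in>J'. B j) < \<infinity>"
  proof -
    have "emeasure \<nu> (\<Union>j\<in>J'. B j) \<le> (\<Sum>j\<in>J'. emeasure \<nu> (B j))"
      using B J' by (intro emeasure_subadditive_finite) auto
    also have "\<dots> < \<infinity>" using B J' by (simp add: less_top sum_Pinfty)
    finally show ?thesis .
  qed
  moreover have "(\<Union>j\<in>J'. B j) \<in> sets borel" using B J' by auto
  ultimately have "prob (\<Inter>j\<in>J'. A j) = exp (- measure \<nu> (\<Union>j\<in>J'. B j))"
    using void_finite by simp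
  also have "measure \<nu> (\<Union>j\<in>J'. B j) = (\<Sum>j\<in>J'. measure \<nu> (B j))"
    using B J' disj by (intro measure_finite_Union) (auto simp: less_top)
  also have "exp (- \<dots>) = (\<Prod>j\<in>J'. exp (- measure \<nu> (B j)))"
    using J' by (simp add: exp_sum sum_negf[symmetric] del: sum_negf)
  also have "\<dots> = (\<Prod>j\<in>J'. prob (A j))"
    using B void_finite by (intro prod.cong) auto
  finally show "prob (\<Inter>j\<in>J'. A j) = (\<Prod>j\<in>J'. prob (A j))" .
qed

text \<open>An open \<open>W\<close> is a countable union of open rectangles, so the failure of the
  event is a countable union of products of an open set with the complement of a void event. Joint
  measurability in the point and the sample thus comes from void events alone.\<close>

lemma joint_void_measurable:
  fixes W :: "('y::second_countable_topology \<times> (heis \<times> real)) set"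
  assumes "open W" and S: "S \<in> sets borel" "S \<subseteq> R"
  shows "{z \<in> space (borel \<Otimes>\<^sub>M Fsig R). Y (snd z) \<inter> {p\<in>S. (fst z, p) \<in> W} = {}} \<in> sets (borel \<Otimes>\<^sub>M Fsig R)"
proof -
  obtain B1 :: "'y set set" where B1: "countable B1" "topological_basis B1"
    using ex_countable_basis by auto
  obtain B2 :: "(heis \<times> real) set set" where B2: "countable B2" "topological_basis B2"
    using ex_countable_basis by auto
  define K where "K = {(U, V). U \<in> B1 \<and> V \<in> B2 \<and> U \<times> V \<subseteq> W}"
  have "countable K" unfolding K_def
    by (rule countable_subset[of _ "B1 \<times> B2"]) (auto intro: B1 B2)
  have 1: "U \<times> V \<subseteq> W" "open U" "open V" if "(U, V) \<in> K" for U V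
    using that B1 B2 by (auto simp: K_def topological_basis_open)
  have 2: "\<exists>(U, V)\<in>K. y \<in> U \<and> p \<in> V" if W: "(y, p) \<in> W" for y p
  proof -
    from open_prod_elim[OF \<open>open W\<close> W] obtain U V where UV: "open U" "open V" "(y, p) \<in> U \<times> V" "U \<times> V \<subseteq> W" .
    obtain U' where U': "U' \<in> B1" "y \<in> U'" "U' \<subseteq> U" using B1 UV by (auto elim: topological_basisE)
    obtain V' where V': "V' \<in> B2" "p \<in> V'" "V' \<subseteq> V" using B2 UV by (auto elim: topological_basisE)
    show ?thesis using U' V' UV unfolding K_def by (intro bexI[of _ "(U', V')"]) auto
  qed
  have eq: "{z \<in> space (borel \<Otimes>\<^sub>M Fsig R). Y (snd z) \<inter> {p\<in>S. (fst z, p) \<in> W} = {}}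
     = space (borel \<Otimes>\<^sub>M Fsig R) - (\<Union>(U, V)\<in>K. U \<times> (space M - void (V \<inter> S)))"
    using 1 2 by (fastforce simp: space_pair_measure void_def)
  have "U \<times> (space M - void (V \<inter> S)) \<in> sets (borel \<Otimes>\<^sub>M Fsig R)" if "(U, V) \<in> K" for U V
  proof (rule pair_measureI)
    show "U \<in> sets borel" using 1[OF that] by auto
    have "void (V \<inter> S) \<in> sets (Fsig R)" using 1[OF that] S by (intro void_Fsig) auto
    from sets.compl_sets[OF this] show "space M - void (V \<inter> S) \<in> sets (Fsig R)" by simp
  qed
  then show ?thesis unfolding eq using \<open>countable K\<close>
    by (intro sets.Diff sets.countable_UN') auto
qed

end

section \<open>Cut-out sets and weak limits\<close>

lemma mem_cutout_set_n:
  "y \<in> cutout_set_n Y n \<omega> \<longleftrightarrow> y \<in> Omega \<and> Y \<omega> \<inter> (hits y \<inter> radii {2 powr (- real n)..}) = {}"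
  unfolding cutout_set_n_def hits_def radii_def kor_ball_def by auto

lemma mem_cutout_set: "y \<in> cutout_set Y \<omega> \<longleftrightarrow> y \<in> Omega \<and> Y \<omega> \<inter> hits y = {}"
  unfolding cutout_set_def hits_def kor_ball_def by auto

lemma mem_cutout_set_Suc:
  "y \<in> cutout_set_n Y (Suc n) \<omega> \<longleftrightarrow> y \<in> cutout_set_n Y n \<omega> \<and>
     Y \<omega> \<inter> (hits y \<inter> radii {2 powr (- real (Suc n))..<2 powr (- real n)}) = {}"
proof -
  have *: "a \<le> b \<Longrightarrow> {a..} = {b..} \<union> {a..<b}" for a b :: real by auto
  have "2 powr (- real (Suc n)) \<le> 2 powr (- real n)" by (rule powr_mono) auto
  then have "{2 powr (- real (Suc n))..} = {2 powr (- real n)..} \<union> {2 powr (- real (Suc n))..<2 powr (- real n)}"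
    using *[of "2 powr (- real (Suc n))"] by blast
  then have "radii {2 powr (- real (Suc n))..} =
      radii {2 powr (- real n)..} \<union> radii {2 powr (- real (Suc n))..<2 powr (- real n)}"
    unfolding radii_def by blast
  then show ?thesis unfolding mem_cutout_set_n by blast
qed

lemma cutout_set_n_decreasing: "m \<le> n \<Longrightarrow> cutout_set_n Y n \<omega> \<subseteq> cutout_set_n Y m \<omega>"
  by (rule lift_Suc_antimono_le[of "\<lambda>n. cutout_set_n Y n \<omega>"]) (auto simp: mem_cutout_set_Suc)

lemma cutout_set_n_subset: "cutout_set_n Y n \<omega> \<subseteq> Omega"
  by (auto simp: cutout_set_n_def)

text \<open>A ball that contains a point has positive radius, hence is taken into account from some
  stage on.\<close>

lemma cutout_set_eq_INT: "cutout_set Y \<omega> = (\<Inter>n. cutout_set_n Y n \<omega>)"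
proof -
  have "\<exists>n. 2 powr (- real n) \<le> r" if "r > 0" for r :: real
  proof -
    obtain n where "(1/2) ^ n < r" using real_arch_pow_inv[of r "1/2"] \<open>r > 0\<close> by auto
    then show ?thesis by (auto simp: powr_minus powr_realpow power_divide divide_simps intro!: exI[of _ n])
  qed
  note small = this
  have "hits y = (\<Union>n. hits y \<inter> radii {2 powr (- real n)..})" for y
  proof (intro equalityI subsetI)
    fix p assume p: "p \<in> hits y"
    then have "0 < snd p" using le_less_trans[OF kor_dist_nonneg] unfolding hits_def by blast
    then obtain n where "2 powr (- real n) \<le> snd p" using small by blast
    then show "p \<in> (\<Union>n. hits y \<inter> radii {2 powr (- real n)..})" using p unfolding radii_def by blast
  qed blast
  then have "Y \<omega> \<inter> hits y = {} \<longleftrightarrow> (\<forall>n. Y \<omega> \<inter> (hits y \<inter> radii {2 powr (- real n)..}) = {})" for y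
    by blast
  then show ?thesis by (auto simp: mem_cutout_set mem_cutout_set_n)
qed

lemma closed_cutout_set_n: "closed (cutout_set_n Y n \<omega>)"
proof -
  have "open (\<Union>(x, r)\<in>{(x, r)\<in>Y \<omega>. r \<ge> 2 powr (- real n)}. kor_ball x r)"
    by (auto intro!: open_UN open_kor_ball)
  then show ?thesis unfolding cutout_set_n_def Omega_def by (intro closed_Diff closed_kor_cball)
qed

lemma compact_cutout_set_n: "compact (cutout_set_n Y n \<omega>)"
  using compact_Int_closed[OF compact_Omega closed_cutout_set_n] cutout_set_n_subset
  by (metis inf.absorb_iff2)

lemma compact_cutout_set: "compact (cutout_set Y \<omega>)"
proof -
  have "closed (cutout_set Y \<omega>)" unfolding cutout_set_eq_INT by (auto intro: closed_cutout_set_n)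
  from compact_Int_closed[OF compact_Omega this] show ?thesis
    by (metis cutout_set_def Diff_subset inf.absorb_iff2)
qed

lemma cutout_set_n_borel [measurable]: "cutout_set_n Y n \<omega> \<in> sets borel"
  by (intro borel_closed closed_cutout_set_n)

section \<open>Stage measures and their weak limits\<close>

lemma sets_cutout_meas_n [simp, measurable_cong]: "sets (cutout_meas_n M Y n \<omega>) = sets borel"
  by (simp add: cutout_meas_n_def)

lemma emeasure_cutout_meas_n:
  assumes [measurable]: "U \<in> sets borel"
  shows "emeasure (cutout_meas_n M Y n \<omega>) U =
    ennreal (cutout_beta M Y n) * (\<integral>\<^sup>+y. indicator U y * indicator (cutout_set_n Y n \<omega>) y \<partial>Hmeas)"
  unfolding cutout_meas_n_def
  by (subst emeasure_density) (auto intro!: nn_integral_cong simp: ac_simps simp flip: nn_integral_cmult)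

lemma emeasure_Hmeas_Omega: "emeasure Hmeas Omega = 1"
  using emeasure_Hmeas_kor_cball[of 1 0] by (simp add: Omega_def)

lemma finite_cutout_meas_n: "finite_measure (cutout_meas_n M Y n \<omega>)"
proof
  have [measurable]: "Omega \<in> sets borel" by (intro borel_compact compact_Omega)
  have "(\<integral>\<^sup>+y. indicator UNIV y * indicator (cutout_set_n Y n \<omega>) y \<partial>Hmeas) \<le> (\<integral>\<^sup>+y. indicator Omega y \<partial>Hmeas)"
    using cutout_set_n_subset[of Y n \<omega>] by (intro nn_integral_mono) (auto simp: indicator_def)
  also have "\<dots> = 1" by (simp add: emeasure_Hmeas_Omega)
  finally show "emeasure (cutout_meas_n M Y n \<omega>) (space (cutout_meas_n M Y n \<omega>)) \<noteq> \<infinity>"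
    using emeasure_cutout_meas_n[of UNIV M Y n \<omega>]
    by (auto simp: cutout_meas_n_def[THEN arg_cong[of _ _ space]] ennreal_mult_eq_top_iff top_unique)
qed

text \<open>The portmanteau inequality, for test functions of compact support. \<open>g k\<close>
  multiplies a distance ramp inside \<open>U\<close> by a radial cut-off that vanishes outside the
  ball of radius \<open>k\<close>. It tends pointwise to the indicator of \<open>U\<close>, and
  Fatou's lemma passes from \<open>g k\<close> to \<open>U\<close>.\<close>

lemma weak_star_conv_open_liminf:
  fixes m :: "nat \<Rightarrow> 'a::euclidean_space measure"
  assumes conv: "weak_star_conv m \<mu>" and \<mu>: "sets \<mu> = sets borel" "finite_measure \<mu>"
    and m: "\<And>n. sets (m n) = sets borel" "\<And>n. finite_measure (m n)" and U: "open U"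
  shows "emeasure \<mu> U \<le> liminf (\<lambda>n. emeasure (m n) U)"
proof -
  interpret \<mu>: finite_measure \<mu> by fact
  \<comment> \<open>The case \<open>U = UNIV\<close> is separate because \<open>infdist\<close> to
    the empty complement is \<open>0\<close>.\<close>
  define h where "h k x = (if U = UNIV then 1 else min 1 (real k * infdist x (- U)))" for k x
  define g where "g k x = h k x * max 0 (min 1 (real k - norm x))" for k x
  have cont: "continuous_on UNIV (g k)" for k
    unfolding g_def h_def by (cases "U = UNIV") (auto intro!: continuous_intros)
  have [measurable]: "g k \<in> borel_measurable borel" for k
    by (intro borel_measurable_continuous_onI cont)
  have h01: "0 \<le> h k x" "h k x \<le> 1" for k x by (auto simp: h_def infdist_nonneg)
  have g01: "0 \<le> g k x" "g k x \<le> 1" for k x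
    unfolding g_def using h01[of k x] by (auto intro!: mult_le_one)
  have hU: "h k x = 0" if "x \<notin> U" for k x using that by (auto simp: h_def)
  have gU: "ennreal (g k x) \<le> indicator U x" for k x
    using hU[of x k] g01[of k x] by (auto simp: g_def indicator_def ennreal_le_1)
  have lim: "(\<lambda>k. ennreal (g k x)) \<longlonglongrightarrow> indicator U x" for x
  proof (cases "x \<in> U")
    case False then show ?thesis by (simp add: g_def hU)
  next
    case True
    have "eventually (\<lambda>k. h k x = 1) sequentially"
    proof (cases "U = UNIV")
      case True then show ?thesis by (simp add: h_def)
    next
      case False
      have "infdist x (- U) > 0"
        using False True \<open>open U\<close> by (subst infdist_pos_not_in_closed) auto
      then have "eventually (\<lambda>k. real k \<ge> 1 / infdist x (- U)) sequentially"
        by (meson eventually_sequentiallyI le_trans of_nat_le_iff real_nat_ceiling_ge order_trans)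
      then show ?thesis
        by eventually_elim (use \<open>infdist x (- U) > 0\<close> in \<open>auto simp: h_def field_simps min_def\<close>)
    qed
    moreover have "eventually (\<lambda>k. real k \<ge> 1 + norm x) sequentially"
      by (meson eventually_sequentiallyI le_trans of_nat_le_iff real_nat_ceiling_ge order_trans)
    ultimately have "eventually (\<lambda>k. ennreal (g k x) = indicator U x) sequentially"
      by eventually_elim (use True in \<open>auto simp: g_def\<close>)
    then show ?thesis by (rule tendsto_eventually)
  qed
  have int: "integrable N (g k)" if "sets N = sets borel" "finite_measure N" for N k
  proof -
    interpret finite_measure N by fact
    have "g k \<in> borel_measurable N" using that by (simp add: measurable_cong_sets[OF that(1) refl])
    then show ?thesis using g01[of k] by (intro integrable_const_bound[of _ 1]) auto
  qed
  have meas: "g k \<in> borel_measurable N" if "sets N = sets borel" for N k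
    by (simp add: measurable_cong_sets[OF that refl])
  have step: "(\<integral>\<^sup>+x. ennreal (g k x) \<partial>\<mu>) \<le> liminf (\<lambda>n. emeasure (m n) U)" for k
  proof -
    have "\<forall>x. x \<notin> cball 0 (real k) \<longrightarrow> g k x = 0" by (auto simp: g_def)
    then have "(\<lambda>n. \<integral>x. g k x \<partial>m n) \<longlonglongrightarrow> (\<integral>x. g k x \<partial>\<mu>)"
      using conv cont[of k] compact_cball[of 0 "real k"] unfolding weak_star_conv_def by blast
    then have "(\<lambda>n. ennreal (\<integral>x. g k x \<partial>m n)) \<longlonglongrightarrow> ennreal (\<integral>x. g k x \<partial>\<mu>)" by (rule tendsto_ennrealI)
    moreover have "ennreal (\<integral>x. g k x \<partial>N) = (\<integral>\<^sup>+x. ennreal (g k x) \<partial>N)"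
      if "sets N = sets borel" "finite_measure N" for N
      by (rule nn_integral_eq_integral[symmetric]) (use int[OF that] g01 in auto)
    ultimately have "(\<lambda>n. \<integral>\<^sup>+x. ennreal (g k x) \<partial>m n) \<longlonglongrightarrow> (\<integral>\<^sup>+x. ennreal (g k x) \<partial>\<mu>)"
      using m \<mu> by simp
    then have "(\<integral>\<^sup>+x. ennreal (g k x) \<partial>\<mu>) = liminf (\<lambda>n. \<integral>\<^sup>+x. ennreal (g k x) \<partial>m n)"
      by (simp add: lim_imp_Liminf)
    also have "\<dots> \<le> liminf (\<lambda>n. emeasure (m n) U)"
    proof (rule Liminf_mono, rule always_eventually, rule allI)
      fix n
      have "(\<integral>\<^sup>+x. ennreal (g k x) \<partial>m n) \<le> (\<integral>\<^sup>+x. indicator U x \<partial>m n)" by (intro nn_integral_mono gU)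
      then show "(\<integral>\<^sup>+x. ennreal (g k x) \<partial>m n) \<le> emeasure (m n) U" using m U by simp
    qed
    finally show ?thesis .
  qed
  have "emeasure \<mu> U = (\<integral>\<^sup>+x. indicator U x \<partial>\<mu>)" using \<mu> U by simp
  also have "\<dots> = (\<integral>\<^sup>+x. liminf (\<lambda>k. ennreal (g k x)) \<partial>\<mu>)"
    by (intro nn_integral_cong) (simp add: lim_imp_Liminf[OF _ lim])
  also have "\<dots> \<le> liminf (\<lambda>k. \<integral>\<^sup>+x. ennreal (g k x) \<partial>\<mu>)"
    by (intro nn_integral_liminf measurable_compose[OF meas[OF \<mu>(1)] measurable_ennreal])
  also have "\<dots> \<le> liminf (\<lambda>k. liminf (\<lambda>n. emeasure (m n) U))"
    by (intro Liminf_mono always_eventually allI step)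
  finally show ?thesis by (simp add: Liminf_const)
qed

text \<open>The complement of stage \<open>k\<close> is open and null for every later stage measure,
  so the limit gives it no mass; these complements exhaust the complement of the cut-out
  set.\<close>

lemma weak_limit_concentrated:
  assumes conv: "weak_star_conv (\<lambda>n. cutout_meas_n M Y n \<omega>) \<mu>"
    and \<mu>: "sets \<mu> = sets borel" "finite_measure \<mu>"
  shows "emeasure \<mu> (- cutout_set Y \<omega>) = 0"
proof -
  have "emeasure \<mu> (- cutout_set_n Y k \<omega>) = 0" for k
  proof -
    have "open (- cutout_set_n Y k \<omega>)" by (intro open_Compl closed_cutout_set_n)
    then have "emeasure \<mu> (- cutout_set_n Y k \<omega>)
        \<le> liminf (\<lambda>n. emeasure (cutout_meas_n M Y n \<omega>) (- cutout_set_n Y k \<omega>))"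
      by (intro weak_star_conv_open_liminf conv \<mu> finite_cutout_meas_n) simp_all
    also have "eventually (\<lambda>n. emeasure (cutout_meas_n M Y n \<omega>) (- cutout_set_n Y k \<omega>) = 0) sequentially"
    proof (rule eventually_sequentiallyI[of k])
      fix n assume "k \<le> n"
      then have "indicator (- cutout_set_n Y k \<omega>) y * indicator (cutout_set_n Y n \<omega>) y = (0::ennreal)" for y
        using cutout_set_n_decreasing[of k n Y \<omega>] by (auto simp: indicator_def)
      then have *: "(\<lambda>y. indicator (- cutout_set_n Y k \<omega>) y * indicator (cutout_set_n Y n \<omega>) y) = (\<lambda>_. 0::ennreal)"
        by (rule ext)
      show "emeasure (cutout_meas_n M Y n \<omega>) (- cutout_set_n Y k \<omega>) = 0"
        by (subst emeasure_cutout_meas_n) (simp_all add: * del: mult_eq_0_iff)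
    qed
    then have "liminf (\<lambda>n. emeasure (cutout_meas_n M Y n \<omega>) (- cutout_set_n Y k \<omega>)) = liminf (\<lambda>n. 0)"
      by (rule Liminf_eq)
    finally show ?thesis by (simp add: Liminf_const)
  qed
  moreover have "- cutout_set Y \<omega> = (\<Union>k. - cutout_set_n Y k \<omega>)" by (auto simp: cutout_set_eq_INT)
  ultimately show ?thesis using \<mu> by (auto intro!: emeasure_UN_eq_0)
qed

section \<open>Survival probabilities of one and of two points\<close>

context poisson_cutout
begin

text \<open>By scale invariance each dyadic layer of radii carries the same intensity, whatever
  \<open>n\<close> and \<open>y\<close>.\<close>

lemma measure_hits:
  "emeasure \<nu> (hits y \<inter> radii {2 powr (- real n)..}) = ennreal (\<gamma> * (real n * ln 2))"
  "emeasure \<nu> (hits y \<inter> radii {2 powr (- real (Suc n))..<2 powr (- real n)}) = ennreal (\<gamma> * ln 2)"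
proof -
  have *: "2 powr (- real n) \<le> 1" "2 powr (- real (Suc n)) \<le> 2 powr (- real n)" for n
    using powr_mono[of "- real n" 0 "2::real"] powr_mono[of "- real (Suc n)" "- real n" "2::real"] by simp_all
  have "ln (1 / 2 powr (- real n)) = real n * ln 2" by (simp add: ln_div ln_powr)
  then show "emeasure \<nu> (hits y \<inter> radii {2 powr (- real n)..}) = ennreal (\<gamma> * (real n * ln 2))"
    using cutout_intensity_hits(2)[of "2 powr (- real n)" 1 \<gamma> y] * gamma_pos by simp
  have "2 powr (- real n) / 2 powr (- real (Suc n)) = 2"
    by (simp add: powr_diff[symmetric])
  then show "emeasure \<nu> (hits y \<inter> radii {2 powr (- real (Suc n))..<2 powr (- real n)}) = ennreal (\<gamma> * ln 2)"
    using cutout_intensity_hits(1)[of "2 powr (- real (Suc n))" "2 powr (- real n)" \<gamma> y] *[of n] gamma_pos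
    by (simp del: of_nat_Suc)
qed

lemma prob_void_hits: "prob (void (hits y \<inter> radii {2 powr (- real n)..})) = 2 powr (- \<gamma> * real n)"
proof -
  have "measure \<nu> (hits y \<inter> radii {2 powr (- real n)..}) = \<gamma> * (real n * ln 2)"
    using gamma_pos by (simp add: measure_hits measure_def)
  then show ?thesis
    using void_finite(2)[of "hits y \<inter> radii {2 powr (- real n)..}"]
    by (simp add: measure_hits powr_def[of 2 "- (\<gamma> * real n)"])
qed

lemma prob_void_layer:
  "prob (void (hits y \<inter> radii {2 powr (- real (Suc n))..<2 powr (- real n)})) = 2 powr (- \<gamma>)"
proof -
  have "measure \<nu> (hits y \<inter> radii {2 powr (- real (Suc n))..<2 powr (- real n)}) = \<gamma> * ln 2"
    using gamma_pos by (simp add: measure_hits measure_def del: of_nat_Suc)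
  then show ?thesis
    using void_finite(2)[of "hits y \<inter> radii {2 powr (- real (Suc n))..<2 powr (- real n)}"]
    by (simp add: measure_hits powr_def[of 2 "- \<gamma>"] del: of_nat_Suc)
qed

lemma cutout_beta_eq: "cutout_beta M Y n = 2 powr (\<gamma> * real n)"
proof -
  have "{\<omega> \<in> space M. 0 \<in> cutout_set_n Y n \<omega>} = void (hits 0 \<inter> radii {2 powr (- real n)..})"
    using zero_in_Omega by (auto simp: void_def mem_cutout_set_n)
  then show ?thesis unfolding cutout_beta_def by (simp only: prob_void_hits) (simp add: powr_minus divide_simps)
qed

text \<open>The algebra of the balls of radius at least \<open>2 powr (- real n)\<close> is used
  rather than that of \<open>M\<close>: independence of the next layer requires stage
  \<open>n\<close> to be determined by these balls.\<close>

lemma cutout_indicator_measurable: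
  "(\<lambda>z. indicator (cutout_set_n Y n (snd z)) (fst z) :: ennreal)
     \<in> borel_measurable (borel \<Otimes>\<^sub>M Fsig (radii {2 powr (- real n)..}))"
proof -
  let ?S = "radii {2 powr (- real n)..}" and ?W = "{z. kor_dist (fst z) (fst (snd z)) < snd (snd z)}"
  have "open ?W" by (intro open_Collect_less continuous_intros)
  from joint_void_measurable[OF this _ order_refl, of ?S]
  have 1: "{z \<in> space (borel \<Otimes>\<^sub>M Fsig ?S). Y (snd z) \<inter> {p\<in>?S. (fst z, p) \<in> ?W} = {}} \<in> sets (borel \<Otimes>\<^sub>M Fsig ?S)"
    by simp
  have [measurable]: "Omega \<in> sets borel" by (intro borel_compact compact_Omega)
  have 2: "{z \<in> space (borel \<Otimes>\<^sub>M Fsig ?S). fst z \<in> Omega} \<in> sets (borel \<Otimes>\<^sub>M Fsig ?S)" by measurable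
  have "{z \<in> space (borel \<Otimes>\<^sub>M Fsig ?S). fst z \<in> cutout_set_n Y n (snd z)} =
      {z \<in> space (borel \<Otimes>\<^sub>M Fsig ?S). Y (snd z) \<inter> {p\<in>?S. (fst z, p) \<in> ?W} = {}} \<inter>
      {z \<in> space (borel \<Otimes>\<^sub>M Fsig ?S). fst z \<in> Omega}"
    by (auto simp: mem_cutout_set_n hits_def)
  also have "\<dots> \<in> sets (borel \<Otimes>\<^sub>M Fsig ?S)" using 1 2 by (rule sets.Int)
  finally have *: "{z \<in> space (borel \<Otimes>\<^sub>M Fsig ?S). fst z \<in> cutout_set_n Y n (snd z)} \<in> sets (borel \<Otimes>\<^sub>M Fsig ?S)" .
  let ?A = "{z \<in> space (borel \<Otimes>\<^sub>M Fsig ?S). fst z \<in> cutout_set_n Y n (snd z)}"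
  have "indicator (cutout_set_n Y n (snd z)) (fst z) = (indicator ?A z :: ennreal)"
    if "z \<in> space (borel \<Otimes>\<^sub>M Fsig ?S)" for z using that by (auto simp: indicator_def)
  then show ?thesis using * by (simp cong: measurable_cong)
qed

text \<open>\<open>Fsig R\<close> has the same underlying space as \<open>M\<close>, so inclusion of
  the subalgebra is encoded as measurability of the identity.\<close>

lemma id_measurable_Fsig: "(\<lambda>\<omega>. \<omega>) \<in> measurable M (Fsig R)"
  by (rule measurableI) (use sets_Fsig_subset[of R] sets.sets_into_space in \<open>auto simp: Int_absorb2 Int_absorb1 vimage_def subset_iff\<close>)

lemma cutout_indicator_measurable_M [measurable]:
  "(\<lambda>z. indicator (cutout_set_n Y n (snd z)) (fst z) :: ennreal) \<in> borel_measurable (borel \<Otimes>\<^sub>M M)"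
proof -
  have "(\<lambda>z. (fst z, snd z)) \<in> measurable (borel \<Otimes>\<^sub>M M) (borel \<Otimes>\<^sub>M Fsig (radii {2 powr (- real n)..}))"
    by (intro measurable_Pair measurable_fst measurable_compose[OF measurable_snd id_measurable_Fsig])
  from measurable_compose[OF this cutout_indicator_measurable] show ?thesis by simp
qed

lemma emeasure_cutout_meas_n_measurable [measurable]:
  assumes [measurable]: "U \<in> sets borel"
  shows "(\<lambda>\<omega>. emeasure (cutout_meas_n M Y n \<omega>) U) \<in> borel_measurable M"
proof -
  interpret H: sigma_finite_measure Hmeas by (rule sigma_finite_Hmeas)
  have *: "(\<lambda>z. indicator (cutout_set_n Y n (fst z)) (snd z) :: ennreal) \<in> borel_measurable (M \<Otimes>\<^sub>M Hmeas)"
    using measurable_compose[OF measurable_pair_swap' cutout_indicator_measurable_M[of n]]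
    by (simp add: case_prod_beta' cong: measurable_cong_sets sets_pair_measure_cong)
  show ?thesis
    unfolding emeasure_cutout_meas_n[OF assms]
    by (intro borel_measurable_times_ennreal borel_measurable_const H.borel_measurable_nn_integral)
       (use * in \<open>simp add: case_prod_beta'\<close>)
qed

text \<open>Inclusion-exclusion for the two cones: a ball of radius \<open>r\<close> containing both
  points has \<open>2 * r > kor_dist x y\<close>, so the overlap has intensity at most
  \<open>\<gamma> * ln (2 / d)\<close>. The bound \<open>d \<le> 2\<close> puts \<open>d / 2\<close>
  into the range of radii where the logarithmic formula applies.\<close>

lemma prob_two_points:
  assumes "x \<noteq> y" "x \<in> Omega" "y \<in> Omega"
  shows "prob {\<omega>\<in>space M. x \<in> cutout_set_n Y n \<omega> \<and> y \<in> cutout_set_n Y n \<omega>}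
    \<le> 2 powr (- 2 * \<gamma> * real n) * (2 / kor_dist x y) powr \<gamma>"
proof -
  define d where "d = kor_dist x y"
  have "d \<noteq> 0"
  proof
    assume "d = 0"
    then have "kor_dist (fst x, snd x) (fst y, snd y) ^ 4 = 0" by (simp add: d_def)
    then have *: "cmod (fst x - fst y) ^ 4 + 4 * (snd x - snd y - Im (cnj (fst y) * fst x))\<^sup>2 = 0"
      unfolding kor_dist_power4 .
    then have "cmod (fst x - fst y) ^ 4 = 0"
      by (smt (verit) zero_le_power2 norm_ge_zero zero_le_power)
    then have "fst x = fst y" by simp
    with * have "snd x = snd y" by simp
    then show False using \<open>fst x = fst y\<close> assms by (simp add: prod_eq_iff)
  qed
  then have d: "0 < d" "d \<le> 2"
    using kor_dist_nonneg[of x y] kor_dist_Omega[OF assms(2,3)] by (auto simp: d_def simp del: kor_dist_nonneg)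
  let ?A = "hits x \<inter> radii {2 powr (- real n)..}" and ?B = "hits y \<inter> radii {2 powr (- real n)..}"
  have sub: "?A \<inter> ?B \<subseteq> hits x \<inter> radii {d/2..}"
  proof
    fix p assume "p \<in> ?A \<inter> ?B"
    then have "kor_dist x (fst p) < snd p" "kor_dist y (fst p) < snd p" by (auto simp: hits_def)
    moreover have "d \<le> kor_dist x (fst p) + kor_dist y (fst p)"
      unfolding d_def using kor_dist_triangle[of x y "fst p"] by (simp add: kor_dist_sym[of y])
    ultimately show "p \<in> hits x \<inter> radii {d/2..}" by (auto simp: hits_def radii_def)
  qed
  have fin: "emeasure \<nu> ?A < \<infinity>" "emeasure \<nu> ?B < \<infinity>" by (simp_all add: measure_hits)
  have finAB: "emeasure \<nu> (?A \<union> ?B) < \<infinity>"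
    using emeasure_subadditive[of ?A \<nu> ?B] fin by (auto simp: ennreal_add_less_top intro: le_less_trans)
  have mAB: "measure \<nu> (?A \<inter> ?B) \<le> \<gamma> * ln (2 / d)"
  proof -
    have e: "emeasure \<nu> (hits x \<inter> radii {d/2..}) = ennreal (\<gamma> * ln (1 / (d/2)))"
      using d gamma_pos by (intro cutout_intensity_hits(2)[of _ 1]) auto
    have "emeasure \<nu> (?A \<inter> ?B) \<le> ennreal (\<gamma> * ln (1 / (d/2)))"
      unfolding e[symmetric] by (rule emeasure_mono[OF sub]) simp
    then show ?thesis using d gamma_pos
      by (auto simp: measure_def intro!: enn2real_leI)
  qed
  have "measure \<nu> (?A \<union> ?B) = measure \<nu> ?A + measure \<nu> ?B - measure \<nu> (?A \<inter> ?B)"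
    using fin by (intro measure_Un3) (auto simp: fmeasurable_def)
  also have "\<dots> \<ge> 2 * \<gamma> * real n * ln 2 - \<gamma> * ln (2 / d)"
    using mAB gamma_pos measure_hits(1)[of _ n] by (simp add: measure_def mult.assoc)
  finally have *: "2 * \<gamma> * real n * ln 2 - \<gamma> * ln (2 / d) \<le> measure \<nu> (?A \<union> ?B)" .
  have "{\<omega>\<in>space M. x \<in> cutout_set_n Y n \<omega> \<and> y \<in> cutout_set_n Y n \<omega>} = void (?A \<union> ?B)"
    using assms unfolding void_def mem_cutout_set_n by auto
  then have "prob {\<omega>\<in>space M. x \<in> cutout_set_n Y n \<omega> \<and> y \<in> cutout_set_n Y n \<omega>} = exp (- measure \<nu> (?A \<union> ?B))"
    using void_finite(2)[OF _ finAB] by simp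
  also have "\<dots> \<le> exp (- (2 * \<gamma> * real n * ln 2) + \<gamma> * ln (2 / d))" using * by simp
  also have "\<dots> = 2 powr (- 2 * \<gamma> * real n) * (2 / d) powr \<gamma>"
    using d by (simp add: powr_def mult.commute flip: exp_add)
  finally show ?thesis by (simp add: d_def)
qed

text \<open>Tonelli reduces the second moment to two-point probabilities, and \<open>b ^ 2\<close>
  cancels the decay in \<open>n\<close>. The resulting bound is uniform in \<open>n\<close>, as
  Fatou's lemma will require.\<close>

lemma second_moment:
  assumes [measurable]: "U \<in> sets borel" "U \<subseteq> Omega"
  shows "(\<integral>\<^sup>+\<omega>. (emeasure (cutout_meas_n M Y n \<omega>) U)\<^sup>2 \<partial>M) \<le>
    (\<integral>\<^sup>+x. \<integral>\<^sup>+y. indicator U x * indicator U y * ennreal ((2 / kor_dist x y) powr \<gamma>) \<partial>Hmeas \<partial>Hmeas)"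
proof -
  interpret H: sigma_finite_measure Hmeas by (rule sigma_finite_Hmeas)
  interpret P: pair_sigma_finite Hmeas M ..
  define b where "b = ennreal (2 powr (\<gamma> * real n))"
  define e :: "heis \<Rightarrow> 'w \<Rightarrow> ennreal" where "e x \<omega> = indicator (cutout_set_n Y n \<omega>) x" for x \<omega>
  have e1 [measurable]: "(\<lambda>z. e (fst z) (snd z)) \<in> borel_measurable (Hmeas \<Otimes>\<^sub>M M)"
    using cutout_indicator_measurable_M[of n] unfolding e_def
    by (simp cong: measurable_cong_sets sets_pair_measure_cong)
  have e2 [measurable]: "(\<lambda>z. e (f z) (g z)) \<in> borel_measurable N"
    if "f \<in> measurable N Hmeas" "g \<in> measurable N M" for f g and N :: "'z measure"
    using measurable_compose[OF measurable_Pair[OF that] e1] by simp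
  have m: "emeasure (cutout_meas_n M Y n \<omega>) U = b * (\<integral>\<^sup>+x. indicator U x * e x \<omega> \<partial>Hmeas)" for \<omega>
    by (simp add: emeasure_cutout_meas_n cutout_beta_eq b_def e_def)
  have "(\<integral>\<^sup>+\<omega>. (emeasure (cutout_meas_n M Y n \<omega>) U)\<^sup>2 \<partial>M) =
    (\<integral>\<^sup>+\<omega>. \<integral>\<^sup>+x. \<integral>\<^sup>+y. b\<^sup>2 * (indicator U x * indicator U y * (e x \<omega> * e y \<omega>)) \<partial>Hmeas \<partial>Hmeas \<partial>M)"
  proof (rule nn_integral_cong)
    fix \<omega> assume [measurable]: "\<omega> \<in> space M"
    have [measurable]: "(\<lambda>x. e x \<omega>) \<in> borel_measurable Hmeas" by measurable
    have "(emeasure (cutout_meas_n M Y n \<omega>) U)\<^sup>2 =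
      b\<^sup>2 * ((\<integral>\<^sup>+x. indicator U x * e x \<omega> \<partial>Hmeas) * (\<integral>\<^sup>+y. indicator U y * e y \<omega> \<partial>Hmeas))"
      by (simp add: m power2_eq_square ac_simps)
    also have "\<dots> = (\<integral>\<^sup>+x. b\<^sup>2 * ((indicator U x * e x \<omega>) * (\<integral>\<^sup>+y. indicator U y * e y \<omega> \<partial>Hmeas)) \<partial>Hmeas)"
      by (subst nn_integral_cmult, measurable, subst nn_integral_multc, measurable)
    also have "\<dots> = (\<integral>\<^sup>+x. \<integral>\<^sup>+y. b\<^sup>2 * (indicator U x * indicator U y * (e x \<omega> * e y \<omega>)) \<partial>Hmeas \<partial>Hmeas)"
      by (intro nn_integral_cong) (simp add: nn_integral_cmult[symmetric] ac_simps)
    finally show "(emeasure (cutout_meas_n M Y n \<omega>) U)\<^sup>2 =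
      (\<integral>\<^sup>+x. \<integral>\<^sup>+y. b\<^sup>2 * (indicator U x * indicator U y * (e x \<omega> * e y \<omega>)) \<partial>Hmeas \<partial>Hmeas)" .
  qed
  also have "\<dots> = (\<integral>\<^sup>+x. \<integral>\<^sup>+\<omega>. \<integral>\<^sup>+y. b\<^sup>2 * (indicator U x * indicator U y * (e x \<omega> * e y \<omega>)) \<partial>Hmeas \<partial>M \<partial>Hmeas)"
    by (rule P.Fubini') measurable
  also have "\<dots> = (\<integral>\<^sup>+x. \<integral>\<^sup>+y. \<integral>\<^sup>+\<omega>. b\<^sup>2 * (indicator U x * indicator U y * (e x \<omega> * e y \<omega>)) \<partial>M \<partial>Hmeas \<partial>Hmeas)"
    by (intro nn_integral_cong P.Fubini') measurable
  also have "\<dots> \<le> (\<integral>\<^sup>+x. \<integral>\<^sup>+y. indicator U x * indicator U y * ennreal ((2 / kor_dist x y) powr \<gamma>) \<partial>Hmeas \<partial>Hmeas)"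
  proof (rule nn_integral_mono, rule nn_integral_mono_AE)
    fix x
    \<comment> \<open>The diagonal is removed as a null set, since there the kernel on the right
      would be built from \<open>2 / 0 = 0\<close>.\<close>
    have "AE y in Hmeas. y \<noteq> x"
      unfolding Hmeas_eq using AE_lborel_singleton[of x] by (simp add: AE_density)
    then show "AE y in Hmeas. (\<integral>\<^sup>+\<omega>. b\<^sup>2 * (indicator U x * indicator U y * (e x \<omega> * e y \<omega>)) \<partial>M)
       \<le> indicator U x * indicator U y * ennreal ((2 / kor_dist x y) powr \<gamma>)"
    proof eventually_elim
      case (elim y)
      show ?case
      proof (cases "x \<in> U \<and> y \<in> U")
        case True
        then have xy: "x \<in> Omega" "y \<in> Omega" using assms by auto
        let ?S = "{\<omega>\<in>space M. x \<in> cutout_set_n Y n \<omega> \<and> y \<in> cutout_set_n Y n \<omega>}"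
        have "?S = void (hits x \<inter> radii {2 powr (- real n)..}) \<inter> void (hits y \<inter> radii {2 powr (- real n)..})"
          using xy by (auto simp: void_def mem_cutout_set_n)
        then have S: "?S \<in> events" by simp
        have "(\<integral>\<^sup>+\<omega>. b\<^sup>2 * (indicator U x * indicator U y * (e x \<omega> * e y \<omega>)) \<partial>M) = (\<integral>\<^sup>+\<omega>. b\<^sup>2 * indicator ?S \<omega> \<partial>M)"
          using True by (intro nn_integral_cong) (auto simp: e_def indicator_def)
        also have "\<dots> = b\<^sup>2 * ennreal (prob ?S)"
          using S by (simp add: nn_integral_cmult_indicator emeasure_eq_measure)
        also have "\<dots> \<le> b\<^sup>2 * ennreal (2 powr (- 2 * \<gamma> * real n) * (2 / kor_dist x y) powr \<gamma>)"
          using prob_two_points[OF _ xy, of n] elim by (intro mult_left_mono ennreal_leI) auto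
        also have "\<dots> = ennreal ((2 powr (\<gamma> * real n))\<^sup>2 * (2 powr (- 2 * \<gamma> * real n) * (2 / kor_dist x y) powr \<gamma>))"
          by (simp add: b_def ennreal_mult ennreal_power)
        also have "(2 powr (\<gamma> * real n))\<^sup>2 * (2 powr (- 2 * \<gamma> * real n) * (2 / kor_dist x y) powr \<gamma>) = (2 / kor_dist x y) powr \<gamma>"
          by (simp add: power2_eq_square mult.assoc[symmetric] flip: powr_add)
        finally show ?thesis using True by simp
      qed (auto simp: indicator_def)
    qed
  qed
  finally show ?thesis .
qed

end

section \<open>Hausdorff measures and the upper bound on the dimension\<close>

lemma hausdorff_content_less:
  assumes "hausdorff_measure s A = 0" "\<epsilon> > 0" "\<delta> > 0"
  obtains U :: "nat \<Rightarrow> 'a::metric_space set" where "A \<subseteq> (\<Union>n. U n)" "\<And>n. bounded (U n)" "\<And>n. diameter (U n) \<le> \<delta>"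
    "(\<Sum>n. ennreal (diameter (U n) powr s)) < ennreal \<epsilon>"
proof -
  have "hausdorff_content s \<delta> A \<le> hausdorff_measure s A"
    unfolding hausdorff_measure_def using \<open>\<delta> > 0\<close> by (intro SUP_upper) auto
  then have "hausdorff_content s \<delta> A < ennreal \<epsilon>" using assms by simp
  then obtain U where "U \<in> {U :: nat \<Rightarrow> 'a set. A \<subseteq> (\<Union>n. U n) \<and> (\<forall>n. bounded (U n) \<and> diameter (U n) \<le> \<delta>)}"
     "(\<Sum>n. ennreal (diameter (U n) powr s)) < ennreal \<epsilon>"
    unfolding hausdorff_content_def INF_less_iff by blast
  then show thesis using that by blast
qed

lemma hausdorff_measure_zeroI:
  fixes A :: "'a::metric_space set"
  assumes "\<And>\<epsilon> \<delta>. \<epsilon> > 0 \<Longrightarrow> \<delta> > 0 \<Longrightarrow> \<exists>U :: nat \<Rightarrow> 'a set. A \<subseteq> (\<Union>n. U n) \<and> (\<forall>n. bounded (U n) \<and> diameter (U n) \<le> \<delta>) \<and>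
     (\<Sum>n. ennreal (diameter (U n) powr s)) \<le> ennreal \<epsilon>"
  shows "hausdorff_measure s A = 0"
proof -
  have "hausdorff_content s \<delta> A \<le> 0" if "\<delta> > 0" for \<delta>
  proof (rule ennreal_le_epsilon)
    fix e :: real assume "e > 0"
    with assms[OF this \<open>\<delta> > 0\<close>] obtain U :: "nat \<Rightarrow> 'a set" where U: "A \<subseteq> (\<Union>n. U n)" "\<forall>n. bounded (U n) \<and> diameter (U n) \<le> \<delta>"
      "(\<Sum>n. ennreal (diameter (U n) powr s)) \<le> ennreal e" by blast
    have "hausdorff_content s \<delta> A \<le> (\<Sum>n. ennreal (diameter (U n) powr s))"
      unfolding hausdorff_content_def by (rule INF_lower) (use U in blast)
    also note U(3)
    finally show "hausdorff_content s \<delta> A \<le> 0 + ennreal e" by simp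
  qed
  then have "hausdorff_measure s A \<le> 0"
    unfolding hausdorff_measure_def by (intro SUP_least) auto
  then show ?thesis by simp
qed

lemma hausdorff_measure_zero_finite_covers:
  fixes A :: "'a::metric_space set"
  assumes "\<And>\<epsilon> \<delta>. \<epsilon> > 0 \<Longrightarrow> \<delta> > 0 \<Longrightarrow> \<exists>(C :: 'i set) V. finite C \<and> A \<subseteq> (\<Union>c\<in>C. V c) \<and>
     (\<forall>c\<in>C. bounded (V c) \<and> diameter (V c) \<le> \<delta>) \<and> (\<Sum>c\<in>C. diameter (V c) powr s) \<le> \<epsilon>"
  shows "hausdorff_measure s A = 0"
proof (rule hausdorff_measure_zeroI)
  fix \<epsilon> \<delta> :: real assume "\<epsilon> > 0" "\<delta> > 0"
  with assms[OF this] obtain C :: "'i set" and V where C: "finite C" "A \<subseteq> (\<Union>c\<in>C. V c)"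
     "\<forall>c\<in>C. bounded (V c) \<and> diameter (V c) \<le> \<delta>" "(\<Sum>c\<in>C. diameter (V c) powr s) \<le> \<epsilon>" by blast
  obtain h where h: "bij_betw h {0..<card C} C" using ex_bij_betw_nat_finite[OF \<open>finite C\<close>] by blast
  \<comment> \<open>Padding with empty sets costs nothing: their diameter is \<open>0\<close>, and
    \<open>0 powr s = 0\<close> even for \<open>s = 0\<close>.\<close>
  define U where "U n = (if n < card C then V (h n) else {})" for n
  have hC: "h n \<in> C" if "n < card C" for n using h that by (auto simp: bij_betw_def)
  have 1: "A \<subseteq> (\<Union>n. U n)"
  proof
    fix x assume "x \<in> A"
    then obtain c where c: "c \<in> C" "x \<in> V c" using C by auto
    then obtain n where "n < card C" "h n = c" using h by (force simp: bij_betw_def)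
    then show "x \<in> (\<Union>n. U n)" using c by (auto simp: U_def intro!: exI[of _ n])
  qed
  have 2: "\<forall>n. bounded (U n) \<and> diameter (U n) \<le> \<delta>"
    using C hC \<open>\<delta> > 0\<close> by (auto simp: U_def)
  have "(\<Sum>n. ennreal (diameter (U n) powr s)) = (\<Sum>n<card C. ennreal (diameter (U n) powr s))"
    by (rule suminf_finite) (auto simp: U_def)
  also have "\<dots> = ennreal (\<Sum>n<card C. diameter (V (h n)) powr s)"
    by (subst sum_ennreal[symmetric]) (auto simp: U_def)
  also have "(\<Sum>n<card C. diameter (V (h n)) powr s) = (\<Sum>c\<in>C. diameter (V c) powr s)"
    using sum.reindex_bij_betw[OF h, of "\<lambda>c. diameter (V c) powr s"] by (simp add: atLeast0LessThan)
  finally have 3: "(\<Sum>n. ennreal (diameter (U n) powr s)) \<le> ennreal \<epsilon>"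
    using C(4) by (simp add: ennreal_leI)
  show "\<exists>U :: nat \<Rightarrow> 'a set. A \<subseteq> (\<Union>n. U n) \<and> (\<forall>n. bounded (U n) \<and> diameter (U n) \<le> \<delta>) \<and>
     (\<Sum>n. ennreal (diameter (U n) powr s)) \<le> ennreal \<epsilon>"
    using 1 2 3 by blast
qed

text \<open>The \<open>i\<close>-th cover may cost \<open>\<epsilon> / 2 ^ (i + 1)\<close>, and the
  double sequence of covering sets is listed through \<open>prod_decode\<close>.\<close>

lemma hausdorff_measure_zero_UN:
  fixes A :: "nat \<Rightarrow> 'a::metric_space set"
  assumes "\<And>i. hausdorff_measure s (A i) = 0"
  shows "hausdorff_measure s (\<Union>i. A i) = 0"
proof (rule hausdorff_measure_zeroI)
  fix \<epsilon> \<delta> :: real assume "\<epsilon> > 0" "\<delta> > 0"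
  define Q where "Q i U \<longleftrightarrow> A i \<subseteq> (\<Union>n. U n) \<and> (\<forall>n. bounded (U n) \<and> diameter (U n) \<le> \<delta>) \<and>
     (\<Sum>n. ennreal (diameter (U n) powr s)) \<le> ennreal (\<epsilon> * (1/2) ^ Suc i)" for i and U :: "nat \<Rightarrow> 'a set"
  have "\<exists>U. Q i U" for i
  proof -
    have "\<epsilon> * (1/2) ^ Suc i > 0" using \<open>\<epsilon> > 0\<close> by simp
    from hausdorff_content_less[OF assms[of i] this \<open>\<delta> > 0\<close>] obtain U where U: "A i \<subseteq> (\<Union>n. U n)"
      "\<And>n. bounded (U n)" "\<And>n. diameter (U n) \<le> \<delta>"
      "(\<Sum>n. ennreal (diameter (U n) powr s)) < ennreal (\<epsilon> * (1/2) ^ Suc i)" by blast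
    then show ?thesis unfolding Q_def using less_imp_le[OF U(4)] by blast
  qed
  then obtain U where QU: "\<And>i. Q i (U i)" by metis
  have U: "A i \<subseteq> (\<Union>n. U i n)" "bounded (U i n)" "diameter (U i n) \<le> \<delta>"
     "(\<Sum>n. ennreal (diameter (U i n) powr s)) \<le> ennreal (\<epsilon> * (1/2) ^ Suc i)" for i n
    using QU[of i] unfolding Q_def by blast+
  define W where "W k = case_prod U (prod_decode k)" for k
  have "(\<Sum>k. ennreal (diameter (W k) powr s)) = (\<Sum>i. \<Sum>n. ennreal (diameter (U i n) powr s))"
  proof -
    have "(\<Sum>i. f (prod_decode i)) = (\<Sum>i. \<Sum>n. f (i, n))" for f :: "nat \<times> nat \<Rightarrow> ennreal"
      by (rule suminf_ennreal_2dimen) (rule refl)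
    from this[of "\<lambda>(i, n). ennreal (diameter (U i n) powr s)"] show ?thesis
      by (simp add: W_def case_prod_beta')
  qed
  also have "\<dots> \<le> (\<Sum>i. ennreal (\<epsilon> * (1/2) ^ Suc i))" by (intro suminf_le U) auto
  also have "\<dots> = ennreal \<epsilon>"
    using sums_mult[OF power_half_series, of \<epsilon>] \<open>\<epsilon> > 0\<close>
    by (subst suminf_ennreal2) (auto simp: sums_iff)
  finally have "(\<Sum>k. ennreal (diameter (W k) powr s)) \<le> ennreal \<epsilon>" .
  moreover have "(\<Union>i. A i) \<subseteq> (\<Union>k. W k)"
  proof
    fix x assume "x \<in> (\<Union>i. A i)"
    then obtain i n where "x \<in> U i n" using U(1) by blast
    then have "x \<in> W (prod_encode (i, n))" by (simp add: W_def)
    then show "x \<in> (\<Union>k. W k)" by blast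
  qed
  moreover have "\<forall>k. bounded (W k) \<and> diameter (W k) \<le> \<delta>" using U by (auto simp: W_def case_prod_beta')
  ultimately show "\<exists>U :: nat \<Rightarrow> 'a set. (\<Union>i. A i) \<subseteq> (\<Union>n. U n) \<and> (\<forall>n. bounded (U n) \<and> diameter (U n) \<le> \<delta>) \<and>
     (\<Sum>n. ennreal (diameter (U n) powr s)) \<le> ennreal \<epsilon>" by blast
qed

lemma hausdorff_measure_zero_mono:
  assumes "A \<subseteq> B" "hausdorff_measure s B = 0"
  shows "hausdorff_measure s A = 0"
proof (rule hausdorff_measure_zeroI)
  fix \<epsilon> \<delta> :: real assume "\<epsilon> > 0" "\<delta> > 0"
  from hausdorff_content_less[OF assms(2) this] obtain U where "B \<subseteq> (\<Union>n. U n)" "\<And>n. bounded (U n)"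
    "\<And>n. diameter (U n) \<le> \<delta>" "(\<Sum>n. ennreal (diameter (U n) powr s)) < ennreal \<epsilon>" by blast
  then show "\<exists>U. A \<subseteq> (\<Union>n. U n) \<and> (\<forall>n. bounded (U n) \<and> diameter (U n) \<le> \<delta>) \<and>
     (\<Sum>n. ennreal (diameter (U n) powr s)) \<le> ennreal \<epsilon>" using assms(1) by (meson less_imp_le order_trans)
qed

section \<open>Grid covers of the plane and of the Koranyi ball\<close>

lemma diameter_cball_complex_le: "diameter (cball (z::complex) r) \<le> 2 * max 0 r"
  by (auto simp: diameter_cball)

lemma floor_grid:
  fixes x :: real and R m :: nat
  assumes "m > 0" "\<bar>x\<bar> \<le> real R"
  shows "\<lfloor>real m * x\<rfloor> \<in> {- int m * int R .. int m * int R}" and "\<bar>x - of_int \<lfloor>real m * x\<rfloor> / real m\<bar> \<le> 1 / real m"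
proof -
  have "real m * x \<le> real m * real R" "real m * (- real R) \<le> real m * x"
    using assms by (intro mult_left_mono; simp add: abs_le_iff)+
  then show "\<lfloor>real m * x\<rfloor> \<in> {- int m * int R .. int m * int R}"
    by (auto simp: floor_le_iff le_floor_iff intro: le_less_trans)
  have "x - of_int \<lfloor>real m * x\<rfloor> / real m = (real m * x - of_int \<lfloor>real m * x\<rfloor>) / real m"
    using assms by (simp add: field_simps)
  moreover have "\<bar>real m * x - of_int \<lfloor>real m * x\<rfloor>\<bar> \<le> 1" by linarith
  ultimately show "\<bar>x - of_int \<lfloor>real m * x\<rfloor> / real m\<bar> \<le> 1 / real m"
    using assms by (simp add: divide_right_mono)
qed

text \<open>The exponent \<open>3\<close> is just a number above the planar dimension: of the order
  of \<open>m ^ 2\<close> cells cost of the order of \<open>1 / m ^ 3\<close> each. It makes the set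
  whose infimum is \<open>hausdorff_dim\<close> nonempty, without which \<open>Inf\<close> would
  carry no information.\<close>

lemma hausdorff_measure_3_complex: "hausdorff_measure 3 (A :: complex set) = 0"
proof -
  have *: "hausdorff_measure 3 (cball (0::complex) (real R)) = 0" for R
  proof (rule hausdorff_measure_zero_finite_covers)
    fix \<epsilon> \<delta> :: real assume "\<epsilon> > 0" "\<delta> > 0"
    \<comment> \<open>\<open>64\<close> is the cube of the factor in the cell diameter
      \<open>4 / m\<close>; there are at most \<open>(m * (2 * R + 1)) ^ 2\<close> cells.\<close>
    define K where "K = 64 * (2 * real R + 1)\<^sup>2"
    obtain m :: nat where m: "real m > max 1 (max (4 / \<delta>) (K / \<epsilon>))" using reals_Archimedean2 by blast
    then have m0: "m > 0" and m1: "4 / real m \<le> \<delta>" and m2: "K / real m \<le> \<epsilon>"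
      using \<open>\<epsilon> > 0\<close> \<open>\<delta> > 0\<close> by (auto simp: field_simps)
    let ?I = "{- int m * int R .. int m * int R}"
    define V :: "int \<times> int \<Rightarrow> complex set" where
      "V = (\<lambda>(a, b). cball (Complex (of_int a / real m) (of_int b / real m)) (2 / real m))"
    have cover: "cball 0 (real R) \<subseteq> (\<Union>c\<in>?I \<times> ?I. V c)"
    proof
      fix z :: complex assume "z \<in> cball 0 (real R)"
      then have z: "\<bar>Re z\<bar> \<le> real R" "\<bar>Im z\<bar> \<le> real R"
        using abs_Re_le_cmod[of z] abs_Im_le_cmod[of z] by auto
      note g = floor_grid[OF m0 z(1)] floor_grid[OF m0 z(2)]
      let ?c = "(\<lfloor>real m * Re z\<rfloor>, \<lfloor>real m * Im z\<rfloor>)"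
      have "cmod (Complex (of_int (fst ?c) / real m) (of_int (snd ?c) / real m) - z)
          \<le> \<bar>Re z - of_int (fst ?c) / real m\<bar> + \<bar>Im z - of_int (snd ?c) / real m\<bar>"
        using cmod_le[of "Complex (of_int (fst ?c) / real m) (of_int (snd ?c) / real m) - z"] by simp
      also have "\<dots> \<le> 1 / real m + 1 / real m" using g by (intro add_mono) simp_all
      finally have "z \<in> V ?c" unfolding V_def by (simp add: dist_norm)
      moreover have "?c \<in> ?I \<times> ?I" using g by simp
      ultimately show "z \<in> (\<Union>c\<in>?I \<times> ?I. V c)" by blast
    qed
    have dV: "diameter (V c) \<le> 4 / real m" "bounded (V c)" for c
      using diameter_cball_complex_le[of _ "2 / real m"] by (auto simp: V_def case_prod_beta')
    have "(\<Sum>c\<in>?I \<times> ?I. diameter (V c) powr 3) \<le> (\<Sum>c\<in>?I \<times> ?I. (4 / real m) powr 3)"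
      using dV by (intro sum_mono powr_mono2) (auto intro: diameter_ge_0)
    also have "\<dots> = (2 * real m * real R + 1)\<^sup>2 * (64 / real m ^ 3)"
      using m0 by (simp add: card_cartesian_product power2_eq_square powr_numeral power_divide algebra_simps)
    also have "\<dots> \<le> (real m * (2 * real R + 1))\<^sup>2 * (64 / real m ^ 3)"
      using m0 by (intro mult_right_mono power_mono) (auto simp: algebra_simps)
    also have "\<dots> = K / real m" using m0 by (simp add: K_def power_mult_distrib power2_eq_square power3_eq_cube)
    also note m2
    finally have "(\<Sum>c\<in>?I \<times> ?I. diameter (V c) powr 3) \<le> \<epsilon>" .
    note sum = this
    have fin: "finite (?I \<times> ?I)" by simp
    have bd: "\<forall>c\<in>?I \<times> ?I. bounded (V c) \<and> diameter (V c) \<le> \<delta>"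
      by (intro ballI conjI dV(2) order_trans[OF dV(1) m1])
    show "\<exists>(C :: (int \<times> int) set) V. finite C \<and> cball (0::complex) (real R) \<subseteq> (\<Union>c\<in>C. V c) \<and>
     (\<forall>c\<in>C. bounded (V c) \<and> diameter (V c) \<le> \<delta>) \<and> (\<Sum>c\<in>C. diameter (V c) powr 3) \<le> \<epsilon>"
      by (rule exI[of _ "?I \<times> ?I"], rule exI[of _ V]) (intro conjI fin cover bd sum)
  qed
  have "A \<subseteq> (\<Union>R::nat. cball 0 (real R))"
    using real_arch_simple by auto
  from hausdorff_measure_zero_mono[OF this hausdorff_measure_zero_UN[OF *]] show ?thesis .
qed

lemma hausdorff_dim_le: "hausdorff_measure s A = 0 \<Longrightarrow> s \<ge> 0 \<Longrightarrow> hausdorff_dim A \<le> s"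
  unfolding hausdorff_dim_def by (rule cInf_lower) (auto intro!: bdd_belowI[of _ 0])

lemma hausdorff_dim_ge:
  fixes A :: "complex set"
  assumes "\<And>s. 0 \<le> s \<Longrightarrow> s < \<beta> \<Longrightarrow> hausdorff_measure s A \<noteq> 0"
  shows "\<beta> \<le> hausdorff_dim A"
  unfolding hausdorff_dim_def
proof (rule cInf_greatest)
  show "{s. 0 \<le> s \<and> hausdorff_measure s A = 0} \<noteq> {}"
    using hausdorff_measure_3_complex[of A] by (auto intro!: exI[of _ 3])
  show "\<beta> \<le> s" if "s \<in> {s. 0 \<le> s \<and> hausdorff_measure s A = 0}" for s
    using assms[of s] that by force
qed

text \<open>The grid point of a cell is twisted by \<open>Im (cnj u0 * u)\<close>, so that
  the vertical distance is measured along the group.\<close>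

lemma Omega_grid:
  assumes "p \<in> Omega" "m > 0"
  obtains a b c :: int where "a \<in> {- int m .. int m}" "b \<in> {- int m .. int m}" "c \<in> {- int (4 * m\<^sup>2) .. int (4 * m\<^sup>2)}"
    "kor_dist p (Complex (of_int a / real m) (of_int b / real m), of_int c / real (m\<^sup>2)) \<le> 2 / real m"
proof -
  obtain u t where p: "p = (u, t)" by force
  note b = Omega_bounds[OF assms(1)[unfolded p]]
  define a where "a = \<lfloor>real m * Re u\<rfloor>"
  define b' where "b' = \<lfloor>real m * Im u\<rfloor>"
  define u0 where "u0 = Complex (of_int a / real m) (of_int b' / real m)"
  define w where "w = t - Im (cnj u0 * u)"
  define c where "c = \<lfloor>real (m\<^sup>2) * w\<rfloor>"
  have "\<bar>Re u\<bar> \<le> real 1" "\<bar>Im u\<bar> \<le> real 1" using b abs_Re_le_cmod[of u] abs_Im_le_cmod[of u] by auto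
  note g = floor_grid[OF assms(2) this(1)] floor_grid[OF assms(2) this(2)]
  have m1: "1 / real m \<le> 1" using assms by simp
  have "(cmod (u - u0))\<^sup>2 = (Re u - of_int a / real m)\<^sup>2 + (Im u - of_int b' / real m)\<^sup>2"
    by (simp add: cmod_power2 u0_def)
  also have "\<dots> \<le> (1 / real m)\<^sup>2 + (1 / real m)\<^sup>2"
    using g unfolding a_def b'_def by (intro add_mono) (simp_all add: abs_le_square_iff[symmetric])
  finally have uu: "(cmod (u - u0))\<^sup>2 \<le> 2 * (1 / real m)\<^sup>2" by simp
  also have "\<dots> \<le> 2 * 1\<^sup>2" using m1 by (intro mult_left_mono power_mono) auto
  finally have "(cmod (u - u0))\<^sup>2 \<le> 2\<^sup>2" by simp
  then have "cmod (u - u0) \<le> 2" by (rule power2_le_imp_le) simp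
  \<comment> \<open>\<open>cnj u * u\<close> is real, so the twist by \<open>u0\<close> equals the
    twist by the displacement \<open>u0 - u\<close> and is at most \<open>2\<close> in absolute
    value.\<close>
  have "Im (cnj u0 * u) = Im (cnj u0 * u - cnj u * u)" by (simp add: algebra_simps)
  also have "\<dots> = Im (cnj (u0 - u) * u)" by (simp only: complex_cnj_diff left_diff_distrib)
  also have "\<bar>\<dots>\<bar> \<le> cmod (cnj (u0 - u) * u)" by (rule abs_Im_le_cmod)
  also have "\<dots> \<le> 2 * 1"
    unfolding norm_mult complex_mod_cnj using b \<open>cmod (u - u0) \<le> 2\<close> by (intro mult_mono) (auto simp: norm_minus_commute)
  finally have "\<bar>w\<bar> \<le> real 4" using b unfolding w_def by linarith
  note gw = floor_grid[OF _ this, of "m\<^sup>2"]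
  have gw2: "\<bar>w - of_int c / real (m\<^sup>2)\<bar> \<le> 1 / real (m\<^sup>2)" using gw(2) assms unfolding c_def by simp
  have "kor_dist p (u0, of_int c / real (m\<^sup>2)) ^ 4 = ((cmod (u - u0))\<^sup>2)\<^sup>2 + 4 * (w - of_int c / real (m\<^sup>2))\<^sup>2"
    unfolding p kor_dist_power4 w_def by (simp add: algebra_simps flip: power_mult)
  also have "\<dots> \<le> (2 * (1 / real m)\<^sup>2)\<^sup>2 + 4 * (1 / real (m\<^sup>2))\<^sup>2"
  proof -
    have "(w - of_int c / real (m\<^sup>2))\<^sup>2 \<le> (1 / real (m\<^sup>2))\<^sup>2"
      using power_mono[OF gw2, of 2] by simp
    then show ?thesis using power_mono[OF uu, of 2] by simp
  qed
  \<comment> \<open>The horizontal mesh \<open>1 / m\<close> and the vertical mesh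
    \<open>1 / m ^ 2\<close> contribute equally: \<open>4 + 4 \<le> 16\<close> in units of
    \<open>1 / m ^ 4\<close>.\<close>
  also have "\<dots> \<le> (2 / real m) ^ 4" by (simp add: power_divide power_mult_distrib divide_right_mono flip: power_mult)
  finally have "kor_dist p (u0, of_int c / real (m\<^sup>2)) \<le> 2 / real m" by (rule power4_le_imp_le) simp
  then show thesis
    using that[of a b' c] g gw(1) assms unfolding u0_def a_def b'_def c_def by simp
qed

section \<open>First-moment bound for covers by surviving cells\<close>

context poisson_cutout
begin

text \<open>\<open>A\<close> collects balls that swallow the whole Koranyi ball of radius
  \<open>\<rho>\<close> about \<open>y\<close>; if one of them is present, the cell contains no
  surviving point. Shrinking the radii by \<open>\<rho>\<close> lowers the intensity
  \<open>\<gamma> * ln (1 / \<rho>)\<close> by at most \<open>3 * \<gamma>\<close>, which costs the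
  factor \<open>exp (3 * \<gamma>)\<close>.\<close>

lemma prob_cell_not_covered:
  fixes y :: heis
  assumes "0 < \<rho>" "\<rho> \<le> 1"
  defines "A \<equiv> {p. snd p \<in> {\<rho>..} \<and> kor_dist y (fst p) < snd p - \<rho>}"
  shows "A \<in> sets borel" "prob (void A) \<le> exp (3 * \<gamma>) * \<rho> powr \<gamma>"
proof -
  note I = cutout_intensity_radial[of "{\<rho>..}" "\<lambda>r. r - \<rho>" \<gamma> y, OF _ _ _ gamma_pos, folded A_def]
  show A: "A \<in> sets borel" by (rule I) auto
  \<comment> \<open>The termwise antiderivative of \<open>(r - \<rho>) ^ 4 / r ^ 5\<close> after
    binomial expansion. At \<open>r = \<rho>\<close> the constants add up to
    \<open>4 - 3 + 4/3 - 1/4 = 25/12\<close>, later rounded up to \<open>3\<close>.\<close>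
  define F where "F r = ln r + 4 * \<rho> / r - 3 * \<rho>\<^sup>2 / r\<^sup>2 + 4 / 3 * \<rho> ^ 3 / r ^ 3 - \<rho> ^ 4 / (4 * r ^ 4)" for r
  have "emeasure \<nu> A = (\<integral>\<^sup>+r. ennreal (\<gamma> * r powr (-5) * (r - \<rho>) ^ 4) * indicator ({\<rho>..} \<inter> {0<..<1}) r \<partial>lborel)"
    by (rule I) auto
  also have "\<dots> = (\<integral>\<^sup>+r. ennreal (\<gamma> * ((r - \<rho>) ^ 4 / r ^ 5)) * indicator {\<rho>..1} r \<partial>lborel)"
  proof (rule nn_integral_cong_AE)
    show "AE r in lborel. ennreal (\<gamma> * r powr (-5) * (r - \<rho>) ^ 4) * indicator ({\<rho>..} \<inter> {0<..<1}) r
        = ennreal (\<gamma> * ((r - \<rho>) ^ 4 / r ^ 5)) * indicator {\<rho>..1} r"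
      using AE_lborel_singleton[of 1]
      by eventually_elim (use assms(1) in \<open>auto simp: indicator_def powr_minus powr_numeral divide_simps\<close>)
  qed
  also have "\<dots> = ennreal (\<gamma> * F 1 - \<gamma> * F \<rho>)"
  proof (rule nn_integral_FTC_Icc)
    fix r assume r: "r \<in> {\<rho>..1}"
    then have "r > 0" using assms by auto
    then show "((\<lambda>r. \<gamma> * F r) has_real_derivative \<gamma> * ((r - \<rho>) ^ 4 / r ^ 5)) (at r)"
      unfolding F_def
      apply (auto intro!: derivative_eq_intros)
      apply (simp add: divide_simps)
      apply (simp add: eval_nat_numeral algebra_simps)
      done
    show "0 \<le> \<gamma> * ((r - \<rho>) ^ 4 / r ^ 5)" using \<open>r > 0\<close> gamma_pos by simp
  qed (use assms in auto)
  finally have \<nu>A: "emeasure \<nu> A = ennreal (\<gamma> * F 1 - \<gamma> * F \<rho>)" .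
  have "F \<rho> = ln \<rho> + 25/12" using assms(1) by (simp add: F_def)
  moreover have "F 1 \<ge> 0"
  proof -
    have "\<rho>\<^sup>2 \<le> \<rho>" "\<rho> ^ 4 \<le> \<rho> ^ 3" "0 \<le> \<rho>\<^sup>2"  "0 \<le> \<rho> ^ 3"
      using assms(1,2) by (auto simp: power2_eq_square mult_left_le intro: power_decreasing)
    moreover have "F 1 = 4 * \<rho> - 3 * \<rho>\<^sup>2 + 4 / 3 * \<rho> ^ 3 - \<rho> ^ 4 / 4" by (simp add: F_def)
    ultimately show ?thesis by linarith
  qed
  ultimately have F: "F 1 - F \<rho> \<ge> - ln \<rho> - 3" "F 1 - F \<rho> \<ge> - ln \<rho> - 25/12" by auto
  have le: "\<gamma> * (- ln \<rho> - 3) \<le> measure \<nu> A"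
  proof (cases "\<gamma> * F 1 - \<gamma> * F \<rho> \<ge> 0")
    case True
    have "\<gamma> * (- ln \<rho> - 3) \<le> \<gamma> * (F 1 - F \<rho>)" using F gamma_pos by (intro mult_left_mono) auto
    then show ?thesis using True by (simp add: measure_def \<nu>A right_diff_distrib)
  next
    case False
    have "\<gamma> * (- ln \<rho> - 3) \<le> \<gamma> * (F 1 - F \<rho>)" using F gamma_pos by (intro mult_left_mono) auto
    also have "\<dots> \<le> 0" using False by (simp add: right_diff_distrib)
    also have "\<dots> \<le> measure \<nu> A" by simp
    finally show ?thesis .
  qed
  have "prob (void A) = exp (- measure \<nu> A)" using void_finite(2)[OF A] \<nu>A by simp
  also have "\<dots> \<le> exp (- (\<gamma> * (- ln \<rho> - 3)))" using le by simp
  also have "\<dots> = exp (3 * \<gamma>) * \<rho> powr \<gamma>" using assms(1) by (simp add: powr_def algebra_simps flip: exp_add)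
  finally show "prob (void A) \<le> exp (3 * \<gamma>) * \<rho> powr \<gamma>" .
qed

text \<open>The expected \<open>s\<close>-sum over the cells left at mesh \<open>2 ^ (- k)\<close>
  is at most \<open>C * q ^ k\<close>. Since these bounds are summable over the scales, the random
  sums are almost surely summable, hence tend to \<open>0\<close>, and late scales supply
  arbitrarily cheap covers.\<close>

lemma AE_hausdorff_measure_zero:
  assumes s: "4 - \<gamma> < s" "0 \<le> s"
  shows "AE \<omega> in M. hausdorff_measure s (fst ` cutout_set Y \<omega>) = 0"
proof -
  define m :: "nat \<Rightarrow> nat" where "m k = 2 ^ k" for k
  define I where "I k = {- int (m k) .. int (m k)} \<times> {- int (m k) .. int (m k)} \<times> {- int (4 * (m k)\<^sup>2) .. int (4 * (m k)\<^sup>2)}" for k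
  define P where "P k = (\<lambda>(a, b, c). (Complex (of_int a / real (m k)) (of_int b / real (m k)), of_int c / real ((m k)\<^sup>2)))" for k
  define \<rho> where "\<rho> k = 2 / real (m k)" for k
  define A where "A k i = {p. snd p \<in> {\<rho> k..} \<and> kor_dist (P k i) (fst p) < snd p - \<rho> k}" for k i
  define Z where "Z k \<omega> = (\<Sum>i\<in>I k. indicator (void (A k i)) \<omega> * ennreal ((4 / real (m k)) powr s))" for k \<omega>
  have m0: "m k > 0" for k by (simp add: m_def)
  have finI: "finite (I k)" for k by (simp add: I_def)
  \<comment> \<open>At \<open>k = 0\<close> the radius is \<open>2\<close>, beyond the range of
    \<open>prob_cell_not_covered\<close>; hence the shift to \<open>Suc k\<close> below.\<close>
  have \<rho>: "0 < \<rho> k" "k \<ge> 1 \<Longrightarrow> \<rho> k \<le> 1" for k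
    using power_increasing[of 1 k "2::real"] by (auto simp: \<rho>_def m_def divide_simps)
  have [measurable]: "void (A k i) \<in> events" if "k \<ge> 1" for k i
    unfolding A_def by (intro void_events prob_cell_not_covered(1) \<rho> that)
  have cardI: "real (card (I k)) \<le> 81 * real (m k) ^ 4" for k
  proof -
    have "real (card (I k)) = (2 * real (m k) + 1)\<^sup>2 * (8 * (real (m k))\<^sup>2 + 1)"
      by (simp add: I_def card_cartesian_product power2_eq_square nat_add_distrib algebra_simps of_nat_diff)
    also have "\<dots> \<le> (3 * real (m k))\<^sup>2 * (9 * (real (m k))\<^sup>2)"
    proof (intro mult_mono power_mono)
      have "1 \<le> real (m k)" by (simp add: m_def)
      then show "2 * real (m k) + 1 \<le> 3 * real (m k)" by simp
      have "1 \<le> (real (m k))\<^sup>2" by (simp add: m_def)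
      then show "8 * (real (m k))\<^sup>2 + 1 \<le> 9 * (real (m k))\<^sup>2" by simp
    qed auto
    finally show ?thesis by (simp add: power_mult_distrib eval_nat_numeral)
  qed
  define q where "q = 2 powr (4 - \<gamma> - s)"
  have q: "0 < q" "q < 1" using s by (auto simp: q_def powr_less_one)
  define C where "C = 81 * exp (3 * \<gamma>) * 2 powr \<gamma> * 4 powr s"
  have EZ: "(\<integral>\<^sup>+\<omega>. Z k \<omega> \<partial>M) \<le> ennreal (C * q ^ k)" if k: "k \<ge> 1" for k
  proof -
    have "(\<integral>\<^sup>+\<omega>. Z k \<omega> \<partial>M) = (\<Sum>i\<in>I k. ennreal (prob (void (A k i)) * (4 / real (m k)) powr s))"
      unfolding Z_def using k
      by (subst nn_integral_sum) (auto simp: nn_integral_multc emeasure_eq_measure ennreal_mult intro!: sum.cong)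
    also have "\<dots> \<le> (\<Sum>i\<in>I k. ennreal (exp (3 * \<gamma>) * \<rho> k powr \<gamma> * (4 / real (m k)) powr s))"
      unfolding A_def using \<rho> k
      by (intro sum_mono ennreal_leI mult_right_mono prob_cell_not_covered(2)) auto
    also have "\<dots> = ennreal (real (card (I k)) * (exp (3 * \<gamma>) * \<rho> k powr \<gamma> * (4 / real (m k)) powr s))"
      by (simp add: ennreal_mult ennreal_of_nat_eq_real_of_nat)
    also have "\<dots> \<le> ennreal ((81 * real (m k) ^ 4) * (exp (3 * \<gamma>) * \<rho> k powr \<gamma> * (4 / real (m k)) powr s))"
      by (intro ennreal_leI mult_right_mono cardI) auto
    also have "(81 * real (m k) ^ 4) * (exp (3 * \<gamma>) * \<rho> k powr \<gamma> * (4 / real (m k)) powr s) =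
       C * (real (m k) powr 4 * real (m k) powr (- \<gamma>) * real (m k) powr (- s))"
      using m0[of k] by (simp add: C_def \<rho>_def powr_divide powr_minus divide_simps)
    also have "real (m k) powr 4 * real (m k) powr (- \<gamma>) * real (m k) powr (- s) = q ^ k"
      by (simp add: m_def q_def powr_power powr_powr flip: powr_add powr_realpow) (simp add: algebra_simps)
    finally show ?thesis .
  qed
  have "(\<integral>\<^sup>+\<omega>. (\<Sum>k. Z (Suc k) \<omega>) \<partial>M) = (\<Sum>k. \<integral>\<^sup>+\<omega>. Z (Suc k) \<omega> \<partial>M)"
    by (rule nn_integral_suminf) (auto simp: Z_def)
  also have "\<dots> \<le> (\<Sum>k. ennreal (C * q ^ Suc k))" by (intro suminf_le EZ) auto
  also have "\<dots> < \<infinity>"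
  proof -
    have "summable (\<lambda>k. C * q ^ Suc k)" using q by (intro summable_mult summable_Suc_iff[THEN iffD2] summable_geometric) auto
    then show ?thesis using q by (subst suminf_ennreal2) (auto simp: C_def)
  qed
  finally have "AE \<omega> in M. (\<Sum>k. Z (Suc k) \<omega>) \<noteq> \<infinity>"
    by (intro nn_integral_noteq_infinite) (auto simp: Z_def less_top)
  then show ?thesis
  proof (rule AE_mp, intro AE_I2 impI)
    fix \<omega> assume \<omega>: "\<omega> \<in> space M" and fin: "(\<Sum>k. Z (Suc k) \<omega>) \<noteq> \<infinity>"
    have Zreal: "Z k \<omega> = ennreal (real (card {i\<in>I k. \<omega> \<in> void (A k i)}) * (4 / real (m k)) powr s)" for k
    proof -
      have "Z k \<omega> = (\<Sum>i\<in>{i\<in>I k. \<omega> \<in> void (A k i)}. ennreal ((4 / real (m k)) powr s))"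
        unfolding Z_def using finI[of k] by (intro sum.mono_neutral_cong_right) auto
      then show ?thesis by (simp add: ennreal_mult ennreal_of_nat_eq_real_of_nat)
    qed
    have "summable (\<lambda>k. real (card {i\<in>I (Suc k). \<omega> \<in> void (A (Suc k) i)}) * (4 / real (m (Suc k))) powr s)"
      using fin unfolding Zreal by (intro summable_suminf_not_top) auto
    then have lim: "(\<lambda>k. real (card {i\<in>I (Suc k). \<omega> \<in> void (A (Suc k) i)}) * (4 / real (m (Suc k))) powr s) \<longlonglongrightarrow> 0"
      by (rule summable_LIMSEQ_zero)
    have lim2: "(\<lambda>k. 4 / real (m (Suc k))) \<longlonglongrightarrow> 0"
    proof -
      have "(\<lambda>k. 2 * (1/2::real) ^ k) \<longlonglongrightarrow> 2 * 0" by (intro tendsto_intros LIMSEQ_realpow_zero) auto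
      then show ?thesis by (simp add: m_def power_divide)
    qed
    show "hausdorff_measure s (fst ` cutout_set Y \<omega>) = 0"
    proof (rule hausdorff_measure_zero_finite_covers)
      fix \<epsilon> \<delta> :: real assume "\<epsilon> > 0" "\<delta> > 0"
      have "eventually (\<lambda>k. real (card {i\<in>I (Suc k). \<omega> \<in> void (A (Suc k) i)}) * (4 / real (m (Suc k))) powr s < \<epsilon>
          \<and> 4 / real (m (Suc k)) < \<delta>) sequentially"
        using order_tendstoD(2)[OF lim \<open>\<epsilon> > 0\<close>] order_tendstoD(2)[OF lim2 \<open>\<delta> > 0\<close>] by eventually_elim simp
      then obtain k' where k': "real (card {i\<in>I (Suc k'). \<omega> \<in> void (A (Suc k') i)}) * (4 / real (m (Suc k'))) powr s < \<epsilon>"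
          "4 / real (m (Suc k')) < \<delta>" by (auto simp: eventually_sequentially)
      define k where "k = Suc k'"
      define C where "C = {i\<in>I k. \<omega> \<in> void (A k i)}"
      define V where "V i = cball (fst (P k i)) (\<rho> k)" for i
      have diam: "diameter (V i) \<le> 4 / real (m k)" "bounded (V i)" for i
        using diameter_cball_complex_le[of "fst (P k i)" "\<rho> k"] by (auto simp: V_def \<rho>_def)
      have "fst ` cutout_set Y \<omega> \<subseteq> (\<Union>c\<in>C. V c)"
      proof
        fix z assume "z \<in> fst ` cutout_set Y \<omega>"
        then obtain p where p: "p \<in> cutout_set Y \<omega>" "z = fst p" by blast
        then have "p \<in> Omega" by (simp add: mem_cutout_set)
        obtain i where i: "i \<in> I k" "kor_dist p (P k i) \<le> \<rho> k"
        proof (rule Omega_grid[OF \<open>p \<in> Omega\<close> m0[of k]])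
          fix a b c :: int
          assume "a \<in> {- int (m k) .. int (m k)}" "b \<in> {- int (m k) .. int (m k)}" "c \<in> {- int (4 * (m k)\<^sup>2) .. int (4 * (m k)\<^sup>2)}"
            and d: "kor_dist p (Complex (of_int a / real (m k)) (of_int b / real (m k)), of_int c / real ((m k)\<^sup>2)) \<le> 2 / real (m k)"
          then have "(a, b, c) \<in> I k" unfolding I_def by blast
          then show thesis by (rule that) (use d in \<open>simp add: P_def \<rho>_def\<close>)
        qed
        \<comment> \<open>By the triangle inequality a ball swallowing the cell around
          \<open>P k i\<close> would contain \<open>p\<close>, which survives.\<close>
        have "Y \<omega> \<inter> A k i = {}"
        proof (rule ccontr)
          assume "Y \<omega> \<inter> A k i \<noteq> {}"
          then obtain x where x: "x \<in> Y \<omega>" "kor_dist (P k i) (fst x) < snd x - \<rho> k" unfolding A_def by blast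
          then have "kor_dist p (fst x) < snd x" using kor_dist_triangle[of p "fst x" "P k i"] i by linarith
          then show False using p x by (auto simp: mem_cutout_set hits_def)
        qed
        then have "i \<in> C" using i \<omega> by (simp add: C_def void_def)
        moreover have "z \<in> V i" using cmod_le_kor_dist[of p "P k i"] i p
          by (simp add: V_def dist_norm norm_minus_commute)
        ultimately show "z \<in> (\<Union>c\<in>C. V c)" by blast
      qed
      moreover have "(\<Sum>c\<in>C. diameter (V c) powr s) \<le> \<epsilon>"
      proof -
        have "(\<Sum>c\<in>C. diameter (V c) powr s) \<le> (\<Sum>c\<in>C. (4 / real (m k)) powr s)"
          using diam s by (intro sum_mono powr_mono2) (auto intro: diameter_ge_0)
        also have "\<dots> \<le> \<epsilon>" using k' by (simp add: C_def k_def)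
        finally show ?thesis .
      qed
      moreover have "finite C" using finI by (simp add: C_def)
      moreover have bd: "\<forall>c\<in>C. bounded (V c) \<and> diameter (V c) \<le> \<delta>"
        by (intro ballI conjI diam(2) order_trans[OF diam(1) less_imp_le[OF k'(2)[folded k_def]]])
      ultimately show "\<exists>(C :: (int \<times> int \<times> int) set) V. finite C \<and> fst ` cutout_set Y \<omega> \<subseteq> (\<Union>c\<in>C. V c) \<and>
         (\<forall>c\<in>C. bounded (V c) \<and> diameter (V c) \<le> \<delta>) \<and> (\<Sum>c\<in>C. diameter (V c) powr s) \<le> \<epsilon>"
        using bd by (intro exI[of _ C]) (rule exI[of _ V], intro conjI)
    qed
  qed
qed

lemma AE_hausdorff_dim_le:
  assumes "\<gamma> \<le> 4"
  shows "AE \<omega> in M. hausdorff_dim (fst ` cutout_set Y \<omega>) \<le> 4 - \<gamma>"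
proof -
  have "AE \<omega> in M. \<forall>n. hausdorff_measure (4 - \<gamma> + 1 / real (Suc n)) (fst ` cutout_set Y \<omega>) = 0"
    unfolding AE_all_countable using assms by (intro allI AE_hausdorff_measure_zero) auto
  then show ?thesis
  proof eventually_elim
    case (elim \<omega>)
    have "hausdorff_dim (fst ` cutout_set Y \<omega>) \<le> 4 - \<gamma> + 1 / real (Suc n)" for n
      using elim assms by (intro hausdorff_dim_le) auto
    moreover have "(\<lambda>n. 4 - \<gamma> + 1 / real (Suc n)) \<longlonglongrightarrow> 4 - \<gamma> + 0"
      by (intro tendsto_intros LIMSEQ_inverse_real_of_nat[unfolded inverse_eq_divide])
    ultimately show ?case using LIMSEQ_le_const[of "\<lambda>n. 4 - \<gamma> + 1 / real (Suc n)"] by auto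
  qed
qed

end

section \<open>Energies and the lower bound on the dimension\<close>

text \<open>Squares of side \<open>4 / 2 ^ k\<close> on a lattice of spacing
  \<open>1 / 2 ^ k\<close>. The overlap puts every disc of radius \<open>1 / 2 ^ k\<close> about a
  point of the unit disc into a single square, and openness lets mass bounds pass to weak
  limits.\<close>

definition grid_sq :: "nat \<Rightarrow> int \<times> int \<Rightarrow> complex set" where
  "grid_sq k c = {z. \<bar>Re z - of_int (fst c) / 2 ^ k\<bar> < 2 / 2 ^ k \<and> \<bar>Im z - of_int (snd c) / 2 ^ k\<bar> < 2 / 2 ^ k}"

definition grid_idx :: "nat \<Rightarrow> (int \<times> int) set" where
  "grid_idx k = {- (2 ^ k) .. 2 ^ k} \<times> {- (2 ^ k) .. 2 ^ k}"

lemma finite_grid_idx [simp]: "finite (grid_idx k)"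
  by (simp add: grid_idx_def)

lemma card_grid_idx_le: "real (card (grid_idx k)) \<le> 9 * 4 ^ k"
proof -
  have "card {- (2 ^ k) .. 2 ^ k :: int} = 2 * 2 ^ k + 1"
    by (simp add: nat_add_distrib nat_mult_distrib nat_power_eq)
  then have "real (card (grid_idx k)) = (2 * 2 ^ k + 1)\<^sup>2"
    by (simp add: grid_idx_def card_cartesian_product power2_eq_square algebra_simps)
  also have "\<dots> \<le> (3 * 2 ^ k)\<^sup>2" by (intro power_mono) auto
  also have "\<dots> = 9 * (2 * 2) ^ k" unfolding power_mult_distrib[of 2 2] by (simp add: power2_eq_square)
  finally show ?thesis by simp
qed

lemma open_grid_sq: "open (grid_sq k c)"
  unfolding grid_sq_def by (intro open_Collect_conj open_Collect_less continuous_intros)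

lemma grid_sq_borel [measurable]: "grid_sq k c \<in> sets borel"
  by (intro borel_open open_grid_sq)

lemma grid_sq_cover:
  assumes "cmod z \<le> 1" "d \<le> 1 / 2 ^ k"
  obtains c where "c \<in> grid_idx k" "cball z d \<subseteq> grid_sq k c"
proof -
  define c where "c = (\<lfloor>2 ^ k * Re z\<rfloor>, \<lfloor>2 ^ k * Im z\<rfloor>)"
  have b: "\<bar>Re z\<bar> \<le> 1" "\<bar>Im z\<bar> \<le> 1" using assms abs_Re_le_cmod[of z] abs_Im_le_cmod[of z] by auto
  have *: "\<lfloor>2 ^ k * x\<rfloor> \<in> {- (2 ^ k) .. 2 ^ k}" "\<bar>x - of_int \<lfloor>2 ^ k * x\<rfloor> / 2 ^ k\<bar> < 1 / 2 ^ k" if "\<bar>x\<bar> \<le> 1" for x :: real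
  proof -
    have "2 ^ k * x \<le> 2 ^ k * 1" "2 ^ k * (- 1) \<le> 2 ^ k * x" using that by (intro mult_left_mono; simp add: abs_le_iff)+
    then have "2 ^ k * x < 2 ^ k + 1" "- (2 ^ k) \<le> 2 ^ k * x" by linarith+
    then show "\<lfloor>2 ^ k * x\<rfloor> \<in> {- (2 ^ k) .. 2 ^ k}" by (auto simp: floor_le_iff le_floor_iff)
    have "x - of_int \<lfloor>2 ^ k * x\<rfloor> / 2 ^ k = (2 ^ k * x - of_int \<lfloor>2 ^ k * x\<rfloor>) / 2 ^ k" by (simp add: diff_divide_distrib)
    moreover have "\<bar>2 ^ k * x - of_int \<lfloor>2 ^ k * x\<rfloor>\<bar> < 1" by linarith
    ultimately show "\<bar>x - of_int \<lfloor>2 ^ k * x\<rfloor> / 2 ^ k\<bar> < 1 / 2 ^ k" by (simp add: divide_strict_right_mono)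
  qed
  have "w \<in> grid_sq k c" if "w \<in> cball z d" for w
  proof -
    have "\<bar>Re w - Re z\<bar> \<le> d" "\<bar>Im w - Im z\<bar> \<le> d"
      using that abs_Re_le_cmod[of "w - z"] abs_Im_le_cmod[of "w - z"] by (auto simp: dist_norm norm_minus_commute)
    moreover have "2 / 2 ^ k = 1 / 2 ^ k + 1 / (2 ^ k :: real)" by simp
    ultimately show ?thesis
      using *(2)[OF b(1)] *(2)[OF b(2)] assms(2) unfolding grid_sq_def c_def mem_Collect_eq fst_conv snd_conv by linarith
  qed
  moreover have "c \<in> grid_idx k" using * b unfolding c_def grid_idx_def by auto
  ultimately show thesis using that by blast
qed

lemma nat_scale:
  assumes "0 < (d::real)" "d \<le> 1 / 2 ^ N"
  obtains k where "k \<ge> N" "d \<le> 1 / 2 ^ k" "1 / 2 ^ k \<le> 2 * d"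
proof -
  obtain n where n: "(1/2) ^ n < d" using real_arch_pow_inv[OF assms(1), of "1/2"] by auto
  define k where "k = (GREATEST k. d \<le> 1 / 2 ^ k)"
  have bd: "k \<le> n" if "d \<le> 1 / 2 ^ k" for k
  proof (rule ccontr)
    assume "\<not> k \<le> n"
    then have "1 / 2 ^ k \<le> (1 / 2 ^ n :: real)" by (intro divide_left_mono power_increasing) auto
    then show False using that n by (simp add: power_divide)
  qed
  have 1: "d \<le> 1 / 2 ^ k" unfolding k_def by (rule GreatestI_nat[where P = "\<lambda>k. d \<le> 1 / 2 ^ k", OF assms(2)]) (use bd in auto)
  have 2: "N \<le> k" unfolding k_def by (rule Greatest_le_nat[where P = "\<lambda>k. d \<le> 1 / 2 ^ k", OF assms(2)]) (use bd in auto)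
  have "\<not> d \<le> 1 / 2 ^ Suc k"
    unfolding k_def using Greatest_le_nat[where P = "\<lambda>k. d \<le> 1 / 2 ^ k" and k = "Suc k" and b = n] bd
    by (metis Suc_n_not_le_n k_def)
  then have "1 / 2 ^ k \<le> 2 * d" by simp
  with 1 2 show thesis using that by blast
qed

text \<open>By a Borel--Cantelli argument, most points lie only in grid squares of small mass.\<close>

lemma hausdorff_measure_pos_of_energy:
  fixes \<kappa> :: "complex measure"
  assumes sets: "sets \<kappa> = sets borel" and fin: "finite_measure \<kappa>" and supp: "emeasure \<kappa> (- cball 0 1) = 0"
    and energy: "(\<Sum>k. ennreal (2 powr (t * real k)) * (\<Sum>c\<in>grid_idx k. (emeasure \<kappa> (grid_sq k c))\<^sup>2)) < \<infinity>"
    and A: "A \<in> sets borel" "emeasure \<kappa> A > 0" and s: "0 \<le> s" "s \<le> t" "0 < t"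
  shows "hausdorff_measure s A \<noteq> 0"
proof
  assume H: "hausdorff_measure s A = 0"
  interpret finite_measure \<kappa> by fact
  have [measurable]: "B \<in> sets \<kappa> \<longleftrightarrow> B \<in> sets borel" for B using sets by simp
  \<comment> \<open>The mass of a bad square is at most \<open>2 powr (t * k)\<close> times the
    square of that mass, so the energy controls the total mass of the bad squares.\<close>
  define bad where "bad k = {c \<in> grid_idx k. emeasure \<kappa> (grid_sq k c) > ennreal (2 powr (- t * real k))}" for k
  define B where "B k = (\<Union>c\<in>bad k. grid_sq k c)" for k
  have finb: "finite (bad k)" for k by (simp add: bad_def)
  have Bm: "B k \<in> sets borel" for k unfolding B_def using finb by auto
  have Ble: "emeasure \<kappa> (B k) \<le> ennreal (2 powr (t * real k)) * (\<Sum>c\<in>grid_idx k. (emeasure \<kappa> (grid_sq k c))\<^sup>2)" for k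
  proof -
    have "emeasure \<kappa> (B k) \<le> (\<Sum>c\<in>bad k. emeasure \<kappa> (grid_sq k c))"
      unfolding B_def by (intro emeasure_subadditive_finite finb) (auto simp: sets)
    also have "\<dots> \<le> (\<Sum>c\<in>bad k. ennreal (2 powr (t * real k)) * (emeasure \<kappa> (grid_sq k c))\<^sup>2)"
    proof (rule sum_mono)
      fix c assume "c \<in> bad k"
      then have "ennreal (2 powr (- t * real k)) \<le> emeasure \<kappa> (grid_sq k c)" by (auto simp: bad_def)
      then have "ennreal (2 powr (t * real k)) * ennreal (2 powr (- t * real k)) * emeasure \<kappa> (grid_sq k c)
        \<le> ennreal (2 powr (t * real k)) * emeasure \<kappa> (grid_sq k c) * emeasure \<kappa> (grid_sq k c)"
        by (intro mult_right_mono mult_left_mono) auto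
      then show "emeasure \<kappa> (grid_sq k c) \<le> ennreal (2 powr (t * real k)) * (emeasure \<kappa> (grid_sq k c))\<^sup>2"
        by (simp add: power2_eq_square mult.assoc flip: ennreal_mult powr_add)
    qed
    also have "\<dots> \<le> (\<Sum>c\<in>grid_idx k. ennreal (2 powr (t * real k)) * (emeasure \<kappa> (grid_sq k c))\<^sup>2)"
      by (intro sum_mono2) (auto simp: bad_def)
    finally show ?thesis by (simp add: sum_distrib_left)
  qed
  have "(\<Sum>k. emeasure \<kappa> (B k)) < \<infinity>" by (rule le_less_trans[OF suminf_le[OF Ble] energy]) auto
  then have "summable (\<lambda>k. measure \<kappa> (B k))"
    unfolding emeasure_eq_measure by (intro summable_suminf_not_top) auto
  \<comment> \<open>Bad squares from stage \<open>N\<close> on take less than half of the mass of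
    \<open>A\<close>; what is left in the unit disc, \<open>A'\<close>, has more than half.\<close>
  from suminf_exist_split[OF _ this, of "measure \<kappa> A / 2"] obtain N where N: "norm (\<Sum>k. measure \<kappa> (B (k + N))) < measure \<kappa> A / 2"
    using A(2) by (auto simp: emeasure_eq_measure)
  define G where "G = (\<Union>k. B (k + N))"
  have Gm: "G \<in> sets borel" unfolding G_def using Bm by auto
  have sumN: "summable (\<lambda>k. measure \<kappa> (B (k + N)))" using \<open>summable (\<lambda>k. measure \<kappa> (B k))\<close> by (subst summable_iff_shift)
  have "measure \<kappa> G \<le> (\<Sum>k. measure \<kappa> (B (k + N)))"
    unfolding G_def using Bm sumN by (intro finite_measure_subadditive_countably) (auto simp: sets)
  then have Gle: "measure \<kappa> G < measure \<kappa> A / 2" using N by simp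
  define A' where "A' = (A - G) \<inter> cball 0 1"
  have A'm: "A' \<in> sets borel" unfolding A'_def using A Gm by auto
  have A'pos: "measure \<kappa> A' > measure \<kappa> A / 2"
  proof -
    have "A \<subseteq> A' \<union> (G \<union> - cball 0 1)" by (auto simp: A'_def)
    then have "measure \<kappa> A \<le> measure \<kappa> (A' \<union> (G \<union> - cball 0 1))"
      using A'm Gm by (intro finite_measure_mono) (auto simp: sets)
    also have "\<dots> \<le> measure \<kappa> A' + (measure \<kappa> G + measure \<kappa> (- cball 0 1))"
      using A'm Gm by (intro order_trans[OF measure_Un_le] add_left_mono measure_Un_le) (auto simp: sets)
    also have "measure \<kappa> (- cball 0 1) = 0" using supp by (simp add: measure_def)
    finally show ?thesis using Gle by simp
  qed
  have good: "measure \<kappa> (grid_sq k c) \<le> 2 powr (- t * real k)" if "z \<in> A'" "z \<in> grid_sq k c" "c \<in> grid_idx k" "k \<ge> N" for z k c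
  proof (rule ccontr)
    assume "\<not> measure \<kappa> (grid_sq k c) \<le> 2 powr (- t * real k)"
    then have "c \<in> bad k" using that by (auto simp: bad_def emeasure_eq_measure ennreal_less_iff)
    then have "z \<in> B (k - N + N)" using that unfolding B_def by auto
    then have "z \<in> G" unfolding G_def by blast
    then show False using that by (simp add: A'_def)
  qed
  \<comment> \<open>Chosen so that \<open>2 powr s * \<epsilon>\<close> is half of the mass of
    \<open>A\<close>, which the mass of \<open>A'\<close> exceeds.\<close>
  define \<epsilon> where "\<epsilon> = measure \<kappa> A / 2 / 2 powr s"
  have "\<epsilon> > 0" using A(2) by (simp add: \<epsilon>_def emeasure_eq_measure)
  have "(0::real) < 1 / 2 ^ N" by simp
  from hausdorff_content_less[OF H \<open>\<epsilon> > 0\<close> this]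
  obtain U where U: "A \<subseteq> (\<Union>n. U n)" "\<And>n. bounded (U n)" "\<And>n. diameter (U n) \<le> 1 / 2 ^ N"
    "(\<Sum>n. ennreal (diameter (U n) powr s)) < ennreal \<epsilon>" by blast
  define Q where "Q n W \<longleftrightarrow> W \<in> sets borel \<and> A' \<inter> U n \<subseteq> W \<and> measure \<kappa> W \<le> 2 powr s * diameter (U n) powr s" for n W
  have ex: "\<exists>W. W \<in> sets borel \<and> A' \<inter> U n \<subseteq> W \<and> measure \<kappa> W \<le> 2 powr s * diameter (U n) powr s" for n
  proof (cases "A' \<inter> U n = {}")
    case True
    then show ?thesis by (intro exI[of _ "{}"]) auto
  next
    case False
    then obtain z where z: "z \<in> A'" "z \<in> U n" by blast
    define d where "d = diameter (U n)"
    have zc: "cmod z \<le> 1" using z by (simp add: A'_def)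
    have sub: "U n \<subseteq> cball z d" using diameter_bounded_bound[OF U(2)] z by (auto simp: d_def)
    have d0: "0 \<le> d" unfolding d_def by (rule diameter_ge_0[OF U(2)])
    show ?thesis
    proof (cases "d = 0")
      case True
      \<comment> \<open>A set of diameter \<open>0\<close> adds nothing to the cover sum, so it must
        be shown to carry no mass: the point lies in good squares of all late scales, and
        \<open>t > 0\<close> makes their masses tend to \<open>0\<close>.\<close>
      have "measure \<kappa> {z} \<le> 2 powr (- t * real (k + N))" for k
      proof -
        obtain c where c: "c \<in> grid_idx (k + N)" "cball z 0 \<subseteq> grid_sq (k + N) c" by (rule grid_sq_cover[OF zc, of 0 "k + N"]) auto
        then have "z \<in> grid_sq (k + N) c" by auto
        then have "measure \<kappa> {z} \<le> measure \<kappa> (grid_sq (k + N) c)" by (intro finite_measure_mono) (auto simp: sets)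
        also have "\<dots> \<le> 2 powr (- t * real (k + N))" by (rule good[OF z(1) \<open>z \<in> grid_sq (k + N) c\<close> c(1)]) simp
        finally show ?thesis .
      qed
      moreover have "(\<lambda>k. 2 powr (- t * real (k + N))) \<longlonglongrightarrow> 0"
      proof -
        have "(\<lambda>k. (2 powr (- t)) ^ k) \<longlonglongrightarrow> 0" using s by (intro LIMSEQ_realpow_zero) (auto simp: powr_less_one)
        then have "(\<lambda>k. 2 powr (- t * real k)) \<longlonglongrightarrow> 0" by (simp add: powr_power mult.commute)
        then show ?thesis by (rule LIMSEQ_ignore_initial_segment)
      qed
      ultimately have "measure \<kappa> {z} \<le> 0" by (intro LIMSEQ_le_const) auto
      moreover have "A' \<inter> U n \<subseteq> {z}" using sub True by auto
      ultimately show ?thesis using True by (intro exI[of _ "{z}"]) (auto simp: d_def)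
    next
      case False
      then have "0 < d" using d0 by simp
      \<comment> \<open>At a scale \<open>1 / 2 ^ k\<close> between \<open>d\<close> and
        \<open>2 * d\<close> a single good square contains \<open>U n\<close>; the factor
        \<open>2\<close> is the origin of \<open>2 powr s\<close>.\<close>
      then obtain k where k: "k \<ge> N" "d \<le> 1 / 2 ^ k" "1 / 2 ^ k \<le> 2 * d"
        using nat_scale[of d N] U(3)[of n] unfolding d_def by blast
      obtain c where c: "c \<in> grid_idx k" "cball z d \<subseteq> grid_sq k c" by (rule grid_sq_cover[OF zc k(2)])
      have "z \<in> grid_sq k c" using c d0 by auto
      then have "measure \<kappa> (grid_sq k c) \<le> 2 powr (- t * real k)" using good[OF z(1) _ c(1) k(1)] by blast
      also have "\<dots> \<le> 2 powr (- s * real k)" using s by (intro powr_mono) (auto intro: mult_right_mono)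
      also have "\<dots> = (1 / 2 ^ k) powr s" by (simp add: powr_divide powr_minus divide_simps powr_powr mult.commute flip: powr_realpow)
      also have "\<dots> \<le> (2 * d) powr s" using k s by (intro powr_mono2) auto
      also have "\<dots> = 2 powr s * d powr s" using d0 by (simp add: powr_mult)
      finally show ?thesis using c sub unfolding d_def by (intro exI[of _ "grid_sq k c"]) auto
    qed
  qed
  have "\<exists>W. Q n W" for n unfolding Q_def by (rule ex)
  then obtain W where QW: "\<And>n. Q n (W n)" by metis
  have W: "W n \<in> sets borel" "A' \<inter> U n \<subseteq> W n" "measure \<kappa> (W n) \<le> 2 powr s * diameter (U n) powr s" for n
    using QW[of n] unfolding Q_def by blast+
  have "emeasure \<kappa> A' \<le> emeasure \<kappa> (\<Union>n. W n)"
  proof (rule emeasure_mono)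
    have "A' \<subseteq> A" by (auto simp: A'_def)
    then show "A' \<subseteq> (\<Union>n. W n)" using U(1) W(2) by blast
    show "(\<Union>n. W n) \<in> sets \<kappa>" using W(1) by (auto simp: sets)
  qed
  also have "\<dots> \<le> (\<Sum>n. emeasure \<kappa> (W n))" using W by (intro emeasure_subadditive_countably) (auto simp: sets)
  also have "\<dots> \<le> (\<Sum>n. ennreal (2 powr s) * ennreal (diameter (U n) powr s))"
    using W(3) by (intro suminf_le) (auto simp: emeasure_eq_measure simp flip: ennreal_mult intro!: ennreal_leI)
  also have "\<dots> = ennreal (2 powr s) * (\<Sum>n. ennreal (diameter (U n) powr s))" by simp
  also have "\<dots> \<le> ennreal (2 powr s) * ennreal \<epsilon>" using U(4) by (intro mult_left_mono) auto
  also have "\<dots> = ennreal (measure \<kappa> A / 2)" by (simp add: \<epsilon>_def flip: ennreal_mult')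
  finally have "measure \<kappa> A' \<le> measure \<kappa> A / 2" by (simp add: emeasure_eq_measure)
  then show False using A'pos by simp
qed

section \<open>Riesz kernels and the energy of a square\<close>

text \<open>The value \<open>\<top>\<close> at \<open>0\<close> absorbs the diagonal, where \<open>2 / kor_dist\<close> has the junk value \<open>0\<close>.\<close>

definition riesz :: "real \<Rightarrow> real \<Rightarrow> ennreal" where
  "riesz a x = (if x = 0 then \<top> else ennreal (\<bar>x\<bar> powr (- a)))"

lemma riesz_measurable [measurable]: "riesz a \<in> borel_measurable borel"
  unfolding riesz_def by measurable

text \<open>Split at distance \<open>L\<close> from \<open>c\<close>: the near part is at most the
  integral over \<open>{-L..L}\<close> and gives \<open>2 / (1 - a)\<close>; on the far part the
  kernel is at most \<open>L powr (- a)\<close>, which gives \<open>1\<close>. Uniformity in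
  \<open>c\<close> later absorbs the twist.\<close>

lemma nn_integral_riesz_interval:
  assumes a: "0 \<le> a" "a < 1" and L: "L > 0" and I: "I \<in> sets borel" "emeasure lborel I \<le> ennreal L"
  shows "(\<integral>\<^sup>+s. indicator I s * riesz a (c - s) \<partial>lborel) \<le> ennreal ((2 / (1 - a) + 1) * L powr (1 - a))"
proof -
  note [measurable] = I(1)
  have shift: "(\<integral>\<^sup>+s. f (c - s) \<partial>lborel) = (\<integral>\<^sup>+x. f x \<partial>lborel)" if [measurable]: "f \<in> borel_measurable borel" for f :: "real \<Rightarrow> ennreal"
    using nn_integral_real_affine[of f "-1" c] by simp
  have half: "(\<integral>\<^sup>+x. ennreal (x powr (- a)) * indicator {0..L} x \<partial>lborel) = ennreal (L powr (1 - a) / (1 - a))"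
  proof -
    have "(\<integral>\<^sup>+x. ennreal (x powr (- a)) * indicator {0..L} x \<partial>lborel) = ennreal (L powr (- a + 1) / (- a + 1))"
    proof (rule nn_integral_has_integral_lebesgue')
      show "((\<lambda>x. x powr (- a)) has_integral L powr (- a + 1) / (- a + 1)) {0..L}"
        using has_integral_powr_from_0[of "- a" L] a L by simp
    qed auto
    then show ?thesis by (simp add: algebra_simps)
  qed
  have near: "(\<integral>\<^sup>+x. riesz a x * indicator {-L..L} x \<partial>lborel) \<le> ennreal (2 / (1 - a) * L powr (1 - a))"
  proof -
    have "(\<integral>\<^sup>+x. riesz a x * indicator {-L..L} x \<partial>lborel)
      = (\<integral>\<^sup>+x. ennreal (x powr (- a)) * indicator {0..L} x + ennreal ((- x) powr (- a)) * indicator {0..L} (- x) \<partial>lborel)"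
      by (rule nn_integral_cong_AE, use AE_lborel_singleton[of 0] in eventually_elim)
         (auto simp: riesz_def indicator_def abs_if)
    also have "\<dots> = (\<integral>\<^sup>+x. ennreal (x powr (- a)) * indicator {0..L} x \<partial>lborel) +
        (\<integral>\<^sup>+x. ennreal ((- x) powr (- a)) * indicator {0..L} (- x) \<partial>lborel)"
      by (rule nn_integral_add) auto
    also have "(\<integral>\<^sup>+x. ennreal ((- x) powr (- a)) * indicator {0..L} (- x) \<partial>lborel) = (\<integral>\<^sup>+x. ennreal (x powr (- a)) * indicator {0..L} x \<partial>lborel)"
      using nn_integral_real_affine[of "\<lambda>x. ennreal (x powr (- a)) * indicator {0..L} x" "-1" 0] by simp
    finally show ?thesis unfolding half using a by (simp flip: ennreal_plus)
  qed
  have "(\<integral>\<^sup>+s. indicator I s * riesz a (c - s) \<partial>lborel)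
      \<le> (\<integral>\<^sup>+s. riesz a (c - s) * indicator {-L..L} (c - s) + ennreal (L powr (- a)) * indicator I s \<partial>lborel)"
  proof (rule nn_integral_mono)
    fix s
    show "indicator I s * riesz a (c - s) \<le> riesz a (c - s) * indicator {-L..L} (c - s) + ennreal (L powr (- a)) * indicator I s"
    proof (cases "c - s \<in> {-L..L}")
      case False
      then have "\<bar>c - s\<bar> powr (- a) \<le> L powr (- a)" using a L by (intro powr_mono2') auto
      then show ?thesis using False L by (auto simp: riesz_def indicator_def intro: ennreal_leI)
    qed (auto simp: indicator_def)
  qed
  also have "\<dots> = (\<integral>\<^sup>+x. riesz a x * indicator {-L..L} x \<partial>lborel) + ennreal (L powr (- a)) * emeasure lborel I"
    by (subst nn_integral_add) (auto simp: shift[of "\<lambda>x. riesz a x * indicator {-L..L} x"] nn_integral_cmult_indicator)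
  also have "\<dots> \<le> ennreal (2 / (1 - a) * L powr (1 - a)) + ennreal (L powr (- a)) * ennreal L"
    by (intro add_mono near mult_left_mono I) auto
  also have "\<dots> = ennreal ((2 / (1 - a) + 1) * L powr (1 - a))"
    using a L by (simp add: ennreal_plus[symmetric] ennreal_mult[symmetric] powr_diff powr_minus divide_simps del: ennreal_plus) (simp add: algebra_simps)
  finally show ?thesis .
qed

lemma nn_integral_complex_prod:
  fixes f g :: "real \<Rightarrow> ennreal"
  assumes [measurable]: "f \<in> borel_measurable borel" "g \<in> borel_measurable borel"
  shows "(\<integral>\<^sup>+z. f (Re z) * g (Im z) \<partial>lborel) = (\<integral>\<^sup>+x. f x \<partial>lborel) * (\<integral>\<^sup>+x. g x \<partial>lborel)"
proof -
  define h where "h b = (if b = (1::complex) then f else g)" for b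
  have "(\<integral>\<^sup>+z. (\<Prod>b\<in>Basis. h b (z \<bullet> b)) \<partial>(lborel :: complex measure)) = (\<Prod>b\<in>Basis. (\<integral>\<^sup>+x. h b x \<partial>lborel))"
    by (rule nn_integral_lborel_prod) (auto simp: h_def)
  moreover have "\<i> \<noteq> 1" by (simp add: complex_eq_iff)
  ultimately show ?thesis by (simp add: Basis_complex_def h_def inner_complex_def)
qed

text \<open>The Koranyi distance dominates both planar coordinates, and its square dominates the
  twisted vertical difference. Distributing \<gamma> over these three inequalities separates the
  variables; the square is why \<open>b\<close> is counted twice.\<close>

lemma kor_dist_kernel_le:
  assumes "\<gamma> = 2 * a + 2 * b" "0 \<le> a" "0 \<le> b"
  shows "ennreal ((2 / kor_dist (u, t) (v, s)) powr \<gamma>) \<le>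
    ennreal (2 powr \<gamma>) * (riesz a (Re u - Re v) * riesz a (Im u - Im v) * riesz b ((t - Im (cnj v * u)) - s))"
proof -
  define d where "d = kor_dist (u, t) (v, s)"
  define \<tau> where "\<tau> = (t - Im (cnj v * u)) - s"
  have nz: "riesz a x \<noteq> 0" for a x by (auto simp: riesz_def)
  show ?thesis
  \<comment> \<open>If a coordinate vanishes, one factor on the right is \<top> and none is
    \<open>0\<close>.\<close>
  proof (cases "Re u - Re v = 0 \<or> Im u - Im v = 0 \<or> \<tau> = 0")
    case True
    then have "riesz a (Re u - Re v) * riesz a (Im u - Im v) * riesz b \<tau> = \<top>"
      using nz by (auto simp: riesz_def ennreal_mult_eq_top_iff ennreal_top_mult ennreal_mult_top)
    then show ?thesis unfolding \<tau>_def by (simp add: ennreal_mult_top)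
  next
    case False
    have d4: "d ^ 4 = cmod (u - v) ^ 4 + 4 * \<tau>\<^sup>2"
      unfolding d_def kor_dist_power4 \<tau>_def by (simp add: algebra_simps)
    have 1: "\<bar>Re u - Re v\<bar> \<le> d" "\<bar>Im u - Im v\<bar> \<le> d"
      using cmod_le_kor_dist[of "(u, t)" "(v, s)"] abs_Re_le_cmod[of "u - v"] abs_Im_le_cmod[of "u - v"]
      by (auto simp: d_def)
    have "\<bar>\<tau>\<bar>\<^sup>2 \<le> (d\<^sup>2)\<^sup>2" using d4 by (simp flip: power_mult)
    then have 2: "\<bar>\<tau>\<bar> \<le> d\<^sup>2" by (rule power2_le_imp_le) simp
    have d: "d > 0" using 1 False by linarith
    have "d powr (- \<gamma>) = d powr (- a) * d powr (- a) * (d\<^sup>2) powr (- b)"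
      using d by (simp add: assms(1) powr_powr flip: powr_add powr_numeral)
    also have "\<dots> \<le> \<bar>Re u - Re v\<bar> powr (- a) * \<bar>Im u - Im v\<bar> powr (- a) * \<bar>\<tau>\<bar> powr (- b)"
      using 1 2 False assms by (intro mult_mono powr_mono2') auto
    finally have dle: "d powr (- \<gamma>) \<le> \<bar>Re u - Re v\<bar> powr (- a) * \<bar>Im u - Im v\<bar> powr (- a) * \<bar>\<tau>\<bar> powr (- b)" .
    have "(2 / d) powr \<gamma> \<le> 2 powr \<gamma> * (\<bar>Re u - Re v\<bar> powr (- a) * \<bar>Im u - Im v\<bar> powr (- a) * \<bar>\<tau>\<bar> powr (- b))"
    proof -
      have "(2 / d) powr \<gamma> = 2 powr \<gamma> * d powr (- \<gamma>)" using d by (simp add: powr_divide powr_minus_divide)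
      then show ?thesis using dle by (simp add: mult_left_mono del: powr_minus)
    qed
    then have "ennreal ((2 / d) powr \<gamma>) \<le> ennreal (2 powr \<gamma> * (\<bar>Re u - Re v\<bar> powr (- a) * \<bar>Im u - Im v\<bar> powr (- a) * \<bar>\<tau>\<bar> powr (- b)))"
      by (rule ennreal_leI)
    also have "\<dots> = ennreal (2 powr \<gamma>) * (riesz a (Re u - Re v) * riesz a (Im u - Im v) * riesz b \<tau>)"
      using False by (simp add: riesz_def ennreal_mult)
    finally show ?thesis unfolding d_def \<tau>_def .
  qed
qed

text \<open>For fixed \<open>v\<close> the twist only translates \<open>s\<close>, so the vertical
  integral over a window of length \<open>1\<close> is bounded by a constant. Each planar coordinate
  contributes \<open>L powr (1 - a)\<close> and the outer integration the area \<open>L ^ 2\<close>,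
  in all \<open>L powr (4 - 2 * a)\<close>.\<close>

lemma grid_sq_energy:
  assumes ab: "\<gamma> = 2 * a + 2 * b" "0 \<le> a" "a < 1" "0 \<le> b" "b < 1"
  shows "\<exists>C\<ge>0. \<forall>k c. (\<integral>\<^sup>+x. \<integral>\<^sup>+y. indicator (fst -` grid_sq k c \<inter> Omega) x * indicator (fst -` grid_sq k c \<inter> Omega) y *
      ennreal ((2 / kor_dist x y) powr \<gamma>) \<partial>Hmeas \<partial>Hmeas) \<le> ennreal (C * (4 / 2 ^ k) powr (4 - 2 * a))"
proof (intro exI conjI allI)
  define Ka where "Ka = 2 / (1 - a) + 1"
  define Kb where "Kb = 2 / (1 - b) + 1"
  have K: "Ka \<ge> 0" "Kb \<ge> 0" using ab by (auto simp: Ka_def Kb_def)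
  let ?C = "Hmeas_const * Hmeas_const * 2 powr \<gamma> * Kb * Ka\<^sup>2"
  show "?C \<ge> 0" using K Hmeas_const_pos by simp
  fix k and c :: "int \<times> int"
  define L :: real where "L = 4 / 2 ^ k"
  have L: "L > 0" by (simp add: L_def)
  define I1 where "I1 = {x::real. \<bar>x - of_int (fst c) / 2 ^ k\<bar> < 2 / 2 ^ k}"
  define I2 where "I2 = {x::real. \<bar>x - of_int (snd c) / 2 ^ k\<bar> < 2 / 2 ^ k}"
  have int: "{x::real. \<bar>x - p\<bar> < q} = {p - q<..<p + q}" for p q by auto
  have I [measurable]: "I1 \<in> sets borel" "I2 \<in> sets borel" and eI: "emeasure lborel I1 = ennreal L" "emeasure lborel I2 = ennreal L"
    unfolding I1_def I2_def int by (auto simp: L_def)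
  let ?S = "{-1/2..1/2::real}"
  let ?U = "fst -` grid_sq k c \<inter> Omega :: heis set"
  have U: "(u, t) \<in> ?U \<Longrightarrow> Re u \<in> I1 \<and> Im u \<in> I2 \<and> t \<in> ?S" for u t
    using Omega_bounds(2)[of u t] by (auto simp: grid_sq_def I1_def I2_def abs_le_iff)
  have U_le: "indicator ?U (u, t) \<le> (indicator I1 (Re u) * indicator I2 (Im u) * indicator ?S t :: ennreal)" for u t
    using U[of u t] by (auto simp: indicator_def)
  have [measurable]: "Omega \<in> sets borel" by (intro borel_compact compact_Omega)
  have "fst -` grid_sq k c \<in> sets (borel :: heis measure)"
    by (intro borel_open open_vimage open_grid_sq continuous_intros)
  then have [measurable]: "?U \<in> sets borel" by simp
  have inner: "(\<integral>\<^sup>+y. indicator ?U y * ennreal ((2 / kor_dist (u, t) y) powr \<gamma>) \<partial>Hmeas)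
      \<le> ennreal (Hmeas_const * 2 powr \<gamma> * Kb * Ka\<^sup>2 * (L powr (1 - a))\<^sup>2)" for u t
  proof -
    have "(\<integral>\<^sup>+y. indicator ?U y * ennreal ((2 / kor_dist (u, t) y) powr \<gamma>) \<partial>Hmeas)
       = ennreal Hmeas_const * (\<integral>\<^sup>+v. \<integral>\<^sup>+s. indicator ?U (v, s) * ennreal ((2 / kor_dist (u, t) (v, s)) powr \<gamma>) \<partial>lborel \<partial>lborel)"
      by (rule nn_integral_Hmeas) measurable
    also have "\<dots> \<le> ennreal Hmeas_const * (\<integral>\<^sup>+v. \<integral>\<^sup>+s. ennreal (2 powr \<gamma>) * (indicator I1 (Re v) * riesz a (Re u - Re v)) *
        (indicator I2 (Im v) * riesz a (Im u - Im v)) * (indicator ?S s * riesz b ((t - Im (cnj v * u)) - s)) \<partial>lborel \<partial>lborel)"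
    proof (intro mult_left_mono nn_integral_mono)
      fix v s
      have "indicator ?U (v, s) * ennreal ((2 / kor_dist (u, t) (v, s)) powr \<gamma>)
        \<le> (indicator I1 (Re v) * indicator I2 (Im v) * indicator ?S s) *
          (ennreal (2 powr \<gamma>) * (riesz a (Re u - Re v) * riesz a (Im u - Im v) * riesz b ((t - Im (cnj v * u)) - s)))"
        by (intro mult_mono U_le kor_dist_kernel_le ab) auto
      then show "indicator ?U (v, s) * ennreal ((2 / kor_dist (u, t) (v, s)) powr \<gamma>)
        \<le> ennreal (2 powr \<gamma>) * (indicator I1 (Re v) * riesz a (Re u - Re v)) *
        (indicator I2 (Im v) * riesz a (Im u - Im v)) * (indicator ?S s * riesz b ((t - Im (cnj v * u)) - s))"
        by (simp only: mult_ac)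
    qed auto
    also have "\<dots> \<le> ennreal Hmeas_const * (\<integral>\<^sup>+v. ennreal (2 powr \<gamma>) * (indicator I1 (Re v) * riesz a (Re u - Re v)) *
        (indicator I2 (Im v) * riesz a (Im u - Im v)) * ennreal Kb \<partial>lborel)"
    proof (intro mult_left_mono nn_integral_mono)
      fix v
      have "(\<integral>\<^sup>+s. indicator ?S s * riesz b ((t - Im (cnj v * u)) - s) \<partial>lborel) \<le> ennreal (Kb * 1 powr (1 - b))"
        unfolding Kb_def using ab by (intro nn_integral_riesz_interval) auto
      then show "(\<integral>\<^sup>+s. ennreal (2 powr \<gamma>) * (indicator I1 (Re v) * riesz a (Re u - Re v)) *
        (indicator I2 (Im v) * riesz a (Im u - Im v)) * (indicator ?S s * riesz b ((t - Im (cnj v * u)) - s)) \<partial>lborel)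
        \<le> ennreal (2 powr \<gamma>) * (indicator I1 (Re v) * riesz a (Re u - Re v)) *
        (indicator I2 (Im v) * riesz a (Im u - Im v)) * ennreal Kb"
        by (subst nn_integral_cmult) (auto intro!: mult_left_mono)
    qed auto
    also have "(\<integral>\<^sup>+v. ennreal (2 powr \<gamma>) * (indicator I1 (Re v) * riesz a (Re u - Re v)) *
        (indicator I2 (Im v) * riesz a (Im u - Im v)) * ennreal Kb \<partial>lborel)
      = (\<integral>\<^sup>+v. (ennreal (2 powr \<gamma>) * ennreal Kb) * ((indicator I1 (Re v) * riesz a (Re u - Re v)) *
        (indicator I2 (Im v) * riesz a (Im u - Im v))) \<partial>lborel)"
      by (simp only: mult_ac)
    also have "\<dots> = (ennreal (2 powr \<gamma>) * ennreal Kb) * ((\<integral>\<^sup>+x. indicator I1 x * riesz a (Re u - x) \<partial>lborel) *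
        (\<integral>\<^sup>+x. indicator I2 x * riesz a (Im u - x) \<partial>lborel))"
      by (subst nn_integral_cmult, measurable, subst nn_integral_complex_prod[of "\<lambda>x. indicator I1 x * riesz a (Re u - x)" "\<lambda>x. indicator I2 x * riesz a (Im u - x)"])
         auto
    also have "ennreal Hmeas_const * \<dots> \<le> ennreal Hmeas_const * ((ennreal (2 powr \<gamma>) * ennreal Kb) * (ennreal (Ka * L powr (1 - a)) * ennreal (Ka * L powr (1 - a))))"
      unfolding Ka_def using ab L eI by (intro mult_left_mono mult_mono nn_integral_riesz_interval) auto
    also have "\<dots> = ennreal (Hmeas_const * 2 powr \<gamma> * Kb * Ka\<^sup>2 * (L powr (1 - a))\<^sup>2)"
      using Hmeas_const_pos K by (simp add: power2_eq_square mult_ac flip: ennreal_mult)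
    finally show ?thesis .
  qed
  have "(\<integral>\<^sup>+x. \<integral>\<^sup>+y. indicator ?U x * indicator ?U y * ennreal ((2 / kor_dist x y) powr \<gamma>) \<partial>Hmeas \<partial>Hmeas)
    = (\<integral>\<^sup>+x. indicator ?U x * (\<integral>\<^sup>+y. indicator ?U y * ennreal ((2 / kor_dist x y) powr \<gamma>) \<partial>Hmeas) \<partial>Hmeas)"
    by (intro nn_integral_cong) (simp add: mult.assoc nn_integral_cmult)
  also have "\<dots> \<le> (\<integral>\<^sup>+x. indicator ?U x * ennreal (Hmeas_const * 2 powr \<gamma> * Kb * Ka\<^sup>2 * (L powr (1 - a))\<^sup>2) \<partial>Hmeas)"
    using inner by (intro nn_integral_mono mult_left_mono) auto
  also have "\<dots> = emeasure Hmeas ?U * ennreal (Hmeas_const * 2 powr \<gamma> * Kb * Ka\<^sup>2 * (L powr (1 - a))\<^sup>2)"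
    by (simp add: nn_integral_multc)
  also have "emeasure Hmeas ?U \<le> ennreal (Hmeas_const * L\<^sup>2)"
  proof -
    have "emeasure Hmeas ?U = (\<integral>\<^sup>+p. indicator ?U p \<partial>Hmeas)" by simp
    also have "\<dots> = ennreal Hmeas_const * (\<integral>\<^sup>+u. \<integral>\<^sup>+t. indicator ?U (u, t) \<partial>lborel \<partial>lborel)" by (rule nn_integral_Hmeas) simp
    also have "\<dots> \<le> ennreal Hmeas_const * (\<integral>\<^sup>+u. \<integral>\<^sup>+t. indicator I1 (Re u) * indicator I2 (Im u) * indicator ?S t \<partial>lborel \<partial>lborel)"
      by (intro mult_left_mono nn_integral_mono U_le) auto
    also have "\<dots> = ennreal Hmeas_const * (\<integral>\<^sup>+u. indicator I1 (Re u) * indicator I2 (Im u) \<partial>lborel)"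
      by (simp add: nn_integral_cmult_indicator)
    also have "\<dots> = ennreal Hmeas_const * (ennreal L * ennreal L)"
      by (subst nn_integral_complex_prod) (auto simp: eI)
    finally show ?thesis using L Hmeas_const_pos by (simp add: power2_eq_square ennreal_mult)
  qed
  also have "ennreal (Hmeas_const * L\<^sup>2) * ennreal (Hmeas_const * 2 powr \<gamma> * Kb * Ka\<^sup>2 * (L powr (1 - a))\<^sup>2) = ennreal (?C * L powr (4 - 2 * a))"
  proof -
    have "L powr (4 - 2 * a) = L powr 2 * (L powr (1 - a) * L powr (1 - a))" by (simp flip: powr_add)
    then have "L powr (4 - 2 * a) = L\<^sup>2 * (L powr (1 - a))\<^sup>2" using L by (simp add: power2_eq_square)
    then show ?thesis using Hmeas_const_pos K L by (simp add: mult_ac flip: ennreal_mult)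
  qed
  finally show "(\<integral>\<^sup>+x. \<integral>\<^sup>+y. indicator ?U x * indicator ?U y * ennreal ((2 / kor_dist x y) powr \<gamma>) \<partial>Hmeas \<partial>Hmeas)
    \<le> ennreal (?C * (4 / 2 ^ k) powr (4 - 2 * a))"
    unfolding L_def by (simp add: mult_right_mono)
qed

lemma liminf_power2_ennreal: "(liminf (f :: nat \<Rightarrow> ennreal))\<^sup>2 = liminf (\<lambda>n. (f n)\<^sup>2)"
proof (rule Liminf_compose_continuous_mono[symmetric])
  show "continuous_on UNIV (\<lambda>x::ennreal. x\<^sup>2)"
    unfolding continuous_on_def power2_eq_square
    by (intro ballI tendsto_mult_ennreal tendsto_ident_at) auto
  show "mono (\<lambda>x::ennreal. x\<^sup>2)" by (intro monoI power_mono) auto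
qed simp

section \<open>Finite energy of the projected measure\<close>

context poisson_cutout
begin

lemma AE_energy_finite:
  assumes t: "0 < t" "t < 4 - \<gamma>" and g: "2 \<le> \<gamma>"
  shows "AE \<omega> in M. (\<Sum>k. ennreal (2 powr (t * real k)) *
    (\<Sum>c\<in>grid_idx k. (liminf (\<lambda>n. emeasure (cutout_meas_n M Y n \<omega>) (fst -` grid_sq k c)))\<^sup>2)) \<noteq> \<infinity>"
proof -
  \<comment> \<open>\<open>b < 1\<close> is the condition \<open>t < 4 - \<gamma>\<close>, and
    \<open>a \<ge> 0\<close> follows from
    \<open>t < 4 - \<gamma> \<le> 2 \<le> \<gamma>\<close>.\<close>
  define a where "a = (\<gamma> - t) / 4"
  define b where "b = (\<gamma> + t) / 4"
  have ab: "\<gamma> = 2 * a + 2 * b" "0 \<le> a" "a < 1" "0 \<le> b" "b < 1" using t g by (auto simp: a_def b_def field_simps)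
  obtain C where C: "C \<ge> 0" "\<And>k c. (\<integral>\<^sup>+x. \<integral>\<^sup>+y. indicator (fst -` grid_sq k c \<inter> Omega) x * indicator (fst -` grid_sq k c \<inter> Omega) y *
      ennreal ((2 / kor_dist x y) powr \<gamma>) \<partial>Hmeas \<partial>Hmeas) \<le> ennreal (C * (4 / 2 ^ k) powr (4 - 2 * a))"
    using grid_sq_energy[OF ab] by blast
  have [measurable]: "Omega \<in> sets borel" by (intro borel_compact compact_Omega)
  have Vm [measurable]: "(fst -` grid_sq k c :: heis set) \<in> sets borel" for k c
    by (intro borel_open open_vimage open_grid_sq continuous_intros)
  define X where "X k c \<omega> = (liminf (\<lambda>n. emeasure (cutout_meas_n M Y n \<omega>) (fst -` grid_sq k c)))\<^sup>2" for k c \<omega>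
  have [measurable]: "X k c \<in> borel_measurable M" for k c unfolding X_def by measurable
  have EX: "(\<integral>\<^sup>+\<omega>. X k c \<omega> \<partial>M) \<le> ennreal (C * (4 / 2 ^ k) powr (4 - 2 * a))" for k c
  proof -
    have "(\<integral>\<^sup>+\<omega>. X k c \<omega> \<partial>M) \<le> liminf (\<lambda>n. \<integral>\<^sup>+\<omega>. (emeasure (cutout_meas_n M Y n \<omega>) (fst -` grid_sq k c))\<^sup>2 \<partial>M)"
      unfolding X_def liminf_power2_ennreal by (rule nn_integral_liminf) measurable
    also have "\<dots> \<le> liminf (\<lambda>n. ennreal (C * (4 / 2 ^ k) powr (4 - 2 * a)))"
    proof (rule Liminf_mono, rule always_eventually, rule allI)
      fix n
      have "emeasure (cutout_meas_n M Y n \<omega>) (fst -` grid_sq k c) = emeasure (cutout_meas_n M Y n \<omega>) (fst -` grid_sq k c \<inter> Omega)" for \<omega>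
      proof -
        have "indicator (fst -` grid_sq k c) y * indicator (cutout_set_n Y n \<omega>) y =
            (indicator (fst -` grid_sq k c \<inter> Omega) y * indicator (cutout_set_n Y n \<omega>) y :: ennreal)" for y
          using cutout_set_n_subset[of Y n \<omega>] by (auto simp: indicator_def)
        then show ?thesis by (simp add: emeasure_cutout_meas_n)
      qed
      then show "(\<integral>\<^sup>+\<omega>. (emeasure (cutout_meas_n M Y n \<omega>) (fst -` grid_sq k c))\<^sup>2 \<partial>M) \<le> ennreal (C * (4 / 2 ^ k) powr (4 - 2 * a))"
        using order_trans[OF second_moment[of "fst -` grid_sq k c \<inter> Omega" n] C(2)[of k c]] by simp
    qed
    finally show ?thesis by (simp add: Liminf_const)
  qed
  \<comment> \<open>The weight gives \<open>2 powr (t * k)\<close>, the number of squares is of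
    order \<open>4 ^ k\<close>, and each square gives \<open>2 powr (- (4 - 2 * a) * k)\<close>. The
    resulting exponent per scale is \<open>(\<gamma> + t) / 2 - 2 < 0\<close>.\<close>
  define q where "q = 2 powr (t - 2 + 2 * a)"
  have "t - 2 + 2 * a < 0" using t by (simp add: a_def field_simps)
  then have q: "0 < q" "q < 1" by (auto simp: q_def powr_less_one)
  define D where "D = 9 * C * 4 powr (4 - 2 * a)"
  have "(\<integral>\<^sup>+\<omega>. (\<Sum>k. ennreal (2 powr (t * real k)) * (\<Sum>c\<in>grid_idx k. X k c \<omega>)) \<partial>M)
    = (\<Sum>k. ennreal (2 powr (t * real k)) * (\<Sum>c\<in>grid_idx k. \<integral>\<^sup>+\<omega>. X k c \<omega> \<partial>M))"
    by (subst nn_integral_suminf) (auto simp: nn_integral_cmult nn_integral_sum)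
  also have "\<dots> \<le> (\<Sum>k. ennreal (D * q ^ k))"
  proof (intro suminf_le)
    fix k
    have "ennreal (2 powr (t * real k)) * (\<Sum>c\<in>grid_idx k. \<integral>\<^sup>+\<omega>. X k c \<omega> \<partial>M)
      \<le> ennreal (2 powr (t * real k)) * (\<Sum>c\<in>grid_idx k. ennreal (C * (4 / 2 ^ k) powr (4 - 2 * a)))"
      by (intro mult_left_mono sum_mono EX) auto
    also have "\<dots> = ennreal (2 powr (t * real k) * (real (card (grid_idx k)) * (C * (4 / 2 ^ k) powr (4 - 2 * a))))"
      using C(1) by (simp add: ennreal_mult ennreal_of_nat_eq_real_of_nat)
    also have "\<dots> \<le> ennreal (2 powr (t * real k) * ((9 * 4 ^ k) * (C * (4 / 2 ^ k) powr (4 - 2 * a))))"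
      using C(1) by (intro ennreal_leI mult_left_mono mult_right_mono card_grid_idx_le) auto
    also have "2 powr (t * real k) * ((9 * 4 ^ k) * (C * (4 / 2 ^ k) powr (4 - 2 * a))) = D * q ^ k"
    proof -
      have "(2 ^ k) powr (4 - 2 * a) = 2 powr ((4 - 2 * a) * real k)" by (simp add: powr_powr mult.commute flip: powr_realpow)
      moreover have "(4::real) ^ k = 2 powr (2 * real k)" by (simp add: powr_powr powr_realpow flip: powr_powr)
      moreover have "q ^ k = 2 powr (t * real k) * 2 powr (2 * real k) / 2 powr ((4 - 2 * a) * real k)"
        by (simp add: q_def powr_power flip: powr_add powr_diff) (simp add: algebra_simps)
      ultimately show ?thesis by (simp add: D_def powr_divide)
    qed
    finally show "ennreal (2 powr (t * real k)) * (\<Sum>c\<in>grid_idx k. \<integral>\<^sup>+\<omega>. X k c \<omega> \<partial>M) \<le> ennreal (D * q ^ k)" .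
  qed auto
  also have "\<dots> < \<infinity>"
  proof -
    have "summable (\<lambda>k. D * q ^ k)" using q by (intro summable_mult summable_geometric) auto
    then show ?thesis using q C by (subst suminf_ennreal2) (auto simp: D_def)
  qed
  finally show ?thesis unfolding X_def[symmetric]
    by (intro nn_integral_noteq_infinite) (auto simp: less_top)
qed

text \<open>One null set serves all limit measures and all Borel sets: the random energies involve
  only stage measures and are finite for the countably many exponents \<open>T j\<close> tending to
  \<open>4 - \<gamma>\<close>. At a fixed sample point the portmanteau inequality on open squares
  transfers them to any weak limit.\<close>

lemma AE_hausdorff_dim_ge:
  assumes g: "2 \<le> \<gamma>" "\<gamma> < 4"
  shows "AE \<omega> in M. \<forall>\<mu> A. sets \<mu> = sets borel \<and> finite_measure \<mu> \<and> weak_star_conv (\<lambda>n. cutout_meas_n M Y n \<omega>) \<mu> \<and>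
    A \<in> sets borel \<and> emeasure (distr \<mu> (borel :: complex measure) fst) A > 0 \<longrightarrow> 4 - \<gamma> \<le> hausdorff_dim A"
proof -
  define T where "T j = (4 - \<gamma>) * (1 - 1 / real (Suc (Suc j)))" for j
  have T: "0 < T j" "T j < 4 - \<gamma>" for j
  proof -
    have "0 < 1 - 1 / real (Suc (Suc j))" "1 - 1 / real (Suc (Suc j)) < 1" by (auto simp: field_simps)
    then show "0 < T j" "T j < 4 - \<gamma>" unfolding T_def using g mult_strict_left_mono[of "1 - 1 / real (Suc (Suc j))" 1 "4 - \<gamma>"] by auto
  qed
  have "AE \<omega> in M. \<forall>j. (\<Sum>k. ennreal (2 powr (T j * real k)) *
    (\<Sum>c\<in>grid_idx k. (liminf (\<lambda>n. emeasure (cutout_meas_n M Y n \<omega>) (fst -` grid_sq k c)))\<^sup>2)) \<noteq> \<infinity>"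
    unfolding AE_all_countable by (intro allI AE_energy_finite T g)
  then show ?thesis
  proof (rule AE_mp, intro AE_I2 impI allI)
    fix \<omega> and \<mu> :: "heis measure" and A :: "complex set"
    assume \<omega>: "\<omega> \<in> space M" and en: "\<forall>j. (\<Sum>k. ennreal (2 powr (T j * real k)) *
    (\<Sum>c\<in>grid_idx k. (liminf (\<lambda>n. emeasure (cutout_meas_n M Y n \<omega>) (fst -` grid_sq k c)))\<^sup>2)) \<noteq> \<infinity>"
      and *: "sets \<mu> = sets borel \<and> finite_measure \<mu> \<and> weak_star_conv (\<lambda>n. cutout_meas_n M Y n \<omega>) \<mu> \<and>
    A \<in> sets borel \<and> emeasure (distr \<mu> (borel :: complex measure) fst) A > 0"
    then have \<mu>: "sets \<mu> = sets borel" "finite_measure \<mu>" "weak_star_conv (\<lambda>n. cutout_meas_n M Y n \<omega>) \<mu>" by auto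
    have sp: "space \<mu> = UNIV" using sets_eq_imp_space_eq[OF \<mu>(1)] by simp
    have fstm: "fst \<in> measurable \<mu> (borel :: complex measure)"
      unfolding measurable_cong_sets[OF \<mu>(1) refl] by (intro borel_measurable_continuous_onI continuous_intros)
    define \<kappa> where "\<kappa> = distr \<mu> (borel :: complex measure) fst"
    have k: "emeasure \<kappa> B = emeasure \<mu> (fst -` B)" if "B \<in> sets borel" for B
      unfolding \<kappa>_def using that fstm by (subst emeasure_distr) (auto simp: sp)
    show "4 - \<gamma> \<le> hausdorff_dim A"
    proof (rule hausdorff_dim_ge)
      fix s assume s: "0 \<le> s" "s < 4 - \<gamma>"
      have "(\<lambda>j. (4 - \<gamma>) * (1 - 1 / real (Suc (Suc j)))) \<longlonglongrightarrow> (4 - \<gamma>) * (1 - 0)"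
        by (intro tendsto_intros LIMSEQ_Suc[OF LIMSEQ_inverse_real_of_nat[unfolded inverse_eq_divide]])
      then have "T \<longlonglongrightarrow> 4 - \<gamma>" unfolding T_def[abs_def] by simp
      from order_tendstoD(1)[OF this s(2)] obtain j where j: "s < T j" by (auto simp: eventually_sequentially)
      show "hausdorff_measure s A \<noteq> 0"
      proof (rule hausdorff_measure_pos_of_energy[where \<kappa> = \<kappa> and t = "T j"])
        show "sets \<kappa> = sets borel" by (simp add: \<kappa>_def)
        show "finite_measure \<kappa>" unfolding \<kappa>_def by (intro finite_measure.finite_measure_distr \<mu> fstm)
        have "emeasure \<mu> (fst -` (- cball 0 1)) \<le> emeasure \<mu> (- cutout_set Y \<omega>)"
        proof (rule emeasure_mono)
          show "fst -` (- cball (0::complex) 1) \<subseteq> - cutout_set Y \<omega>"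
            using Omega_bounds(1) by (force simp: mem_cutout_set)
          show "- cutout_set Y \<omega> \<in> sets \<mu>" unfolding \<mu>
            by (intro borel_open open_Compl compact_imp_closed compact_cutout_set)
        qed
        also have "\<dots> = 0" by (rule weak_limit_concentrated[OF \<mu>(3,1,2)])
        finally show "emeasure \<kappa> (- cball 0 1) = 0" by (subst k) auto
        have "(\<Sum>k. ennreal (2 powr (T j * real k)) * (\<Sum>c\<in>grid_idx k. (emeasure \<kappa> (grid_sq k c))\<^sup>2))
          \<le> (\<Sum>k. ennreal (2 powr (T j * real k)) *
              (\<Sum>c\<in>grid_idx k. (liminf (\<lambda>n. emeasure (cutout_meas_n M Y n \<omega>) (fst -` grid_sq k c)))\<^sup>2))"
        proof (intro suminf_le mult_left_mono sum_mono power_mono)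
          fix i c
          have "open (fst -` grid_sq i c :: heis set)" by (intro open_vimage open_grid_sq continuous_intros)
          then show "emeasure \<kappa> (grid_sq i c) \<le> liminf (\<lambda>n. emeasure (cutout_meas_n M Y n \<omega>) (fst -` grid_sq i c))"
            unfolding k[OF grid_sq_borel] by (intro weak_star_conv_open_liminf \<mu> finite_cutout_meas_n) simp_all
        qed auto
        also have "\<dots> < \<infinity>" using en by (simp add: less_top)
        finally show "(\<Sum>k. ennreal (2 powr (T j * real k)) * (\<Sum>c\<in>grid_idx k. (emeasure \<kappa> (grid_sq k c))\<^sup>2)) < \<infinity>" .
        show "A \<in> sets borel" "emeasure \<kappa> A > 0" using * by (auto simp: \<kappa>_def)
      qed (use s j T in auto)
    qed
  qed
qed

end

section \<open>Concentration of the fibre densities\<close>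

definition layer :: "nat \<Rightarrow> (heis \<times> real) set" where
  "layer n = radii {2 powr (- real (Suc n))..<2 powr (- real n)}"

definition slab :: "nat \<Rightarrow> (heis \<times> real) set" where
  "slab n = radii {2 powr (- real n)..}"

lemma layer_borel [measurable]: "layer n \<in> sets borel"
  unfolding layer_def by simp

lemma slab_layer_disjoint: "slab n \<inter> layer n = {}"
  by (auto simp: slab_def layer_def radii_def)

lemma open_hits: "open (hits y)"
  unfolding hits_def by (intro open_Collect_less continuous_intros)

definition fib0 :: "('w \<Rightarrow> (heis \<times> real) set) \<Rightarrow> nat \<Rightarrow> complex \<Rightarrow> real set \<Rightarrow> 'w \<Rightarrow> real set" where
  "fib0 Y n u I \<omega> = {t\<in>I. (u, t) \<in> cutout_set_n Y n \<omega>}"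

text \<open>The next layer is taken from a second sample point, so that it can be made independent.\<close>

definition fib1 :: "('w \<Rightarrow> (heis \<times> real) set) \<Rightarrow> nat \<Rightarrow> complex \<Rightarrow> real set \<Rightarrow> 'w \<Rightarrow> 'w \<Rightarrow> real set" where
  "fib1 Y n u I \<omega>1 \<omega>2 = {t\<in>fib0 Y n u I \<omega>1. Y \<omega>2 \<inter> (hits (u, t) \<inter> layer n) = {}}"

lemma fib0_borel [measurable]:
  assumes [measurable]: "I \<in> sets borel"
  shows "fib0 Y n u I \<omega> \<in> sets borel"
proof -
  have "(\<lambda>t. (u, t)) -` cutout_set_n Y n \<omega> \<in> sets borel"
    by (intro borel_closed closed_vimage closed_cutout_set_n continuous_intros)
  moreover have "fib0 Y n u I \<omega> = I \<inter> (\<lambda>t. (u, t)) -` cutout_set_n Y n \<omega>" by (auto simp: fib0_def)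
  ultimately show ?thesis by simp
qed

lemma fib1_borel [measurable]:
  assumes [measurable]: "I \<in> sets borel"
  shows "fib1 Y n u I \<omega>1 \<omega>2 \<in> sets borel"
proof -
  define V where "V = (\<Union>p\<in>Y \<omega>2 \<inter> layer n. {t. kor_dist (u, t) (fst p) < snd p})"
  have "open V" unfolding V_def by (intro open_UN ballI open_Collect_less continuous_intros)
  moreover have "fib1 Y n u I \<omega>1 \<omega>2 = fib0 Y n u I \<omega>1 - V"
    by (auto simp: fib1_def V_def hits_def)
  ultimately show ?thesis by (auto intro: borel_open)
qed

lemma fib0_subset: "fib0 Y n u I \<omega> \<subseteq> {-1/2..1/2} \<inter> I"
  using cutout_set_n_subset Omega_bounds(2) by (fastforce simp: fib0_def abs_le_iff)

lemma fib1_subset: "fib1 Y n u I \<omega>1 \<omega>2 \<subseteq> fib0 Y n u I \<omega>1"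
  by (auto simp: fib1_def)

lemma fib0_Suc: "fib0 Y (Suc n) u I \<omega> = fib1 Y n u I \<omega> \<omega>"
  by (auto simp: fib0_def fib1_def mem_cutout_set_Suc layer_def)

lemma fmeasurable_fib:
  assumes "I \<in> sets borel"
  shows "fib0 Y n u I \<omega> \<in> fmeasurable lborel" "fib1 Y n u I \<omega>1 \<omega>2 \<in> fmeasurable lborel"
proof -
  have 1: "emeasure lborel (fib0 Y n u I \<omega>) < \<infinity>" for \<omega>
  proof -
    have "emeasure lborel (fib0 Y n u I \<omega>) \<le> emeasure lborel {-1/2..1/2::real}"
      using fib0_subset[of Y n u I \<omega>] by (intro emeasure_mono) auto
    then show ?thesis by (rule le_less_trans) simp
  qed
  then show "fib0 Y n u I \<omega> \<in> fmeasurable lborel" using assms by (intro fmeasurableI) auto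
  have "emeasure lborel (fib1 Y n u I \<omega>1 \<omega>2) \<le> emeasure lborel (fib0 Y n u I \<omega>1)"
    using assms by (intro emeasure_mono fib1_subset) auto
  then show "fib1 Y n u I \<omega>1 \<omega>2 \<in> fmeasurable lborel" using 1[of \<omega>1] assms
    by (intro fmeasurableI) (auto intro: le_less_trans)
qed

lemma measure_fib1_le: "I \<in> sets borel \<Longrightarrow> measure lborel (fib1 Y n u I \<omega>1 \<omega>2) \<le> measure lborel (fib0 Y n u I \<omega>1)"
  by (intro measure_mono_fmeasurable fib1_subset fmeasurable_fib) auto

section \<open>Cutting a fibre into short pieces\<close>

text \<open>The length \<open>2 / 4 ^ n\<close> is chosen so that no ball of the layer \<open>n\<close> meets two nonadjacent pieces.\<close>

definition piece :: "nat \<Rightarrow> nat \<Rightarrow> real set" where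
  "piece n j = {-1 + real j * (2 / 4 ^ n) ..< -1 + real (Suc j) * (2 / 4 ^ n)}"

lemma piece_borel [measurable]: "piece n j \<in> sets borel"
  by (simp add: piece_def)

lemma emeasure_lborel_Ico_finite: "emeasure lborel {a..<b::real} < \<infinity>"
  by (rule le_less_trans[OF emeasure_mono[of _ "{a..b}"]]) (auto simp: emeasure_lborel_Icc_eq)

lemma measure_pieces:
  assumes [measurable]: "S \<in> sets borel"
  shows "(\<Sum>j<N. measure lborel (S \<inter> piece n j)) = measure lborel (S \<inter> {-1..< -1 + real N * (2 / 4 ^ n)})"
proof (induction N)
  case (Suc N)
  have e: "S \<inter> {-1..< -1 + real (Suc N) * (2 / 4 ^ n)} = (S \<inter> {-1..< -1 + real N * (2 / 4 ^ n)}) \<union> (S \<inter> piece n N)"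
  proof -
    have "0 \<le> real N * (2 / 4 ^ n)" "real N * (2 / 4 ^ n) \<le> real (Suc N) * (2 / 4 ^ n)"
      by (auto intro!: divide_right_mono)
    moreover have "S \<inter> {-1..<b} = (S \<inter> {-1..<a}) \<union> (S \<inter> {a..<b})" if "-1 \<le> a" "a \<le> b" for a b :: real
      using that by auto
    ultimately show ?thesis unfolding piece_def by (simp del: of_nat_Suc)
  qed
  have fin: "emeasure lborel (S \<inter> {a..<b::real}) < \<infinity>" for a b
    by (rule le_less_trans[OF emeasure_mono[of _ "{a..<b}"] emeasure_lborel_Ico_finite]) auto
  have "measure lborel (S \<inter> {-1..< -1 + real (Suc N) * (2 / 4 ^ n)})
     = measure lborel (S \<inter> {-1..< -1 + real N * (2 / 4 ^ n)}) + measure lborel (S \<inter> piece n N)"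
    unfolding e using fin[of "-1" "-1 + real N * (2 / 4 ^ n)"] fin[of "-1 + real N * (2 / 4 ^ n)" "-1 + real (Suc N) * (2 / 4 ^ n)"]
    by (intro measure_Union) (auto simp: piece_def simp del: of_nat_Suc)
  with Suc show ?case by simp
qed simp

lemma sum_fib_pieces:
  "(\<Sum>j<4 ^ n. measure lborel (fib0 Y n u (piece n j) \<omega>1)) = measure lborel (fib0 Y n u UNIV \<omega>1)"
  "(\<Sum>j<4 ^ n. measure lborel (fib1 Y n u (piece n j) \<omega>1 \<omega>2)) = measure lborel (fib1 Y n u UNIV \<omega>1 \<omega>2)"
proof -
  have 1: "fib0 Y n u (piece n j) \<omega>1 = fib0 Y n u UNIV \<omega>1 \<inter> piece n j"
    "fib1 Y n u (piece n j) \<omega>1 \<omega>2 = fib1 Y n u UNIV \<omega>1 \<omega>2 \<inter> piece n j" for j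
    by (auto simp: fib1_def fib0_def)
  have 2: "S \<inter> {-1..< -1 + real (4 ^ n) * (2 / 4 ^ n)} = S" if "S \<subseteq> fib0 Y n u UNIV \<omega>1" for S
    using fib0_subset[of Y n u UNIV \<omega>1] that by force
  show "(\<Sum>j<4 ^ n. measure lborel (fib0 Y n u (piece n j) \<omega>1)) = measure lborel (fib0 Y n u UNIV \<omega>1)"
    unfolding 1 by (subst measure_pieces, simp, subst 2, auto)
  show "(\<Sum>j<4 ^ n. measure lborel (fib1 Y n u (piece n j) \<omega>1 \<omega>2)) = measure lborel (fib1 Y n u UNIV \<omega>1 \<omega>2)"
    unfolding 1 by (subst measure_pieces, simp, subst 2) (auto simp: fib1_def)
qed

lemma measure_fib0_piece_le: "measure lborel (fib0 Y n u (piece n j) \<omega>) \<le> 2 / 4 ^ n"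
proof -
  have "measure lborel (fib0 Y n u (piece n j) \<omega>) \<le> measure lborel (piece n j)"
    unfolding piece_def
    by (intro measure_mono_fmeasurable fmeasurableI emeasure_lborel_Ico_finite) (auto simp: fib0_def)
  also have "\<dots> = 2 / 4 ^ n"
    unfolding piece_def by (subst measure_lborel_Ico) (auto simp: field_simps intro!: divide_right_mono)
  finally show ?thesis .
qed

text \<open>The region of the layer that decides which points of the piece survive the next stage;
  pieces with disjoint regions evolve independently.\<close>

definition reach :: "nat \<Rightarrow> complex \<Rightarrow> real set \<Rightarrow> (heis \<times> real) set" where
  "reach n u I = (\<Union>t\<in>I. hits (u, t)) \<inter> layer n"

text \<open>The union over \<open>I\<close> may be uncountable, but the cones are open.\<close>

lemma reach_borel [measurable]: "reach n u I \<in> sets borel"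
  unfolding reach_def by (intro sets.Int borel_open open_UN ballI open_hits layer_borel)

lemma reach_subset: "reach n u I \<subseteq> layer n"
  by (auto simp: reach_def)

text \<open>Two points of one fibre have Koranyi distance \<open>sqrt (2 * |t - t'|)\<close>.
  Distinct pieces of equal parity are at least \<open>2 / 4 ^ n\<close> apart, hence at Koranyi
  distance at least \<open>2 / 2 ^ n\<close>, twice the supremum of the radii in the layer; no ball
  contains points of both.\<close>

lemma reach_disjoint:
  assumes "j < k" "even j = even k"
  shows "reach n u (piece n j) \<inter> reach n u (piece n k) = {}"
proof (rule ccontr)
  assume "reach n u (piece n j) \<inter> reach n u (piece n k) \<noteq> {}"
  then obtain p t t' where p: "p \<in> hits (u, t)" "p \<in> hits (u, t')" "p \<in> layer n" "t \<in> piece n j" "t' \<in> piece n k"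
    unfolding reach_def by blast
  have "j + 2 \<le> k" using assms by presburger
  then have "real j + 2 \<le> real k" by linarith
  then have "(real j + 2) * (2 / 4 ^ n) \<le> real k * (2 / 4 ^ n)" by (intro mult_right_mono) auto
  moreover have "(real j + 2) * l = real (Suc j) * l + l" for l :: real by (simp add: algebra_simps)
  ultimately have gap: "t' - t \<ge> 2 / 4 ^ n"
    using p(4,5) unfolding piece_def atLeastLessThan_iff by (smt (verit))
  define r where "r = 2 powr (- real n)"
  have r: "r > 0" "r = 1 / 2 ^ n" by (auto simp: r_def powr_minus powr_realpow divide_simps)
  have "kor_dist (u, t') (u, t) < 2 * r"
    using p kor_dist_triangle[of "(u, t')" "(u, t)" "fst p"] kor_dist_sym[of "fst p" "(u, t)"]
    unfolding hits_def layer_def radii_def r_def by auto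
  then have "kor_dist (u, t') (u, t) ^ 4 < (2 * r) ^ 4" by (intro power_strict_mono) auto
  then have "4 * (t' - t)\<^sup>2 < 16 * r ^ 4" by (simp add: kor_dist_power4 mult.commute[of "cnj u" u] power_mult_distrib)
  moreover have "(2 * r\<^sup>2)\<^sup>2 \<le> (t' - t)\<^sup>2"
  proof (rule power_mono)
    have "4 ^ n = (2 ^ n :: real)\<^sup>2" by (simp add: power2_eq_square flip: power_mult_distrib)
    then show "2 * r\<^sup>2 \<le> t' - t" using gap by (simp add: r power_divide)
  qed simp
  ultimately show False by (simp add: power_mult_distrib flip: power_mult)
qed

section \<open>One step of the fibre densities with the coarse balls frozen\<close>

context poisson_cutout
begin

lemma reach_void_measurable:
  assumes I [measurable]: "I \<in> sets borel"
  shows "{z \<in> space (borel \<Otimes>\<^sub>M Fsig (reach n u I)). fst z \<in> I \<and> Y (snd z) \<inter> (hits (u, fst z) \<inter> layer n) = {}}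
    \<in> sets (borel \<Otimes>\<^sub>M Fsig (reach n u I))"
proof -
  let ?W = "{z. kor_dist (u, fst z) (fst (snd z)) < snd (snd z)}"
  have "open ?W" by (intro open_Collect_less continuous_intros)
  from joint_void_measurable[OF this reach_borel order_refl, of n u I]
  have 1: "{z \<in> space (borel \<Otimes>\<^sub>M Fsig (reach n u I)). Y (snd z) \<inter> {p\<in>reach n u I. (fst z, p) \<in> ?W} = {}}
    \<in> sets (borel \<Otimes>\<^sub>M Fsig (reach n u I))" .
  have 2: "{z \<in> space (borel \<Otimes>\<^sub>M Fsig (reach n u I)). fst z \<in> I} \<in> sets (borel \<Otimes>\<^sub>M Fsig (reach n u I))" by measurable
  have "{z \<in> space (borel \<Otimes>\<^sub>M Fsig (reach n u I)). fst z \<in> I \<and> Y (snd z) \<inter> (hits (u, fst z) \<inter> layer n) = {}}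
    = {z \<in> space (borel \<Otimes>\<^sub>M Fsig (reach n u I)). Y (snd z) \<inter> {p\<in>reach n u I. (fst z, p) \<in> ?W} = {}} \<inter>
      {z \<in> space (borel \<Otimes>\<^sub>M Fsig (reach n u I)). fst z \<in> I}"
    by (auto simp: reach_def hits_def)
  also have "\<dots> \<in> sets (borel \<Otimes>\<^sub>M Fsig (reach n u I))" using 1 2 by (rule sets.Int)
  finally show ?thesis .
qed

text \<open>Measurability in the small algebra of \<open>reach\<close>, with
  \<open>\<omega>1\<close> frozen, is what turns disjointness of regions into independence of the
  new piece lengths.\<close>

lemma measure_fib1_measurable:
  assumes I [measurable]: "I \<in> sets borel"
  shows "(\<lambda>\<omega>2. measure lborel (fib1 Y n u I \<omega>1 \<omega>2)) \<in> borel_measurable (Fsig (reach n u I))"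
proof -
  let ?R = "Fsig (reach n u I)"
  define Q where "Q = {z \<in> space (?R \<Otimes>\<^sub>M lborel). snd z \<in> fib0 Y n u I \<omega>1 \<and> (snd z \<in> I \<and> Y (fst z) \<inter> (hits (u, snd z) \<inter> layer n) = {})}"
  have 1: "{z \<in> space (?R \<Otimes>\<^sub>M lborel). snd z \<in> fib0 Y n u I \<omega>1} \<in> sets (?R \<Otimes>\<^sub>M lborel)" by measurable
  have 2: "{z \<in> space (?R \<Otimes>\<^sub>M lborel). snd z \<in> I \<and> Y (fst z) \<inter> (hits (u, snd z) \<inter> layer n) = {}} \<in> sets (?R \<Otimes>\<^sub>M lborel)"
  proof -
    have "(\<lambda>z. (snd z, fst z)) \<in> measurable (?R \<Otimes>\<^sub>M lborel) (borel \<Otimes>\<^sub>M ?R)" by measurable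
    from measurable_sets[OF this reach_void_measurable[OF I, of n u]]
    show ?thesis by (rule back_subst[of "\<lambda>A. A \<in> sets (?R \<Otimes>\<^sub>M lborel)"]) (auto simp: space_pair_measure)
  qed
  have "Q = {z \<in> space (?R \<Otimes>\<^sub>M lborel). snd z \<in> fib0 Y n u I \<omega>1} \<inter>
     {z \<in> space (?R \<Otimes>\<^sub>M lborel). snd z \<in> I \<and> Y (fst z) \<inter> (hits (u, snd z) \<inter> layer n) = {}}"
    by (auto simp: Q_def)
  then have "Q \<in> sets (?R \<Otimes>\<^sub>M lborel)" using 1 2 by (simp add: sets.Int)
  then have Qm: "(\<lambda>\<omega>2. emeasure lborel (Pair \<omega>2 -` Q)) \<in> borel_measurable ?R"
    by (rule lborel.measurable_emeasure_Pair)
  have "Pair \<omega>2 -` Q = fib1 Y n u I \<omega>1 \<omega>2" if "\<omega>2 \<in> space ?R" for \<omega>2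
    using that by (auto simp: Q_def fib1_def fib0_def space_pair_measure)
  then have "(\<lambda>\<omega>2. emeasure lborel (fib1 Y n u I \<omega>1 \<omega>2)) \<in> borel_measurable ?R"
    by (intro measurable_cong[THEN iffD1, OF _ Qm]) simp
  then show ?thesis unfolding measure_def by measurable
qed

lemma measure_fib1_measurable_M [measurable]:
  assumes "I \<in> sets borel"
  shows "(\<lambda>\<omega>2. measure lborel (fib1 Y n u I \<omega>1 \<omega>2)) \<in> borel_measurable M"
  using measurable_compose[OF id_measurable_Fsig measure_fib1_measurable[OF assms]] .

text \<open>Every point of the fibre survives the layer with the same probability, and Fubini
  integrates this over the points left at stage \<open>n\<close>. This is the martingale property
  given \<open>\<omega>1\<close>.\<close>

lemma expectation_fib1:
  assumes I [measurable]: "I \<in> sets borel"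
  shows "expectation (\<lambda>\<omega>2. measure lborel (fib1 Y n u I \<omega>1 \<omega>2)) = 2 powr (- \<gamma>) * measure lborel (fib0 Y n u I \<omega>1)"
proof -
  interpret P: pair_sigma_finite M "lborel :: real measure" ..
  let ?R = "Fsig (reach n u I)"
  define v where "v t \<omega>2 = (indicator {t\<in>I. Y \<omega>2 \<inter> (hits (u, t) \<inter> layer n) = {}} t :: ennreal)" for t \<omega>2
  have vm: "case_prod (\<lambda>\<omega>2 t. v t \<omega>2) \<in> borel_measurable (M \<Otimes>\<^sub>M lborel)"
  proof -
    have m: "(\<lambda>z. (snd z, fst z)) \<in> measurable (M \<Otimes>\<^sub>M lborel) (borel \<Otimes>\<^sub>M ?R)"
      by (intro measurable_Pair measurable_compose[OF measurable_fst id_measurable_Fsig]) measurable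
    from measurable_sets[OF this reach_void_measurable[OF I, of n u]]
    have "{z \<in> space (M \<Otimes>\<^sub>M lborel). snd z \<in> I \<and> Y (fst z) \<inter> (hits (u, snd z) \<inter> layer n) = {}} \<in> sets (M \<Otimes>\<^sub>M lborel)"
      by (rule back_subst[of "\<lambda>A. A \<in> sets (M \<Otimes>\<^sub>M lborel)"]) (auto simp: space_pair_measure)
    then have "(\<lambda>z. indicator {z \<in> space (M \<Otimes>\<^sub>M lborel). snd z \<in> I \<and> Y (fst z) \<inter> (hits (u, snd z) \<inter> layer n) = {}} z :: ennreal)
      \<in> borel_measurable (M \<Otimes>\<^sub>M lborel)" by simp
    then show ?thesis by (rule measurable_cong[THEN iffD1, rotated]) (auto simp: v_def indicator_def)
  qed
  have vm2: "(\<lambda>z. indicator (fib0 Y n u I \<omega>1) (snd z) * v (snd z) (fst z)) \<in> borel_measurable (M \<Otimes>\<^sub>M lborel)"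
    using vm by (auto simp: case_prod_beta' intro!: borel_measurable_times_ennreal)
  have v1: "(\<lambda>t. v t \<omega>2) \<in> borel_measurable lborel" if "\<omega>2 \<in> space M" for \<omega>2
    using measurable_compose[OF measurable_Pair1'[OF that] vm] by simp
  have v2: "v t \<in> borel_measurable M" for t
    using measurable_compose[OF measurable_Pair2' vm] by simp
  have "(\<integral>\<^sup>+\<omega>2. emeasure lborel (fib1 Y n u I \<omega>1 \<omega>2) \<partial>M) = (\<integral>\<^sup>+\<omega>2. \<integral>\<^sup>+t. indicator (fib0 Y n u I \<omega>1) t * v t \<omega>2 \<partial>lborel \<partial>M)"
  proof (rule nn_integral_cong)
    fix \<omega>2
    have "emeasure lborel (fib1 Y n u I \<omega>1 \<omega>2) = (\<integral>\<^sup>+t. indicator (fib1 Y n u I \<omega>1 \<omega>2) t \<partial>lborel)" by simp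
    also have "\<dots> = (\<integral>\<^sup>+t. indicator (fib0 Y n u I \<omega>1) t * v t \<omega>2 \<partial>lborel)"
      by (intro nn_integral_cong) (auto simp: v_def fib1_def fib0_def indicator_def)
    finally show "emeasure lborel (fib1 Y n u I \<omega>1 \<omega>2) = (\<integral>\<^sup>+t. indicator (fib0 Y n u I \<omega>1) t * v t \<omega>2 \<partial>lborel)" .
  qed
  also have "\<dots> = (\<integral>\<^sup>+t. \<integral>\<^sup>+\<omega>2. indicator (fib0 Y n u I \<omega>1) t * v t \<omega>2 \<partial>M \<partial>lborel)"
    by (rule P.Fubini'[symmetric]) (use vm2 in \<open>simp add: case_prod_beta'\<close>)
  also have "\<dots> = (\<integral>\<^sup>+t. ennreal (2 powr (- \<gamma>)) * indicator (fib0 Y n u I \<omega>1) t \<partial>lborel)"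
  proof (rule nn_integral_cong)
    fix t
    show "(\<integral>\<^sup>+\<omega>2. indicator (fib0 Y n u I \<omega>1) t * v t \<omega>2 \<partial>M) = ennreal (2 powr (- \<gamma>)) * indicator (fib0 Y n u I \<omega>1) t"
    proof (cases "t \<in> fib0 Y n u I \<omega>1")
      case True
      then have "(\<integral>\<^sup>+\<omega>2. v t \<omega>2 \<partial>M) = (\<integral>\<^sup>+\<omega>2. indicator (void (hits (u, t) \<inter> layer n)) \<omega>2 \<partial>M)"
        by (intro nn_integral_cong) (auto simp: v_def void_def indicator_def fib0_def)
      also have "\<dots> = ennreal (2 powr (- \<gamma>))"
        using prob_void_layer[of "(u, t)" n] by (simp add: emeasure_eq_measure layer_def del: of_nat_Suc)
      finally show ?thesis using True by simp
    qed simp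
  qed
  also have "\<dots> = ennreal (2 powr (- \<gamma>)) * emeasure lborel (fib0 Y n u I \<omega>1)"
    by (simp add: nn_integral_cmult_indicator)
  also have "\<dots> = ennreal (2 powr (- \<gamma>) * measure lborel (fib0 Y n u I \<omega>1))"
    using fmeasurable_fib(1)[OF I, of Y n u \<omega>1] by (simp add: emeasure_eq_measure2 ennreal_mult)
  finally have "(\<integral>\<^sup>+\<omega>2. ennreal (measure lborel (fib1 Y n u I \<omega>1 \<omega>2)) \<partial>M) = ennreal (2 powr (- \<gamma>) * measure lborel (fib0 Y n u I \<omega>1))"
    unfolding emeasure_eq_measure2[OF fmeasurable_fib(2)[OF I]] .
  then show ?thesis
    by (subst integral_eq_nn_integral) (auto simp: measure_fib1_measurable_M)
qed

definition Xinc :: "nat \<Rightarrow> complex \<Rightarrow> nat \<Rightarrow> 'w \<Rightarrow> 'w \<Rightarrow> real" where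
  "Xinc n u j \<omega>1 \<omega>2 = 2 powr \<gamma> * measure lborel (fib1 Y n u (piece n j) \<omega>1 \<omega>2) - measure lborel (fib0 Y n u (piece n j) \<omega>1)"

text \<open>On one parity class the increments are independent and centred, and each lies in an
  interval whose width is \<open>2 powr \<gamma>\<close> times the old length; \<open>K\<close>
  bounds the sum of the squared widths.\<close>

lemma Xinc_Hoeffding:
  assumes J: "finite J" "\<And>j k. j \<in> J \<Longrightarrow> k \<in> J \<Longrightarrow> even j = even k"
    and \<epsilon>: "\<epsilon> > 0" and K: "K > 0" "(\<Sum>j\<in>J. (2 powr \<gamma> * measure lborel (fib0 Y n u (piece n j) \<omega>1))\<^sup>2) \<le> K"
  shows "prob {\<omega>2\<in>space M. \<bar>\<Sum>j\<in>J. Xinc n u j \<omega>1 \<omega>2\<bar> \<ge> \<epsilon>} \<le> 2 * exp (- 2 * \<epsilon>\<^sup>2 / K)"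
proof -
  define w where "w j = measure lborel (fib0 Y n u (piece n j) \<omega>1)" for j
  have w0: "0 \<le> w j" for j by (simp add: w_def)
  define \<sigma> where "\<sigma> = (\<Sum>j\<in>J. (((2 powr \<gamma> - 1) * w j) - (- w j))\<^sup>2)"
  have \<sigma>K: "\<sigma> \<le> K" using K(2) by (simp add: \<sigma>_def w_def algebra_simps)
  have bounds: "Xinc n u j \<omega>1 \<omega>2 \<in> {- w j .. (2 powr \<gamma> - 1) * w j}" for j \<omega>2
    using measure_fib1_le[OF piece_borel, of Y n u n j \<omega>1 \<omega>2]
    by (auto simp: Xinc_def w_def left_diff_distrib)
  have Xm: "(\<lambda>\<omega>2. Xinc n u j \<omega>1 \<omega>2) \<in> borel_measurable (Fsig (reach n u (piece n j)))" for j
    unfolding Xinc_def using measure_fib1_measurable[OF piece_borel, of n u n j \<omega>1] by measurable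
  have XM: "(\<lambda>\<omega>2. Xinc n u j \<omega>1 \<omega>2) \<in> borel_measurable M" for j
    by (rule measurable_compose[OF id_measurable_Fsig Xm])
  have "disjoint_family_on (\<lambda>j. reach n u (piece n j)) J"
    unfolding disjoint_family_on_def
  proof (intro ballI impI)
    fix j k assume "j \<in> J" "k \<in> J" "j \<noteq> k"
    then show "reach n u (piece n j) \<inter> reach n u (piece n k) = {}"
      using reach_disjoint[of j k n u] reach_disjoint[of k j n u] J(2)[of j k] by (cases "j < k") auto
  qed
  from indep_sets_Fsig[OF this]
  have indep: "indep_vars (\<lambda>_. borel) (\<lambda>j \<omega>2. Xinc n u j \<omega>1 \<omega>2) J"
    unfolding indep_vars_def2
  proof (intro conjI ballI XM, rule indep_sets_mono_sets)
    fix j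
    show "{(\<lambda>\<omega>2. Xinc n u j \<omega>1 \<omega>2) -` A \<inter> space M |A. A \<in> sets borel} \<subseteq> sets (Fsig (reach n u (piece n j)))"
      using measurable_sets[OF Xm[of j]] by auto
  qed
  have E0: "expectation (\<lambda>\<omega>2. Xinc n u j \<omega>1 \<omega>2) = 0" for j
  proof -
    have "integrable M (\<lambda>\<omega>2. measure lborel (fib1 Y n u (piece n j) \<omega>1 \<omega>2))"
      using measure_fib1_le[OF piece_borel, of Y n u n j \<omega>1]
      by (intro integrable_const_bound[of _ "w j"] AE_I2) (auto simp: w_def measure_fib1_measurable_M)
    then show ?thesis unfolding Xinc_def
      by (simp add: expectation_fib1[OF piece_borel] prob_space flip: powr_add mult.assoc)
  qed
  interpret H: Hoeffding_ineq M J "\<lambda>j \<omega>2. Xinc n u j \<omega>1 \<omega>2" "\<lambda>j. - w j" "\<lambda>j. (2 powr \<gamma> - 1) * w j" 0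
    by unfold_locales (use J indep bounds E0 in auto)
  show ?thesis
  proof (cases "\<sigma> > 0")
    case True
    have "prob {\<omega>2\<in>space M. \<bar>\<Sum>j\<in>J. Xinc n u j \<omega>1 \<omega>2\<bar> \<ge> \<epsilon>} \<le> 2 * exp (- 2 * \<epsilon>\<^sup>2 / \<sigma>)"
      using H.Hoeffding_ineq_abs_ge[of \<epsilon>] \<epsilon> True by (simp add: \<sigma>_def)
    also have "\<dots> \<le> 2 * exp (- 2 * \<epsilon>\<^sup>2 / K)"
      using \<sigma>K True by (simp add: frac_le)
    finally show ?thesis .
  next
    case False
    \<comment> \<open>Hoeffding's inequality needs a positive sum of squared widths; if it vanishes,
      so do all increments.\<close>
    then have "\<sigma> = 0" using sum_nonneg[of J "\<lambda>j. (((2 powr \<gamma> - 1) * w j) - (- w j))\<^sup>2"] by (simp add: \<sigma>_def)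
    then have "w j = 0" if "j \<in> J" for j
      using J(1) that by (simp add: \<sigma>_def sum_nonneg_eq_0_iff left_diff_distrib)
    then have "Xinc n u j \<omega>1 \<omega>2 = 0" if "j \<in> J" for j \<omega>2 using bounds[of j \<omega>2] that by simp
    then have "{\<omega>2\<in>space M. \<bar>\<Sum>j\<in>J. Xinc n u j \<omega>1 \<omega>2\<bar> \<ge> \<epsilon>} = {}" using \<epsilon> by simp
    then show ?thesis by (simp only: measure_empty) simp
  qed
qed

text \<open>Up to the factor \<open>Hmeas_const\<close>, the Lebesgue density at \<open>u\<close> of
  the projected stage-\<open>n\<close> measure.\<close>

definition fdens :: "nat \<Rightarrow> complex \<Rightarrow> 'w \<Rightarrow> real" where
  "fdens n u \<omega> = 2 powr (\<gamma> * real n) * measure lborel (fib0 Y n u UNIV \<omega>)"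

definition fnext :: "nat \<Rightarrow> complex \<Rightarrow> 'w \<Rightarrow> 'w \<Rightarrow> real" where
  "fnext n u \<omega>1 \<omega>2 = 2 powr (\<gamma> * real (Suc n)) * measure lborel (fib1 Y n u UNIV \<omega>1 \<omega>2)"

lemma fdens_nonneg [simp]: "0 \<le> fdens n u \<omega>"
  by (simp add: fdens_def)

lemma fdens_Suc: "fdens (Suc n) u \<omega> = fnext n u \<omega> \<omega>"
  by (simp add: fdens_def fnext_def fib0_Suc)

lemma fnext_increment:
  "fnext n u \<omega>1 \<omega>2 - fdens n u \<omega>1 = 2 powr (\<gamma> * real n) * (\<Sum>j<4 ^ n. Xinc n u j \<omega>1 \<omega>2)"
proof -
  have "(\<Sum>j<4 ^ n. Xinc n u j \<omega>1 \<omega>2) = 2 powr \<gamma> * measure lborel (fib1 Y n u UNIV \<omega>1 \<omega>2) - measure lborel (fib0 Y n u UNIV \<omega>1)"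
    by (simp add: Xinc_def sum_subtractf sum_fib_pieces flip: sum_distrib_left)
  then show ?thesis by (simp add: fnext_def fdens_def right_diff_distrib distrib_left powr_add mult.assoc)
qed

text \<open>The squared lengths sum to at most the largest length times the total length, so the
  variance proxy is proportional to the density itself. Measuring deviations relative to
  \<open>1 + fdens\<close> makes the exponent independent of \<open>\<omega>1\<close>. The two
  parity classes cause the factor \<open>2\<close> in the threshold and double the two-sided
  Hoeffding factor to \<open>4\<close>.\<close>

lemma fnext_deviation:
  assumes \<gamma>2: "\<gamma> \<le> 2" and \<eta>: "\<eta> > 0"
  shows "prob {\<omega>2\<in>space M. \<bar>fnext n u \<omega>1 \<omega>2 - fdens n u \<omega>1\<bar> \<ge> 2 * \<eta> * (1 + fdens n u \<omega>1)}
    \<le> 4 * exp (- (\<eta>\<^sup>2 * 2 powr ((2 - \<gamma>) * real n) / 16))"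
proof -
  define F where "F = 1 + fdens n u \<omega>1"
  have F: "F > 0" by (simp add: F_def add_pos_nonneg)
  define b where "b = 2 powr (\<gamma> * real n)"
  have b: "b > 0" by (simp add: b_def)
  \<comment> \<open>\<open>32 = 16 * 2\<close>: \<open>16\<close> bounds the square of
    \<open>2 powr \<gamma>\<close>, and \<open>2 / 4 ^ n\<close> bounds each piece length. The
    density is replaced by the larger \<open>F ^ 2\<close>, which cancels against the
    threshold.\<close>
  define K where "K = 32 * F\<^sup>2 / (4 ^ n * b)"
  define \<epsilon> where "\<epsilon> = \<eta> * F / b"
  have K: "K > 0" and \<epsilon>: "\<epsilon> > 0" using F b \<eta> by (auto simp: K_def \<epsilon>_def)
  define J where "J e = {j. j < (4::nat) ^ n \<and> even j = e}" for e
  have J: "finite (J e)" "\<And>j k. j \<in> J e \<Longrightarrow> k \<in> J e \<Longrightarrow> even j = even k" for e by (auto simp: J_def)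
  define w where "w j = measure lborel (fib0 Y n u (piece n j) \<omega>1)" for j
  have sumK: "(\<Sum>j\<in>J e. (2 powr \<gamma> * measure lborel (fib0 Y n u (piece n j) \<omega>1))\<^sup>2) \<le> K" for e
  proof -
    have "(\<Sum>j\<in>J e. (2 powr \<gamma> * w j)\<^sup>2) \<le> (\<Sum>j<4 ^ n. (2 powr \<gamma> * w j)\<^sup>2)"
      by (intro sum_mono2) (auto simp: J_def)
    also have "\<dots> \<le> (\<Sum>j<4 ^ n. 16 * (2 / 4 ^ n) * w j)"
    proof (rule sum_mono)
      fix j
      have "2 powr \<gamma> \<le> 2 powr 2" using \<gamma>2 by (intro powr_mono) auto
      then have "(2 powr \<gamma>)\<^sup>2 \<le> 4\<^sup>2" by (intro power_mono) auto
      moreover have "(w j)\<^sup>2 \<le> (2 / 4 ^ n) * w j"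
        unfolding power2_eq_square w_def by (intro mult_right_mono measure_fib0_piece_le) auto
      ultimately have "(2 powr \<gamma>)\<^sup>2 * (w j)\<^sup>2 \<le> 4\<^sup>2 * ((2 / 4 ^ n) * w j)" by (intro mult_mono) auto
      then show "(2 powr \<gamma> * w j)\<^sup>2 \<le> 16 * (2 / 4 ^ n) * w j" by (simp add: power_mult_distrib)
    qed
    also have "\<dots> = 32 / 4 ^ n * (fdens n u \<omega>1 / b)"
      unfolding sum_distrib_left[symmetric] w_def sum_fib_pieces by (simp add: fdens_def b_def)
    also have "\<dots> \<le> 32 / 4 ^ n * (F\<^sup>2 / b)"
    proof (intro mult_left_mono divide_right_mono)
      have "F * 1 \<le> F * F" by (intro mult_left_mono) (auto simp: F_def)
      then show "fdens n u \<omega>1 \<le> F\<^sup>2" unfolding power2_eq_square F_def by simp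
    qed (use b in auto)
    finally show ?thesis by (simp add: K_def w_def)
  qed
  have ex: "2 * \<epsilon>\<^sup>2 / K = \<eta>\<^sup>2 * 2 powr ((2 - \<gamma>) * real n) / 16"
  proof -
    have "2 powr ((2 - \<gamma>) * real n) = 4 ^ n / b"
      by (simp add: b_def left_diff_distrib powr_diff powr_powr[symmetric] powr_realpow[symmetric])
    then show ?thesis using F b by (simp add: \<epsilon>_def K_def power2_eq_square field_simps)
  qed
  define S where "S e \<omega>2 = (\<Sum>j\<in>J e. Xinc n u j \<omega>1 \<omega>2)" for e \<omega>2
  have Xm [measurable]: "(\<lambda>\<omega>2. Xinc n u j \<omega>1 \<omega>2) \<in> borel_measurable M" for j
    unfolding Xinc_def by measurable
  have [measurable]: "S e \<in> borel_measurable M" for e unfolding S_def by measurable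
  have split: "(\<Sum>j<4 ^ n. Xinc n u j \<omega>1 \<omega>2) = S True \<omega>2 + S False \<omega>2" for \<omega>2
  proof -
    have "{..<4 ^ n} = J True \<union> J False" by (auto simp: J_def)
    then show ?thesis unfolding S_def by (simp only:) (rule sum.union_disjoint, auto simp: J_def)
  qed
  have P: "prob {\<omega>2\<in>space M. \<bar>S e \<omega>2\<bar> \<ge> \<epsilon>} \<le> 2 * exp (- 2 * \<epsilon>\<^sup>2 / K)" for e
    unfolding S_def by (rule Xinc_Hoeffding[OF J \<epsilon> K sumK])
  have "prob {\<omega>2\<in>space M. \<bar>fnext n u \<omega>1 \<omega>2 - fdens n u \<omega>1\<bar> \<ge> 2 * \<eta> * (1 + fdens n u \<omega>1)}
    \<le> prob ({\<omega>2\<in>space M. \<bar>S True \<omega>2\<bar> \<ge> \<epsilon>} \<union> {\<omega>2\<in>space M. \<bar>S False \<omega>2\<bar> \<ge> \<epsilon>})"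
  proof (rule finite_measure_mono, rule subsetI, rule ccontr)
    fix \<omega>2 assume a: "\<omega>2 \<in> {\<omega>2\<in>space M. \<bar>fnext n u \<omega>1 \<omega>2 - fdens n u \<omega>1\<bar> \<ge> 2 * \<eta> * (1 + fdens n u \<omega>1)}"
      and "\<omega>2 \<notin> {\<omega>2\<in>space M. \<bar>S True \<omega>2\<bar> \<ge> \<epsilon>} \<union> {\<omega>2\<in>space M. \<bar>S False \<omega>2\<bar> \<ge> \<epsilon>}"
    then have "\<bar>S True \<omega>2 + S False \<omega>2\<bar> < 2 * \<epsilon>" by auto
    then have "b * \<bar>S True \<omega>2 + S False \<omega>2\<bar> < b * (2 * \<epsilon>)" using b by (rule mult_strict_left_mono)
    also have "b * (2 * \<epsilon>) = 2 * \<eta> * F" using b by (simp add: \<epsilon>_def)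
    finally have "\<bar>fnext n u \<omega>1 \<omega>2 - fdens n u \<omega>1\<bar> < 2 * \<eta> * F"
      unfolding fnext_increment split using b by (simp add: b_def abs_mult)
    then show False using a by (simp add: F_def)
  qed measurable
  also have "\<dots> \<le> prob {\<omega>2\<in>space M. \<bar>S True \<omega>2\<bar> \<ge> \<epsilon>} + prob {\<omega>2\<in>space M. \<bar>S False \<omega>2\<bar> \<ge> \<epsilon>}"
    by (rule measure_Un_le) measurable
  also have "\<dots> \<le> 4 * exp (- 2 * \<epsilon>\<^sup>2 / K)" using P[of True] P[of False] by simp
  also have "- 2 * \<epsilon>\<^sup>2 / K = - (\<eta>\<^sup>2 * 2 powr ((2 - \<gamma>) * real n) / 16)" unfolding ex[symmetric] by simp
  finally show ?thesis .
qed

section \<open>From frozen coarse balls to the actual process\<close>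

text \<open>The layer is independent of the coarser balls.\<close>

lemma diagonal_law:
  "distr M (Fsig (slab n)) (\<lambda>\<omega>. \<omega>) \<Otimes>\<^sub>M distr M (Fsig (layer n)) (\<lambda>\<omega>. \<omega>) =
   distr M (Fsig (slab n) \<Otimes>\<^sub>M Fsig (layer n)) (\<lambda>\<omega>. (\<omega>, \<omega>))"
proof -
  have sig: "sigma_sets (space M) {(\<lambda>\<omega>. \<omega>) -` A \<inter> space M |A. A \<in> sets (Fsig R)} = sets (Fsig R)" for R
  proof -
    have "{(\<lambda>\<omega>. \<omega>) -` A \<inter> space M |A. A \<in> sets (Fsig R)} = sets (Fsig R)"
      using sets.sets_into_space[of _ "Fsig R"] by (auto simp: Int_absorb2 vimage_def)
    then show ?thesis using sets.sigma_sets_eq[of "Fsig R"] by simp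
  qed
  have "disjoint_family_on (case_bool (slab n) (layer n)) UNIV"
    using slab_layer_disjoint by (auto simp: disjoint_family_on_def split: bool.splits)
  from indep_sets_Fsig[OF this]
  have "indep_set (sets (Fsig (slab n))) (sets (Fsig (layer n)))"
    unfolding indep_set_def by (rule back_subst[of "\<lambda>F. indep_sets F UNIV"]) (auto split: bool.splits)
  then have "indep_var (Fsig (slab n)) (\<lambda>\<omega>. \<omega>) (Fsig (layer n)) (\<lambda>\<omega>. \<omega>)"
    unfolding indep_var_eq sig using id_measurable_Fsig by blast
  then show ?thesis unfolding indep_var_distribution_eq by blast
qed

lemma fdens_measurable [measurable]: "fdens n u \<in> borel_measurable (Fsig (slab n))"
proof -
  define e where "e z = (indicator (cutout_set_n Y n (snd z)) (fst z) :: ennreal)" for z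
  have em: "e \<in> borel_measurable (borel \<Otimes>\<^sub>M Fsig (slab n))"
    using cutout_indicator_measurable[of n] unfolding e_def[abs_def] slab_def .
  have [measurable]: "(\<lambda>t. (u, t)) \<in> measurable borel borel" by (intro borel_measurable_continuous_onI continuous_intros)
  have "(\<lambda>z. ((u, snd z), fst z)) \<in> measurable (Fsig (slab n) \<Otimes>\<^sub>M lborel) (borel \<Otimes>\<^sub>M Fsig (slab n))"
    by measurable
  from measurable_compose[OF this em]
  have m: "(\<lambda>z. e ((u, snd z), fst z)) \<in> borel_measurable (Fsig (slab n) \<Otimes>\<^sub>M lborel)" .
  have "(\<lambda>\<omega>. \<integral>\<^sup>+t. e ((u, t), \<omega>) \<partial>lborel) \<in> borel_measurable (Fsig (slab n))"
    by (rule lborel.borel_measurable_nn_integral) (use m in \<open>simp add: case_prod_beta'\<close>)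
  moreover have "(\<integral>\<^sup>+t. e ((u, t), \<omega>) \<partial>lborel) = emeasure lborel (fib0 Y n u UNIV \<omega>)" for \<omega>
  proof -
    have "e ((u, t), \<omega>) = indicator (fib0 Y n u UNIV \<omega>) t" for t by (auto simp: e_def fib0_def indicator_def)
    then show ?thesis by simp
  qed
  ultimately have "(\<lambda>\<omega>. emeasure lborel (fib0 Y n u UNIV \<omega>)) \<in> borel_measurable (Fsig (slab n))" by simp
  then show ?thesis unfolding fdens_def[abs_def] measure_def by measurable
qed

lemma fdens_measurable_M [measurable]: "fdens n u \<in> borel_measurable M"
  using measurable_compose[OF id_measurable_Fsig fdens_measurable] .

lemma Fsig_mono: "R \<subseteq> R' \<Longrightarrow> (\<lambda>\<omega>. \<omega>) \<in> measurable (Fsig R') (Fsig R)"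
proof (rule measurableI)
  fix A assume "R \<subseteq> R'" "A \<in> sets (Fsig R)"
  moreover have "Fgen R \<subseteq> Fgen R'" using \<open>R \<subseteq> R'\<close> unfolding Fgen_def by blast
  ultimately have "A \<in> sets (Fsig R')" unfolding sets_Fsig using sigma_sets_mono' by blast
  moreover have "A \<subseteq> space (Fsig R')" using calculation by (rule sets.sets_into_space)
  ultimately show "(\<lambda>\<omega>. \<omega>) -` A \<inter> space (Fsig R') \<in> sets (Fsig R')" by (simp add: vimage_def Int_absorb2)
qed simp

text \<open>Joint measurability in two sample points, for the coarse balls in the first and the
  layer in the second, as Fubini on the product of the two laws requires.\<close>

lemma fnext_measurable: "case_prod (fnext n u) \<in> borel_measurable (Fsig (slab n) \<Otimes>\<^sub>M Fsig (layer n))"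
proof -
  let ?P = "(Fsig (slab n) \<Otimes>\<^sub>M Fsig (layer n)) \<Otimes>\<^sub>M lborel"
  define e where "e z = (indicator (cutout_set_n Y n (snd z)) (fst z) :: ennreal)" for z
  have em: "e \<in> borel_measurable (borel \<Otimes>\<^sub>M Fsig (slab n))"
    using cutout_indicator_measurable[of n] unfolding e_def[abs_def] slab_def .
  have [measurable]: "(\<lambda>t. (u, t)) \<in> measurable borel borel" by (intro borel_measurable_continuous_onI continuous_intros)
  have "(\<lambda>z. ((u, snd z), fst (fst z))) \<in> measurable ?P (borel \<Otimes>\<^sub>M Fsig (slab n))" by measurable
  from measurable_compose[OF this em]
  have m1: "(\<lambda>z. e ((u, snd z), fst (fst z))) \<in> borel_measurable ?P" .
  have rm: "(\<lambda>\<omega>. \<omega>) \<in> measurable (Fsig (layer n)) (Fsig (reach n u UNIV))" by (rule Fsig_mono[OF reach_subset])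
  have "(\<lambda>z. (snd z, snd (fst z))) \<in> measurable ?P (borel \<Otimes>\<^sub>M Fsig (reach n u UNIV))"
    by (intro measurable_Pair measurable_compose[OF measurable_compose[OF measurable_fst measurable_snd] rm]) measurable
  from measurable_sets[OF this reach_void_measurable[of UNIV n u]]
  have "{z \<in> space ?P. Y (snd (fst z)) \<inter> (hits (u, snd z) \<inter> layer n) = {}} \<in> sets ?P"
    by (rule back_subst[of "\<lambda>A. A \<in> sets ?P"]) (auto simp: space_pair_measure)
  then have m2: "(\<lambda>z. indicator {z \<in> space ?P. Y (snd (fst z)) \<inter> (hits (u, snd z) \<inter> layer n) = {}} z :: ennreal) \<in> borel_measurable ?P"
    by simp
  define h where "h z = e ((u, snd z), fst (fst z)) * indicator {z \<in> space ?P. Y (snd (fst z)) \<inter> (hits (u, snd z) \<inter> layer n) = {}} z" for z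
  have "h \<in> borel_measurable ?P" unfolding h_def[abs_def] using m1 m2 by (rule borel_measurable_times_ennreal)
  then have "(\<lambda>x. \<integral>\<^sup>+t. h (x, t) \<partial>lborel) \<in> borel_measurable (Fsig (slab n) \<Otimes>\<^sub>M Fsig (layer n))"
    by (intro lborel.borel_measurable_nn_integral) simp
  moreover have "(\<integral>\<^sup>+t. h (x, t) \<partial>lborel) = emeasure lborel (fib1 Y n u UNIV (fst x) (snd x))"
    if "x \<in> space (Fsig (slab n) \<Otimes>\<^sub>M Fsig (layer n))" for x
  proof -
    have "h (x, t) = indicator (fib1 Y n u UNIV (fst x) (snd x)) t" for t
      using that by (auto simp: h_def e_def fib1_def fib0_def indicator_def space_pair_measure)
    then show ?thesis by simp
  qed
  ultimately have "(\<lambda>x. emeasure lborel (fib1 Y n u UNIV (fst x) (snd x))) \<in> borel_measurable (Fsig (slab n) \<Otimes>\<^sub>M Fsig (layer n))"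
    by (simp cong: measurable_cong)
  then show ?thesis unfolding fnext_def[abs_def] measure_def case_prod_beta' by measurable
qed

lemma fdens_deviation:
  assumes \<gamma>2: "\<gamma> \<le> 2" and \<eta>: "\<eta> > 0"
  shows "prob {\<omega>\<in>space M. \<bar>fdens (Suc n) u \<omega> - fdens n u \<omega>\<bar> \<ge> 2 * \<eta> * (1 + fdens n u \<omega>)}
    \<le> 4 * exp (- (\<eta>\<^sup>2 * 2 powr ((2 - \<gamma>) * real n) / 16))" (is "?p \<le> ?b")
proof -
  let ?F1 = "Fsig (slab n)" and ?F2 = "Fsig (layer n)"
  let ?M1 = "distr M ?F1 (\<lambda>\<omega>. \<omega>)" and ?M2 = "distr M ?F2 (\<lambda>\<omega>. \<omega>)"
  interpret M1: prob_space ?M1 by (rule prob_space_distr[OF id_measurable_Fsig])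
  interpret M2: prob_space ?M2 by (rule prob_space_distr[OF id_measurable_Fsig])
  have id: "(\<lambda>\<omega>. \<omega>) \<in> measurable M ?F1" "(\<lambda>\<omega>. \<omega>) \<in> measurable M ?F2" by (rule id_measurable_Fsig)+
  define B where "B = {x \<in> space (?F1 \<Otimes>\<^sub>M ?F2). \<bar>fnext n u (fst x) (snd x) - fdens n u (fst x)\<bar> \<ge> 2 * \<eta> * (1 + fdens n u (fst x))}"
  have B: "B \<in> sets (?F1 \<Otimes>\<^sub>M ?F2)"
    using fnext_measurable[of n u] unfolding B_def case_prod_beta' by measurable
  have s12: "sets (?M1 \<Otimes>\<^sub>M ?M2) = sets (?F1 \<Otimes>\<^sub>M ?F2)" by (rule sets_pair_measure_cong) simp_all
  have "ennreal ?p = emeasure M ((\<lambda>\<omega>. (\<omega>, \<omega>)) -` B \<inter> space M)"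
  proof -
    have "(\<lambda>\<omega>. (\<omega>, \<omega>)) -` B \<inter> space M = {\<omega>\<in>space M. \<bar>fdens (Suc n) u \<omega> - fdens n u \<omega>\<bar> \<ge> 2 * \<eta> * (1 + fdens n u \<omega>)}"
      by (auto simp: B_def fdens_Suc space_pair_measure)
    then show ?thesis by (simp add: emeasure_eq_measure)
  qed
  also have "\<dots> = emeasure (distr M (?F1 \<Otimes>\<^sub>M ?F2) (\<lambda>\<omega>. (\<omega>, \<omega>))) B"
    by (rule emeasure_distr[symmetric, OF _ B]) (intro measurable_Pair id)
  also have "\<dots> = emeasure (?M1 \<Otimes>\<^sub>M ?M2) B" by (simp only: diagonal_law)
  also have "\<dots> = (\<integral>\<^sup>+\<omega>1. emeasure ?M2 (Pair \<omega>1 -` B) \<partial>?M1)"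
    by (rule M2.emeasure_pair_measure_alt) (simp add: s12 B)
  also have "\<dots> \<le> (\<integral>\<^sup>+\<omega>1. ennreal ?b \<partial>?M1)"
  proof (rule nn_integral_mono)
    fix \<omega>1 assume "\<omega>1 \<in> space ?M1"
    then have \<omega>1: "\<omega>1 \<in> space M" by simp
    have "emeasure ?M2 (Pair \<omega>1 -` B) = emeasure M ((\<lambda>\<omega>. \<omega>) -` (Pair \<omega>1 -` B) \<inter> space M)"
      by (rule emeasure_distr[OF id(2) sets_Pair1[OF B]])
    also have "(\<lambda>\<omega>. \<omega>) -` (Pair \<omega>1 -` B) \<inter> space M =
        {\<omega>2\<in>space M. \<bar>fnext n u \<omega>1 \<omega>2 - fdens n u \<omega>1\<bar> \<ge> 2 * \<eta> * (1 + fdens n u \<omega>1)}"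
      using \<omega>1 by (auto simp: B_def space_pair_measure)
    also have "emeasure M \<dots> \<le> ennreal ?b"
      unfolding emeasure_eq_measure by (intro ennreal_leI fnext_deviation assms)
    finally show "emeasure ?M2 (Pair \<omega>1 -` B) \<le> ennreal ?b" .
  qed
  also have "\<dots> = ennreal ?b" by (simp add: M1.emeasure_space_1 del: space_distr)
  finally show ?thesis by simp
qed

end

section \<open>Uniform convergence of the fibre densities\<close>

text \<open>Half the length of the slice of the ball \<open>p\<close> over \<open>u\<close>;
  \<open>max 0\<close> yields an empty slice when the ball misses the fibre.\<close>

definition cut_half :: "heis \<times> real \<Rightarrow> complex \<Rightarrow> real" where
  "cut_half p u = sqrt (max 0 (snd p ^ 4 - cmod (u - fst (fst p)) ^ 4)) / 2"

definition cut_center :: "heis \<times> real \<Rightarrow> complex \<Rightarrow> real" where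
  "cut_center p u = snd (fst p) + Im (cnj (fst (fst p)) * u)"

lemma hits_fibre_iff:
  assumes "snd p \<ge> 0"
  shows "p \<in> hits (u, t) \<longleftrightarrow> \<bar>t - cut_center p u\<bar> < cut_half p u"
proof -
  obtain v s r where p: "p = ((v, s), r)" by (metis surj_pair)
  have "p \<in> hits (u, t) \<longleftrightarrow> kor_dist (u, t) (v, s) ^ 4 < r ^ 4"
    using assms by (simp add: hits_def p kor_dist_less_iff)
  also have "\<dots> \<longleftrightarrow> (2 * (t - cut_center p u))\<^sup>2 < r ^ 4 - cmod (u - v) ^ 4"
  proof -
    have "(2 * (t - cut_center p u))\<^sup>2 = 4 * (t - s - Im (cnj v * u))\<^sup>2"
      by (simp add: cut_center_def p power2_eq_square algebra_simps)
    then show ?thesis unfolding kor_dist_power4 by linarith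
  qed
  also have "\<dots> \<longleftrightarrow> (2 * (t - cut_center p u))\<^sup>2 < max 0 (r ^ 4 - cmod (u - v) ^ 4)"
  proof -
    have "x < q \<longleftrightarrow> x < max 0 q" if "0 \<le> x" for x q :: real using that by auto
    then show ?thesis using zero_le_power2 by blast
  qed
  also have "\<dots> \<longleftrightarrow> \<bar>2 * (t - cut_center p u)\<bar> < sqrt (max 0 (r ^ 4 - cmod (u - v) ^ 4))"
    using real_sqrt_less_iff[of "(2 * (t - cut_center p u))\<^sup>2"] by simp
  also have "\<dots> \<longleftrightarrow> \<bar>t - cut_center p u\<bar> < cut_half p u"
    unfolding abs_mult by (auto simp: cut_half_def p)
  finally show ?thesis .
qed

lemma sqrt_diff_le: "0 \<le> a \<Longrightarrow> 0 \<le> b \<Longrightarrow> \<bar>sqrt a - sqrt b\<bar> \<le> sqrt \<bar>a - b\<bar>"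
proof -
  have *: "sqrt a - sqrt b \<le> sqrt \<bar>a - b\<bar>" if "0 \<le> a" "0 \<le> b" for a b
  proof -
    have "sqrt a \<le> sqrt (b + \<bar>a - b\<bar>)" by (rule real_sqrt_le_mono) linarith
    also have "\<dots> \<le> sqrt b + sqrt \<bar>a - b\<bar>" using that by (intro sqrt_add_le_add_sqrt) auto
    finally show ?thesis by simp
  qed
  assume "0 \<le> a" "0 \<le> b"
  then show ?thesis using *[of a b] *[of b a] by (simp add: abs_le_iff abs_minus_commute)
qed

lemma power4_diff_le:
  assumes "0 \<le> x" "x \<le> 5" "0 \<le> y" "y \<le> (5::real)"
  shows "\<bar>x ^ 4 - y ^ 4\<bar> \<le> 500 * \<bar>x - y\<bar>"
proof -
  have "x ^ 4 - y ^ 4 = (x ^ 3 + x\<^sup>2 * y + x * y\<^sup>2 + y ^ 3) * (x - y)" by (simp add: eval_nat_numeral algebra_simps)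
  moreover have "x ^ 3 \<le> 5 ^ 3" "x\<^sup>2 * y \<le> 5\<^sup>2 * 5" "x * y\<^sup>2 \<le> 5 * 5\<^sup>2" "y ^ 3 \<le> 5 ^ 3"
    using assms by (intro mult_mono power_mono; simp)+
  then have "\<bar>x ^ 3 + x\<^sup>2 * y + x * y\<^sup>2 + y ^ 3\<bar> \<le> 500" using assms by (simp add: abs_of_nonneg)
  ultimately show ?thesis by (simp add: abs_mult mult_right_mono)
qed

lemma cut_center_diff:
  assumes "cmod (fst (fst p)) \<le> 3"
  shows "\<bar>cut_center p u - cut_center p u'\<bar> \<le> 3 * cmod (u - u')"
proof -
  have "cut_center p u - cut_center p u' = Im (cnj (fst (fst p)) * (u - u'))"
    by (simp add: cut_center_def algebra_simps)
  then have "\<bar>cut_center p u - cut_center p u'\<bar> \<le> cmod (cnj (fst (fst p)) * (u - u'))"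
    using abs_Im_le_cmod by metis
  also have "\<dots> \<le> 3 * cmod (u - u')" using assms by (simp add: norm_mult mult_right_mono)
  finally show ?thesis .
qed

text \<open>Slice lengths behave like a square root near the rim of a ball, whence the Hoelder
  exponent \<open>1/2\<close>. Constants: \<open>5 = 2 + 3\<close> bounds the planar distance,
  \<open>4 * 5 ^ 3 = 500 \<le> 24 ^ 2\<close>, and halving leaves \<open>12\<close>.\<close>

lemma cut_half_diff:
  assumes "cmod (fst (fst p)) \<le> 3" "cmod u \<le> 2" "cmod u' \<le> 2"
  shows "\<bar>cut_half p u - cut_half p u'\<bar> \<le> 12 * sqrt (cmod (u - u'))"
proof -
  define v where "v = fst (fst p)"
  have le5: "cmod (u - v) \<le> 5" "cmod (u' - v) \<le> 5"
    using assms norm_triangle_ineq4[of u v] norm_triangle_ineq4[of u' v] by (auto simp: v_def)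
  have "\<bar>cut_half p u - cut_half p u'\<bar> = \<bar>sqrt (max 0 (snd p ^ 4 - cmod (u - v) ^ 4)) - sqrt (max 0 (snd p ^ 4 - cmod (u' - v) ^ 4))\<bar> / 2"
    by (simp add: cut_half_def v_def flip: diff_divide_distrib)
  also have "\<dots> \<le> sqrt \<bar>max 0 (snd p ^ 4 - cmod (u - v) ^ 4) - max 0 (snd p ^ 4 - cmod (u' - v) ^ 4)\<bar> / 2"
    by (intro divide_right_mono sqrt_diff_le) auto
  also have "\<dots> \<le> sqrt (500 * cmod (u - u')) / 2"
  proof (intro divide_right_mono real_sqrt_le_mono)
    have "\<bar>max 0 (snd p ^ 4 - cmod (u - v) ^ 4) - max 0 (snd p ^ 4 - cmod (u' - v) ^ 4)\<bar> \<le> \<bar>cmod (u - v) ^ 4 - cmod (u' - v) ^ 4\<bar>"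
    proof -
      have "\<bar>max 0 (a - b) - max 0 (a - c)\<bar> \<le> \<bar>b - c\<bar>" for a b c :: real by (auto simp: max_def abs_if)
      then show ?thesis .
    qed
    also have "\<dots> \<le> 500 * \<bar>cmod (u - v) - cmod (u' - v)\<bar>" using le5 by (intro power4_diff_le) auto
    also have "\<bar>cmod (u - v) - cmod (u' - v)\<bar> \<le> cmod (u - u')"
      using norm_triangle_ineq3[of "u - v" "u' - v"] by simp
    finally show "\<bar>max 0 (snd p ^ 4 - cmod (u - v) ^ 4) - max 0 (snd p ^ 4 - cmod (u' - v) ^ 4)\<bar> \<le> 500 * cmod (u - u')" by simp
  qed simp
  also have "sqrt (500 * cmod (u - u')) \<le> 24 * sqrt (cmod (u - u'))"
  proof -
    have "sqrt 500 \<le> sqrt (24\<^sup>2)" by (rule real_sqrt_le_mono) simp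
    then show ?thesis by (simp add: real_sqrt_mult mult_right_mono)
  qed
  finally show ?thesis by simp
qed

lemma emeasure_interval_difference:
  fixes c h c' h' b :: real
  assumes "\<bar>c - c'\<bar> + \<bar>h - h'\<bar> \<le> b"
  shows "{t. \<bar>t - c\<bar> < h \<and> \<not> \<bar>t - c'\<bar> < h'} \<subseteq> {c - h..c' - h'} \<union> {c' + h'..c + h}"
    "emeasure lborel ({c - h..c' - h'} \<union> {c' + h'..c + h}) \<le> ennreal (2 * b)"
proof -
  show "{t. \<bar>t - c\<bar> < h \<and> \<not> \<bar>t - c'\<bar> < h'} \<subseteq> {c - h..c' - h'} \<union> {c' + h'..c + h}" by auto
  have "emeasure lborel ({c - h..c' - h'} \<union> {c' + h'..c + h}) \<le> emeasure lborel {c - h..c' - h'} + emeasure lborel {c' + h'..c + h}"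
    by (rule emeasure_subadditive) auto
  also have "\<dots> \<le> ennreal b + ennreal b"
    using assms by (intro add_mono) (auto simp: emeasure_lborel_Icc_eq intro!: ennreal_leI)
  also have "\<dots> = ennreal (2 * b)" using assms by (subst ennreal_plus[symmetric]) auto
  finally show "emeasure lborel ({c - h..c' - h'} \<union> {c' + h'..c + h}) \<le> ennreal (2 * b)" .
qed

text \<open>A ball of radius below \<open>1\<close> that meets \<open>Omega\<close> is centred
  within distance \<open>2\<close> of the origin, so once radii of at least \<open>1\<close> are
  excluded, only parameters in this box affect stage \<open>n\<close>.\<close>

definition near_box :: "nat \<Rightarrow> (heis \<times> real) set" where
  "near_box n = {p. snd p \<in> {2 powr (- real n)..} \<and> kor_dist 0 (fst p) < 3}"

text \<open>Each of the finitely many balls that matter changes the fibre length by at most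
  \<open>30 * sqrt (cmod (u - u'))\<close>.\<close>

lemma measure_fib0_diff_le:
  assumes fin: "finite (Y \<omega> \<inter> near_box n)" and small: "Y \<omega> \<inter> radii {1..} = {}"
    and u: "cmod u \<le> 2" "cmod u' \<le> 2" "cmod (u - u') \<le> 1"
  shows "\<bar>measure lborel (fib0 Y n u UNIV \<omega>) - measure lborel (fib0 Y n u' UNIV \<omega>)\<bar>
    \<le> 30 * real (card (Y \<omega> \<inter> near_box n) + 1) * sqrt (cmod (u - u'))"
proof -
  define P where "P = Y \<omega> \<inter> near_box n"
  \<comment> \<open>\<open>Omega\<close> is treated as one more ball, of radius \<open>1\<close>
    about the origin, whose slice also moves with \<open>u\<close>; it accounts for the
    \<open>+ 1\<close> in the bound.\<close>
  define \<Omega>p :: "heis \<times> real" where "\<Omega>p = (0, 1)"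
  have one: "measure lborel (fib0 Y n u UNIV \<omega>) - measure lborel (fib0 Y n u' UNIV \<omega>)
      \<le> 30 * real (card P + 1) * sqrt (cmod (u - u'))"
    if u: "cmod u \<le> 2" "cmod u' \<le> 2" "cmod (u - u') \<le> 1" for u u'
  proof -
    define \<delta> where "\<delta> = cmod (u - u')"
    \<comment> \<open>This merges the Lipschitz drift of the centres with the Hoelder change of the
      widths: \<open>3 + 12 = 15\<close> for one endpoint, \<open>30\<close> for both.\<close>
    have "\<delta> \<le> sqrt \<delta>" using u(3) real_le_rsqrt[of \<delta> \<delta>] by (simp add: \<delta>_def power2_eq_square mult_left_le)
    define D where "D p u u' = {cut_center p u - cut_half p u .. cut_center p u' - cut_half p u'} \<union> {cut_center p u' + cut_half p u' .. cut_center p u + cut_half p u}" for p u u'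
    have D: "emeasure lborel (D p w w') \<le> ennreal (30 * sqrt \<delta>)"
        "{t. \<bar>t - cut_center p w\<bar> < cut_half p w \<and> \<not> \<bar>t - cut_center p w'\<bar> < cut_half p w'} \<subseteq> D p w w'"
      if "cmod (fst (fst p)) \<le> 3" "cmod w \<le> 2" "cmod w' \<le> 2" "cmod (w - w') = \<delta>" for p w w'
    proof -
      have b: "\<bar>cut_center p w - cut_center p w'\<bar> + \<bar>cut_half p w - cut_half p w'\<bar> \<le> 15 * sqrt \<delta>"
        using cut_center_diff[OF that(1), of w w'] cut_half_diff[OF that(1,2,3)] \<open>\<delta> \<le> sqrt \<delta>\<close> unfolding that(4) by simp
      show "{t. \<bar>t - cut_center p w\<bar> < cut_half p w \<and> \<not> \<bar>t - cut_center p w'\<bar> < cut_half p w'} \<subseteq> D p w w'"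
        unfolding D_def by (rule emeasure_interval_difference(1)[OF b])
      have "emeasure lborel (D p w w') \<le> ennreal (2 * (15 * sqrt \<delta>))"
        unfolding D_def by (rule emeasure_interval_difference(2)[OF b])
      then show "emeasure lborel (D p w w') \<le> ennreal (30 * sqrt \<delta>)" by simp
    qed
    have Pv: "cmod (fst (fst p)) \<le> 3" "snd p \<ge> 0" if "p \<in> P" for p
    proof -
      have "kor_dist 0 (fst p) < 3" using that by (auto simp: P_def near_box_def)
      then show "cmod (fst (fst p)) \<le> 3" using cmod_le_kor_dist[of 0 "fst p"] by simp
      show "snd p \<ge> 0" using that order_trans[of 0 "2 powr (- real n)" "snd p"] by (auto simp: P_def near_box_def)
    qed
    have sub: "fib0 Y n u UNIV \<omega> \<subseteq> fib0 Y n u' UNIV \<omega> \<union> (D \<Omega>p u u' \<union> (\<Union>p\<in>P. D p u' u))"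
    proof
      fix t assume t: "t \<in> fib0 Y n u UNIV \<omega>"
      then have tO: "(u, t) \<in> Omega" and tY: "Y \<omega> \<inter> (hits (u, t) \<inter> radii {2 powr (- real n)..}) = {}"
        by (auto simp: fib0_def mem_cutout_set_n)
      show "t \<in> fib0 Y n u' UNIV \<omega> \<union> (D \<Omega>p u u' \<union> (\<Union>p\<in>P. D p u' u))"
      proof (rule ccontr)
        assume n: "t \<notin> fib0 Y n u' UNIV \<omega> \<union> (D \<Omega>p u u' \<union> (\<Union>p\<in>P. D p u' u))"
        \<comment> \<open>\<open>Omega\<close> is closed whereas the cut-out balls are open; the
          intervals in \<open>D\<close> are closed and so contain the critical endpoint.\<close>
        have "(u', t) \<in> Omega"
        proof (rule ccontr)
          assume nO: "(u', t) \<notin> Omega"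
          have c0: "cut_center \<Omega>p w = 0" for w by (simp add: cut_center_def \<Omega>p_def zero_prod_def)
          have h0: "cut_half \<Omega>p w = sqrt (max 0 (1 - cmod w ^ 4)) / 2" for w by (simp add: cut_half_def \<Omega>p_def zero_prod_def)
          have "(2 * t)\<^sup>2 \<le> 1 - cmod u ^ 4" using tO by (simp add: mem_Omega_iff power_mult_distrib)
          then have "(2 * t)\<^sup>2 \<le> max 0 (1 - cmod u ^ 4)" by simp
          then have "\<bar>2 * t\<bar> \<le> sqrt (max 0 (1 - cmod u ^ 4))"
            unfolding real_sqrt_abs[symmetric] by (rule real_sqrt_le_mono)
          moreover have "max 0 (1 - cmod u' ^ 4) \<le> (2 * t)\<^sup>2"
            using nO by (simp add: mem_Omega_iff power_mult_distrib)
          then have "sqrt (max 0 (1 - cmod u' ^ 4)) \<le> \<bar>2 * t\<bar>"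
            unfolding real_sqrt_abs[symmetric] by (rule real_sqrt_le_mono)
          ultimately have "t \<in> D \<Omega>p u u'" unfolding D_def c0 h0 by auto
          then show False using n by simp
        qed
        then obtain p where p: "p \<in> Y \<omega>" "p \<in> hits (u', t)" "p \<in> radii {2 powr (- real n)..}"
          using n by (auto simp: fib0_def mem_cutout_set_n)
        have "snd p < 1" using p(1) small by (force simp: radii_def)
        have "kor_dist 0 (fst p) \<le> kor_dist 0 (u', t) + kor_dist (u', t) (fst p)" by (rule kor_dist_triangle)
        moreover have "kor_dist 0 (u', t) \<le> 1" using \<open>(u', t) \<in> Omega\<close> by (simp add: Omega_def kor_cball_def kor_dist_sym[of 0])
        ultimately have "kor_dist 0 (fst p) < 3" using p(2) \<open>snd p < 1\<close> by (simp add: hits_def)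
        then have pP: "p \<in> P" using p by (auto simp: P_def near_box_def radii_def)
        have "p \<notin> hits (u, t)" using tY p by blast
        then have "t \<in> D p u' u"
          using D(2)[OF Pv(1)[OF pP], of u' u] u p(2) hits_fibre_iff[OF Pv(2)[OF pP]]
          by (auto simp: \<delta>_def norm_minus_commute)
        then show False using n pP by blast
      qed
    qed
    have finP: "finite P" using fin by (simp add: P_def)
    have Dm [measurable, simp]: "D p w w' \<in> sets borel" for p w w' by (simp add: D_def)
    have UDm [simp]: "(\<Union>p\<in>P. D p u' u) \<in> sets borel" using finP by (intro sets.finite_UN) auto
    have fm [simp]: "fib0 Y n w UNIV \<omega> \<in> sets borel" for w by (rule fib0_borel) simp
    have "emeasure lborel (fib0 Y n u UNIV \<omega>) \<le> emeasure lborel (fib0 Y n u' UNIV \<omega> \<union> (D \<Omega>p u u' \<union> (\<Union>p\<in>P. D p u' u)))"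
    proof (intro emeasure_mono sub)
      show "fib0 Y n u' UNIV \<omega> \<union> (D \<Omega>p u u' \<union> (\<Union>p\<in>P. D p u' u)) \<in> sets lborel"
        unfolding sets_lborel by (intro sets.Un fm Dm UDm)
    qed
    also have "\<dots> \<le> emeasure lborel (fib0 Y n u' UNIV \<omega>) + (emeasure lborel (D \<Omega>p u u') + emeasure lborel (\<Union>p\<in>P. D p u' u))"
      using finP by (intro order_trans[OF emeasure_subadditive] add_left_mono emeasure_subadditive) auto
    also have "\<dots> \<le> emeasure lborel (fib0 Y n u' UNIV \<omega>) + (ennreal (30 * sqrt \<delta>) + (\<Sum>p\<in>P. ennreal (30 * sqrt \<delta>)))"
    proof (intro add_mono order_refl)
      show "emeasure lborel (D \<Omega>p u u') \<le> ennreal (30 * sqrt \<delta>)"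
        by (rule D(1)) (use u in \<open>auto simp: \<Omega>p_def \<delta>_def\<close>)
      have "emeasure lborel (\<Union>p\<in>P. D p u' u) \<le> (\<Sum>p\<in>P. emeasure lborel (D p u' u))"
        using finP by (intro emeasure_subadditive_finite) auto
      also have "\<dots> \<le> (\<Sum>p\<in>P. ennreal (30 * sqrt \<delta>))"
        using Pv u by (intro sum_mono D(1)) (auto simp: \<delta>_def norm_minus_commute)
      finally show "emeasure lborel (\<Union>p\<in>P. D p u' u) \<le> (\<Sum>p\<in>P. ennreal (30 * sqrt \<delta>))" .
    qed
    also have "\<dots> = ennreal (measure lborel (fib0 Y n u' UNIV \<omega>) + (30 * sqrt \<delta> + real (card P) * (30 * sqrt \<delta>)))"
      unfolding emeasure_eq_measure2[OF fmeasurable_fib(1)[of UNIV, simplified]]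
      by (simp add: \<delta>_def ennreal_mult ennreal_of_nat_eq_real_of_nat)
    finally have "measure lborel (fib0 Y n u UNIV \<omega>) \<le> measure lborel (fib0 Y n u' UNIV \<omega>) + (30 * sqrt \<delta> + real (card P) * (30 * sqrt \<delta>))"
      unfolding emeasure_eq_measure2[OF fmeasurable_fib(1)[of UNIV, simplified]]
      by (subst (asm) ennreal_le_iff) (auto simp: \<delta>_def)
    then show ?thesis by (simp add: \<delta>_def algebra_simps)
  qed
  show ?thesis using one[OF u] one[of u' u] u unfolding P_def[symmetric]
    by (simp add: norm_minus_commute abs_le_iff)
qed

text \<open>\<open>2 ^ (36 * n)\<close> is the order of the number of grid points in the union
  bound; the doubly exponential tail beats it.\<close>

lemma summable_dominated_by_exp:
  fixes q :: real
  assumes "q > 1"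
  shows "summable (\<lambda>n. 2 ^ (36 * n) * exp (- (q ^ n / 16)))"
proof (rule summable_comparison_test_bigo)
  show "summable (\<lambda>n. norm ((1/2::real) ^ n))" by (simp add: summable_geometric)
  show "(\<lambda>n. 2 ^ (36 * n) * exp (- (q ^ n / 16))) \<in> O(\<lambda>n. (1/2) ^ n)"
    using assms by real_asymp
qed

section \<open>Counting bounds and the union bound over a grid\<close>

context poisson_cutout
begin

text \<open>A crude bound suffices: a ball of radius \<open>3\<close> has volume \<open>81\<close>,
  and \<open>r powr (-5)\<close> is at most \<open>2 ^ (5 * n)\<close> on a set of radii of length
  at most \<open>1\<close>.\<close>

lemma near_box_intensity:
  "near_box n \<in> sets borel" "emeasure \<nu> (near_box n) \<le> ennreal (81 * \<gamma> * 2 ^ (5 * n))"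
proof -
  note I = cutout_intensity_radial[of "{2 powr (- real n)..}" "\<lambda>_. 3" \<gamma> 0, OF _ _ _ gamma_pos]
  show "near_box n \<in> sets borel" unfolding near_box_def by (rule I) auto
  have "emeasure \<nu> (near_box n) = (\<integral>\<^sup>+r. ennreal (\<gamma> * r powr (-5) * 3 ^ 4) * indicator ({2 powr (- real n)..} \<inter> {0<..<1}) r \<partial>lborel)"
    unfolding near_box_def by (rule I) auto
  also have "\<dots> \<le> (\<integral>\<^sup>+r. ennreal (81 * \<gamma> * 2 ^ (5 * n)) * indicator {0..1::real} r \<partial>lborel)"
  proof (rule nn_integral_mono)
    fix r :: real
    show "ennreal (\<gamma> * r powr (-5) * 3 ^ 4) * indicator ({2 powr (- real n)..} \<inter> {0<..<1}) r \<le> ennreal (81 * \<gamma> * 2 ^ (5 * n)) * indicator {0..1} r"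
    proof (cases "r \<in> {2 powr (- real n)..} \<inter> {0<..<1}")
      case True
      have "r powr (-5) \<le> (2 powr (- real n)) powr (-5)" using True by (intro powr_mono2') auto
      also have "\<dots> = 2 ^ (5 * n)" by (simp add: powr_powr mult.commute flip: powr_realpow)
      finally have "\<gamma> * r powr (-5) * 3 ^ 4 \<le> 81 * \<gamma> * 2 ^ (5 * n)" using gamma_pos by simp
      then show ?thesis using True by (auto simp: indicator_def intro: ennreal_leI)
    qed simp
  qed
  also have "\<dots> = ennreal (81 * \<gamma> * 2 ^ (5 * n))" by (simp add: nn_integral_cmult_indicator)
  finally show "emeasure \<nu> (near_box n) \<le> ennreal (81 * \<gamma> * 2 ^ (5 * n))" .
qed

text \<open>Markov's inequality, read off from the Poisson weights through
  \<open>p (k + 1) = p k * l / (k + 1)\<close>. Since the weights sum to \<open>1\<close>, the event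
  of infinitely many points is included in the tail estimate.\<close>

lemma prob_count_large:
  assumes A: "A \<in> sets borel" "emeasure \<nu> A < \<infinity>" and K: "K \<ge> 1"
  shows "{\<omega>\<in>space M. \<not> (finite (Y \<omega> \<inter> A) \<and> card (Y \<omega> \<inter> A) < K)} \<in> events"
    "prob {\<omega>\<in>space M. \<not> (finite (Y \<omega> \<inter> A) \<and> card (Y \<omega> \<inter> A) < K)} \<le> measure \<nu> A / real K"
proof -
  define l where "l = measure \<nu> A"
  define E where "E k = {\<omega>\<in>space M. finite (Y \<omega> \<inter> A) \<and> card (Y \<omega> \<inter> A) = k}" for k
  define p where "p k = exp (- l) * l ^ k / fact k" for k
  have l: "l \<ge> 0" by (simp add: l_def)
  have E: "E k \<in> events" "prob (E k) = p k" for k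
    using poisson_count[OF A, of k] by (simp_all add: E_def p_def l_def)
  have p0: "p k \<ge> 0" for k using l by (simp add: p_def)
  have "(\<lambda>k. exp (- l) * (l ^ k /\<^sub>R fact k)) sums (exp (- l) * exp l)" by (intro sums_mult exp_converges)
  then have ps: "p sums 1" by (simp add: p_def[abs_def] divide_inverse mult_ac exp_minus)
  have eq: "{\<omega>\<in>space M. \<not> (finite (Y \<omega> \<inter> A) \<and> card (Y \<omega> \<inter> A) < K)} = space M - (\<Union>k<K. E k)"
    by (auto simp: E_def)
  show "{\<omega>\<in>space M. \<not> (finite (Y \<omega> \<inter> A) \<and> card (Y \<omega> \<inter> A) < K)} \<in> events" unfolding eq using E by auto
  have "prob (\<Union>k<K. E k) = (\<Sum>k<K. p k)"
    unfolding E(2)[symmetric] using E by (intro finite_measure_finite_Union) (auto simp: disjoint_family_on_def E_def)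
  then have "prob {\<omega>\<in>space M. \<not> (finite (Y \<omega> \<inter> A) \<and> card (Y \<omega> \<inter> A) < K)} = 1 - (\<Sum>k<K. p k)"
    unfolding eq using E by (subst prob_compl) auto
  also have "\<dots> = (\<Sum>k. p (k + K))"
    using suminf_minus_initial_segment[OF sums_summable[OF ps], of K] sums_unique[OF ps] by simp
  also have "\<dots> \<le> (\<Sum>k. l / real K * p (k + (K - 1)))"
  proof (rule suminf_le)
    fix k
    have "p (Suc m) = p m * (l / real (Suc m))" for m by (simp add: p_def ac_simps)
    moreover have "k + K = Suc (k + (K - 1))" using K by simp
    ultimately have "p (k + K) = p (k + (K - 1)) * (l / real (k + K))" by metis
    also have "\<dots> \<le> p (k + (K - 1)) * (l / real K)"
      using K l p0 by (intro mult_left_mono divide_left_mono) auto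
    finally show "p (k + K) \<le> l / real K * p (k + (K - 1))" by (simp add: mult.commute)
  qed (use sums_summable[OF ps] in \<open>auto intro!: summable_mult simp: summable_iff_shift\<close>)
  also have "\<dots> = l / real K * (\<Sum>k. p (k + (K - 1)))"
    using sums_summable[OF ps] by (intro suminf_mult) (simp add: summable_iff_shift)
  also have "\<dots> \<le> l / real K * 1"
  proof (rule mult_left_mono)
    have "(\<Sum>k. p (k + (K - 1))) = 1 - (\<Sum>k<K - 1. p k)"
      using suminf_minus_initial_segment[OF sums_summable[OF ps], of "K - 1"] sums_unique[OF ps] by simp
    then show "(\<Sum>k. p (k + (K - 1))) \<le> 1" using p0 by (simp add: sum_nonneg)
  qed (use l in auto)
  finally show "prob {\<omega>\<in>space M. \<not> (finite (Y \<omega> \<inter> A) \<and> card (Y \<omega> \<inter> A) < K)} \<le> measure \<nu> A / real K"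
    by (simp add: l_def)
qed

text \<open>A mean of at most \<open>162 * 2 ^ (5 * n)\<close> against the threshold
  \<open>162 * 2 ^ (6 * n)\<close> gives exceptional probabilities of at most
  \<open>(1/2) ^ n\<close>, which Borel-Cantelli can sum.\<close>

lemma AE_count_bound:
  assumes "\<gamma> \<le> 2"
  shows "AE \<omega> in M. eventually (\<lambda>n. finite (Y \<omega> \<inter> near_box n) \<and> card (Y \<omega> \<inter> near_box n) < 162 * 2 ^ (6 * n)) sequentially"
proof -
  define B where "B n = {\<omega>\<in>space M. \<not> (finite (Y \<omega> \<inter> near_box n) \<and> card (Y \<omega> \<inter> near_box n) < 162 * 2 ^ (6 * n))}" for n
  have fin: "emeasure \<nu> (near_box n) < \<infinity>" for n using near_box_intensity(2)[of n] by (rule le_less_trans) simp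
  have K1: "1 \<le> (162 * 2 ^ (6 * n) :: nat)" for n by simp
  have B: "B n \<in> events" for n unfolding B_def by (rule prob_count_large[OF near_box_intensity(1) fin K1])
  have PB0: "prob (B n) \<le> measure \<nu> (near_box n) / real (162 * 2 ^ (6 * n))" for n
    unfolding B_def by (rule prob_count_large[OF near_box_intensity(1) fin K1])
  have PB: "prob (B n) \<le> (1/2) ^ n" for n
  proof -
    have "measure \<nu> (near_box n) \<le> 81 * \<gamma> * 2 ^ (5 * n)"
      using near_box_intensity(2)[of n] gamma_pos by (auto simp: measure_def intro!: enn2real_leI)
    also have "\<dots> \<le> 162 * 2 ^ (5 * n)" using assms by simp
    finally have "measure \<nu> (near_box n) \<le> 162 * 2 ^ (5 * n)" .
    then have "measure \<nu> (near_box n) / real (162 * 2 ^ (6 * n)) \<le> 162 * 2 ^ (5 * n) / real (162 * 2 ^ (6 * n))"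
      by (intro divide_right_mono) auto
    also have "\<dots> = (1/2) ^ n"
    proof -
      have "(2::real) ^ (6 * n) = 2 ^ (5 * n) * 2 ^ n" by (simp flip: power_add)
      then show ?thesis by (simp add: power_divide)
    qed
    finally show ?thesis using PB0[of n] by (rule order_trans[rotated])
  qed
  have "summable (\<lambda>n. prob (B n))"
    by (rule summable_comparison_test'[OF summable_geometric[of "1/2"], of 0]) (use PB in auto)
  then have "AE \<omega> in M. eventually (\<lambda>n. \<omega> \<in> space M - B n) sequentially"
    by (intro borel_cantelli_AE1 B) (auto simp: emeasure_eq_measure)
  then show ?thesis
    by eventually_elim (auto elim!: eventually_mono simp: B_def)
qed

text \<open>With at most \<open>162 * 2 ^ (6 * n)\<close> relevant balls and the normalisation \<open>4 ^ n\<close>, the mesh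
  \<open>2 ^ (- 18 * n)\<close> makes Hoelder errors with exponent \<open>1/2\<close> of order \<open>2 ^ (- n)\<close>.\<close>

definition grid_pts :: "nat \<Rightarrow> complex set" where
  "grid_pts n = (\<lambda>(a, b). Complex (of_int a / real (2 ^ (18 * n))) (of_int b / real (2 ^ (18 * n)))) `
     ({- int (2 ^ (18 * n)) .. int (2 ^ (18 * n))} \<times> {- int (2 ^ (18 * n)) .. int (2 ^ (18 * n))})"

lemma card_grid_pts: "real (card (grid_pts n)) \<le> 9 * 2 ^ (36 * n)" "finite (grid_pts n)"
proof -
  let ?m = "2 ^ (18 * n) :: nat"
  have "card (grid_pts n) \<le> card ({- int ?m .. int ?m} \<times> {- int ?m .. int ?m})"
    unfolding grid_pts_def by (rule card_image_le) simp
  also have "\<dots> = (2 * ?m + 1)\<^sup>2"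
  proof -
    have "card {- int m .. int m} = 2 * m + 1" for m
      by (subst card_atLeastAtMost_int) linarith
    then have "card ({- int m .. int m} \<times> {- int m .. int m}) = (2 * m + 1)\<^sup>2" for m
      by (simp only: card_cartesian_product power2_eq_square)
    then show ?thesis by (simp only:)
  qed
  also have "\<dots> \<le> (3 * ?m)\<^sup>2" by (intro power_mono) auto
  also have "\<dots> = 9 * 2 ^ (36 * n)" by (simp add: power_mult_distrib flip: power_mult)
  finally show "real (card (grid_pts n)) \<le> 9 * 2 ^ (36 * n)" by (metis of_nat_le_iff of_nat_mult of_nat_numeral of_nat_power)
  show "finite (grid_pts n)" unfolding grid_pts_def by simp
qed

lemma grid_pts_near:
  assumes "cmod u \<le> 1"
  obtains w where "w \<in> grid_pts n" "cmod (u - w) \<le> 2 / 2 ^ (18 * n)"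
proof -
  let ?m = "2 ^ (18 * n) :: nat"
  have m0: "?m > 0" by simp
  have u: "\<bar>Re u\<bar> \<le> real 1" "\<bar>Im u\<bar> \<le> real 1" using assms abs_Re_le_cmod[of u] abs_Im_le_cmod[of u] by auto
  note g = floor_grid[OF m0 u(1)] floor_grid[OF m0 u(2)]
  let ?a = "\<lfloor>real ?m * Re u\<rfloor>" and ?b = "\<lfloor>real ?m * Im u\<rfloor>"
  define w where "w = Complex (of_int ?a / real ?m) (of_int ?b / real ?m)"
  have "cmod (u - w) \<le> \<bar>Re u - of_int ?a / real ?m\<bar> + \<bar>Im u - of_int ?b / real ?m\<bar>"
    using cmod_le[of "u - w"] by (simp add: w_def)
  also have "\<dots> \<le> 1 / real ?m + 1 / real ?m" using g by (intro add_mono) simp_all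
  finally have "cmod (u - w) \<le> 2 / 2 ^ (18 * n)" by simp
  moreover have "w \<in> grid_pts n"
    unfolding grid_pts_def w_def by (rule image_eqI[of _ _ "(?a, ?b)"]) (use g in auto)
  ultimately show thesis using that by blast
qed

text \<open>The tolerance \<open>\<eta> n\<close> spends half of the available exponent: it decays
  geometrically, while \<open>\<eta> n ^ 2 * 2 powr ((2 - \<gamma>) * n)\<close> still grows
  geometrically and drives the tail.\<close>

lemma AE_grid_deviation:
  assumes "\<gamma> < 2"
  shows "AE \<omega> in M. eventually (\<lambda>n. \<forall>u\<in>grid_pts n. \<bar>fdens (Suc n) u \<omega> - fdens n u \<omega>\<bar>
     \<le> 2 * (2 powr (- (2 - \<gamma>) / 4)) ^ n * (1 + fdens n u \<omega>)) sequentially"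
proof -
  define \<eta> where "\<eta> n = (2 powr (- (2 - \<gamma>) / 4)) ^ n" for n
  define q where "q = 2 powr ((2 - \<gamma>) / 2)"
  have q: "q > 1" using assms by (simp add: q_def)
  have \<eta>: "\<eta> n > 0" for n by (simp add: \<eta>_def)
  have \<eta>q: "(\<eta> n)\<^sup>2 * 2 powr ((2 - \<gamma>) * real n) = q ^ n" for n
    by (simp add: \<eta>_def q_def powr_power flip: powr_add) (simp add: field_simps)
  define D where "D n u = {\<omega>\<in>space M. \<bar>fdens (Suc n) u \<omega> - fdens n u \<omega>\<bar> \<ge> 2 * \<eta> n * (1 + fdens n u \<omega>)}" for n u
  have D: "D n u \<in> events" for n u unfolding D_def by measurable
  define B where "B n = (\<Union>u\<in>grid_pts n. D n u)" for n
  have B: "B n \<in> events" for n unfolding B_def using D card_grid_pts(2) by auto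
  have PB: "prob (B n) \<le> 36 * (2 ^ (36 * n) * exp (- (q ^ n / 16)))" for n
  proof -
    have "prob (B n) \<le> (\<Sum>u\<in>grid_pts n. prob (D n u))"
      unfolding B_def using D card_grid_pts(2) by (intro measure_UNION_le) auto
    also have "\<dots> \<le> (\<Sum>u\<in>grid_pts n. 4 * exp (- (q ^ n / 16)))"
    proof (rule sum_mono)
      fix u
      show "prob (D n u) \<le> 4 * exp (- (q ^ n / 16))"
        using fdens_deviation[OF less_imp_le[OF assms] \<eta>[of n], of n u] unfolding D_def \<eta>q .
    qed
    also have "\<dots> = real (card (grid_pts n)) * (4 * exp (- (q ^ n / 16)))" by simp
    also have "\<dots> \<le> (9 * 2 ^ (36 * n)) * (4 * exp (- (q ^ n / 16)))" by (intro mult_right_mono card_grid_pts) auto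
    finally show ?thesis by simp
  qed
  have "summable (\<lambda>n. prob (B n))"
    by (rule summable_comparison_test'[OF summable_mult[OF summable_dominated_by_exp[OF q], of 36], of 0]) (use PB in auto)
  then have "AE \<omega> in M. eventually (\<lambda>n. \<omega> \<in> space M - B n) sequentially"
    by (intro borel_cantelli_AE1 B) (auto simp: emeasure_eq_measure)
  then show ?thesis unfolding \<eta>_def[symmetric]
  proof (rule AE_mp, intro AE_I2 impI)
    fix \<omega> assume "\<omega> \<in> space M" "eventually (\<lambda>n. \<omega> \<in> space M - B n) sequentially"
    then show "eventually (\<lambda>n. \<forall>u\<in>grid_pts n. \<bar>fdens (Suc n) u \<omega> - fdens n u \<omega>\<bar> \<le> 2 * \<eta> n * (1 + fdens n u \<omega>)) sequentially"
      by (auto elim!: eventually_mono simp: B_def D_def not_le less_imp_le)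
  qed
qed

lemma fdens_zero: "cmod u > 1 \<Longrightarrow> fdens n u \<omega> = 0"
proof -
  assume "cmod u > 1"
  then have "fib0 Y n u UNIV \<omega> = {}"
    using Omega_bounds(1)[of u] by (fastforce simp: fib0_def mem_cutout_set_n)
  then show ?thesis by (simp add: fdens_def)
qed

lemma fdens_Hoelder:
  assumes "finite (Y \<omega> \<inter> near_box n)" "Y \<omega> \<inter> radii {1..} = {}"
    and "cmod u \<le> 2" "cmod u' \<le> 2" "cmod (u - u') \<le> 1"
  shows "\<bar>fdens n u \<omega> - fdens n u' \<omega>\<bar> \<le> 2 powr (\<gamma> * real n) * (30 * real (card (Y \<omega> \<inter> near_box n) + 1) * sqrt (cmod (u - u')))"
proof -
  have "\<bar>fdens n u \<omega> - fdens n u' \<omega>\<bar> = 2 powr (\<gamma> * real n) * \<bar>measure lborel (fib0 Y n u UNIV \<omega>) - measure lborel (fib0 Y n u' UNIV \<omega>)\<bar>"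
    unfolding fdens_def right_diff_distrib[symmetric] by (simp add: abs_mult)
  also have "\<dots> \<le> 2 powr (\<gamma> * real n) * (30 * real (card (Y \<omega> \<inter> near_box n) + 1) * sqrt (cmod (u - u')))"
    by (intro mult_left_mono measure_fib0_diff_le assms) auto
  finally show ?thesis .
qed

text \<open>Stages \<open>n\<close> and \<open>n + 1\<close> are both compared on the mesh of stage
  \<open>n\<close>, whence \<open>m \<le> Suc n\<close>. The product
  \<open>4 ^ n * 64 ^ n / 512 ^ n\<close> is \<open>(1/2) ^ n\<close>; the constant is
  \<open>4 * 30 * 162 * 64 * 2 = 2488320\<close>, rounded up.\<close>

lemma fdens_fine_Hoelder:
  assumes "finite (Y \<omega> \<inter> near_box m)" "card (Y \<omega> \<inter> near_box m) < 162 * 2 ^ (6 * m)" "Y \<omega> \<inter> radii {1..} = {}"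
    and "cmod u \<le> 2" "cmod u' \<le> 2" "cmod (u - u') \<le> 2 / 2 ^ (18 * n)" "n \<ge> 1" "m \<le> Suc n" "\<gamma> \<le> 2"
  shows "\<bar>fdens m u \<omega> - fdens m u' \<omega>\<bar> \<le> 2500000 * (1/2) ^ n"
proof -
  have "(2::real) ^ 1 \<le> 2 ^ (18 * n)" using assms(7) by (intro power_increasing) auto
  then have "2 / 2 ^ (18 * n) \<le> (1 :: real)" by (simp add: divide_le_eq)
  then have "cmod (u - u') \<le> 1" using assms(6) by linarith
  from fdens_Hoelder[OF assms(1,3,4,5) this]
  have "\<bar>fdens m u \<omega> - fdens m u' \<omega>\<bar> \<le> 2 powr (\<gamma> * real m) * (30 * real (card (Y \<omega> \<inter> near_box m) + 1) * sqrt (cmod (u - u')))" .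
  also have "\<dots> \<le> 4 ^ Suc n * (30 * (162 * 2 ^ (6 * Suc n)) * (2 * (1/2) ^ (9 * n)))"
  proof (intro mult_mono)
    have "2 powr (\<gamma> * real m) \<le> 2 powr (2 * real (Suc n))"
      using assms(8,9) gamma_pos by (intro powr_mono mult_mono) auto
    also have "\<dots> = (2 powr 2) powr real (Suc n)" by (simp only: powr_powr)
    also have "\<dots> = 4 ^ Suc n" by (subst powr_realpow) simp_all
    finally show "2 powr (\<gamma> * real m) \<le> 4 ^ Suc n" .
    have "card (Y \<omega> \<inter> near_box m) + 1 \<le> 162 * 2 ^ (6 * m)" using assms(2) by simp
    also have "\<dots> \<le> 162 * 2 ^ (6 * Suc n)" using assms(8) by (intro mult_left_mono power_increasing) auto
    finally show "real (card (Y \<omega> \<inter> near_box m) + 1) \<le> 162 * 2 ^ (6 * Suc n)"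
      by (metis of_nat_le_iff of_nat_mult of_nat_numeral of_nat_power)
    show "sqrt (cmod (u - u')) \<le> 2 * (1/2) ^ (9 * n)"
    proof (rule real_le_lsqrt)
      have "cmod (u - u') \<le> 2 / 2 ^ (18 * n)" by fact
      also have "\<dots> \<le> 4 / 2 ^ (18 * n)" by (intro divide_right_mono) auto
      also have "\<dots> = (2 * (1/2) ^ (9 * n))\<^sup>2" by (simp add: power_mult_distrib power_divide flip: power_mult)
      finally show "cmod (u - u') \<le> (2 * (1/2) ^ (9 * n))\<^sup>2" .
    qed auto
  qed auto
  also have "\<dots> = 2488320 * (4 ^ n * 64 ^ n / 512 ^ n)"
    by (simp add: power_add power_mult power_divide)
  also have "\<dots> = 2488320 * (4 * 64 / 512) ^ n"
    by (simp only: power_mult_distrib power_divide)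
  also have "\<dots> \<le> 2500000 * (1/2) ^ n" by simp
  finally show ?thesis .
qed

text \<open>The increments are controlled only relative to \<open>1 + fdens\<close>. This quantity
  grows by factors of at most \<open>1 + \<zeta> n\<close> with summable \<open>\<zeta>\<close>,
  hence stays bounded; after that the increments are uniformly summable and the Weierstrass test
  applies. The ball of radius \<open>2\<close> is a neighbourhood of the unit disc, outside which
  all densities vanish.\<close>

lemma AE_fdens_uniform:
  assumes \<gamma>2: "\<gamma> < 2"
  shows "AE \<omega> in M. (\<exists>B. \<forall>n u. fdens n u \<omega> \<le> B) \<and>
    (\<exists>f. uniform_limit UNIV (\<lambda>n u. fdens n u \<omega>) f sequentially \<and> continuous_on (ball 0 2) f)"
proof -
  have null: "AE \<omega> in M. Y \<omega> \<inter> radii {1..} = {}"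
  proof (rule void_null)
    show "emeasure \<nu> (radii {1..}) = 0"
    proof -
      have "emeasure \<nu> (radii {1..}) = (\<integral>\<^sup>+r. indicator {0<..<1} r * ennreal (\<gamma> * r powr (-5)) * emeasure Hmeas {x. (x, r) \<in> radii {1..}} \<partial>lborel)"
        by (rule emeasure_cutout_intensity) simp
      also have "\<dots> = (\<integral>\<^sup>+r. 0 \<partial>(lborel :: real measure))"
        by (intro nn_integral_cong) (auto simp: radii_def indicator_def)
      finally show ?thesis by simp
    qed
  qed simp
  from null AE_count_bound[OF less_imp_le[OF \<gamma>2]] AE_grid_deviation[OF \<gamma>2] show ?thesis
  proof eventually_elim
    case (elim \<omega>)
    define \<theta> where "\<theta> = 2 powr (- (2 - \<gamma>) / 4)"
    have \<theta>: "0 < \<theta>" "\<theta> < 1" using \<gamma>2 by (auto simp: \<theta>_def powr_less_one)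
    obtain N where N: "\<And>n. n \<ge> N \<Longrightarrow> finite (Y \<omega> \<inter> near_box n) \<and> card (Y \<omega> \<inter> near_box n) < 162 * 2 ^ (6 * n)"
      "\<And>n u. n \<ge> N \<Longrightarrow> u \<in> grid_pts n \<Longrightarrow> \<bar>fdens (Suc n) u \<omega> - fdens n u \<omega>\<bar> \<le> 2 * \<theta> ^ n * (1 + fdens n u \<omega>)" "N \<ge> 1"
    proof -
      have "eventually (\<lambda>n. n \<ge> 1 \<and> (finite (Y \<omega> \<inter> near_box n) \<and> card (Y \<omega> \<inter> near_box n) < 162 * 2 ^ (6 * n)) \<and>
        (\<forall>u\<in>grid_pts n. \<bar>fdens (Suc n) u \<omega> - fdens n u \<omega>\<bar> \<le> 2 * \<theta> ^ n * (1 + fdens n u \<omega>))) sequentially"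
        using elim(2,3) eventually_ge_at_top[of "1::nat"] unfolding \<theta>_def by eventually_elim blast
      then obtain N where "\<And>n. n \<ge> N \<Longrightarrow> n \<ge> 1 \<and> (finite (Y \<omega> \<inter> near_box n) \<and> card (Y \<omega> \<inter> near_box n) < 162 * 2 ^ (6 * n)) \<and>
        (\<forall>u\<in>grid_pts n. \<bar>fdens (Suc n) u \<omega> - fdens n u \<omega>\<bar> \<le> 2 * \<theta> ^ n * (1 + fdens n u \<omega>))"
        by (auto simp: eventually_sequentially)
      then show thesis using that[of N] by blast
    qed
    \<comment> \<open>\<open>near_box\<close> increases with \<open>n\<close>, so finiteness at late
      stages gives it at all stages.\<close>
    have fin: "finite (Y \<omega> \<inter> near_box n)" for n
    proof (rule finite_subset)
      have "2 powr (- real (max n N)) \<le> 2 powr (- real n)" by (intro powr_mono) auto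
      from order_trans[OF this] show "Y \<omega> \<inter> near_box n \<subseteq> Y \<omega> \<inter> near_box (max n N)" unfolding near_box_def by blast
      show "finite (Y \<omega> \<inter> near_box (max n N))" using N(1)[of "max n N"] by simp
    qed
    define H :: "nat \<Rightarrow> real" where "H n = 2500000 * (1/2) ^ n" for n
    \<comment> \<open>\<open>2 * H n\<close> pays for moving from \<open>u\<close> to the grid point
      at both stages, and the \<open>H n\<close> in the bracket for replacing the density at the
      grid point by that at \<open>u\<close>.\<close>
    define \<zeta> where "\<zeta> n = 2 * \<theta> ^ n * (1 + H n) + 2 * H n" for n
    have H0: "H n \<ge> 0" for n by (simp add: H_def)
    have \<zeta>0: "\<zeta> n \<ge> 0" for n using H0[of n] \<theta> by (simp add: \<zeta>_def)
    have \<zeta>s: "summable \<zeta>"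
    proof -
      have "summable (\<lambda>n. 2 * \<theta> ^ n + 5000000 * (\<theta> / 2) ^ n + 5000000 * (1/2) ^ n)"
        using \<theta> by (intro summable_add summable_mult summable_geometric) auto
      moreover have "\<zeta> n = 2 * \<theta> ^ n + 5000000 * (\<theta> / 2) ^ n + 5000000 * (1/2) ^ n" for n
        by (simp add: \<zeta>_def H_def power_divide algebra_simps)
      ultimately show ?thesis by presburger
    qed
    have step: "\<bar>fdens (Suc n) u \<omega> - fdens n u \<omega>\<bar> \<le> \<zeta> n * (1 + fdens n u \<omega>)" if n: "n \<ge> N" for n u
    proof (cases "cmod u \<le> 1")
      case False
      then show ?thesis using \<zeta>0[of n] by (simp add: fdens_zero)
    next
      case True
      obtain w where w: "w \<in> grid_pts n" "cmod (u - w) \<le> 2 / 2 ^ (18 * n)" by (rule grid_pts_near[OF True])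
      have "(2::real) ^ 1 \<le> 2 ^ (18 * n)" using n N(3) by (intro power_increasing) auto
      then have "2 / 2 ^ (18 * n) \<le> (1 :: real)" by (simp add: divide_le_eq)
      then have "cmod (u - w) \<le> 1" using w(2) by linarith
      then have w2: "cmod w \<le> 2" using norm_triangle_ineq2[of w u] True by (simp add: norm_minus_commute)
      have Hm: "\<bar>fdens m u \<omega> - fdens m w \<omega>\<bar> \<le> H n" if "m = n \<or> m = Suc n" for m
        unfolding H_def by (rule fdens_fine_Hoelder) (use N(1)[of m] N(3) n that elim(1) True w w2 \<gamma>2 in auto)
      have 1: "\<bar>fdens (Suc n) w \<omega> - fdens n w \<omega>\<bar> \<le> 2 * \<theta> ^ n * (1 + fdens n w \<omega>)" by (rule N(2)[OF n w(1)])
      have "fdens n w \<omega> \<le> fdens n u \<omega> + H n" using Hm[of n] by linarith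
      then have "2 * \<theta> ^ n * (1 + fdens n w \<omega>) \<le> 2 * \<theta> ^ n * (1 + (fdens n u \<omega> + H n))"
        using \<theta> by (intro mult_left_mono add_left_mono) auto
      also have "\<dots> \<le> 2 * \<theta> ^ n * ((1 + H n) * (1 + fdens n u \<omega>))"
        using \<theta> H0[of n] by (intro mult_left_mono) (auto simp: algebra_simps)
      finally have "\<bar>fdens (Suc n) u \<omega> - fdens n u \<omega>\<bar> \<le> 2 * \<theta> ^ n * ((1 + H n) * (1 + fdens n u \<omega>)) + 2 * H n"
        using 1 Hm[of n] Hm[of "Suc n"] by linarith
      also have "\<dots> \<le> 2 * \<theta> ^ n * ((1 + H n) * (1 + fdens n u \<omega>)) + 2 * H n * (1 + fdens n u \<omega>)"
        using H0[of n] by (simp add: algebra_simps)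
      also have "\<dots> = \<zeta> n * (1 + fdens n u \<omega>)" by (simp add: \<zeta>_def algebra_simps)
      finally show ?thesis .
    qed
    have F0: "fdens n u \<omega> \<le> 2 powr (\<gamma> * real n)" for n u
    proof -
      have "measure lborel (fib0 Y n u UNIV \<omega>) \<le> measure lborel {-1/2..1/2::real}"
        using fib0_subset[of Y n u UNIV \<omega>] by (intro measure_mono_fmeasurable fmeasurable_compact) auto
      then show ?thesis by (simp add: fdens_def)
    qed
    define B where "B = (1 + 2 powr (\<gamma> * real N)) * exp (suminf \<zeta>)"
    have grow: "1 + fdens (N + k) u \<omega> \<le> (1 + 2 powr (\<gamma> * real N)) * exp (\<Sum>i<k. \<zeta> (N + i))" for k u
    proof (induction k)
      case 0 then show ?case using F0[of N u] by simp
    next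
      case (Suc k)
      have "1 + fdens (N + Suc k) u \<omega> \<le> (1 + fdens (N + k) u \<omega>) * (1 + \<zeta> (N + k))"
        using step[of "N + k" u] by (simp add: algebra_simps)
      also have "\<dots> \<le> ((1 + 2 powr (\<gamma> * real N)) * exp (\<Sum>i<k. \<zeta> (N + i))) * exp (\<zeta> (N + k))"
        using Suc \<zeta>0 by (intro mult_mono) (auto simp: add_nonneg_nonneg)
      finally show ?case by (simp add: exp_add mult.assoc)
    qed
    have Bn: "1 + fdens n u \<omega> \<le> B" for n u
    proof (cases "n \<ge> N")
      case True
      then obtain k where k: "n = N + k" using le_Suc_ex by blast
      have "(\<Sum>i<k. \<zeta> (N + i)) = sum \<zeta> ((+) N ` {..<k})" by (simp add: sum.reindex)
      also have "\<dots> \<le> suminf \<zeta>" using \<zeta>s \<zeta>0 by (intro sum_le_suminf) auto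
      finally have "(1 + 2 powr (\<gamma> * real N)) * exp (\<Sum>i<k. \<zeta> (N + i)) \<le> B"
        unfolding B_def by (intro mult_left_mono) (auto simp: add_nonneg_nonneg)
      then show ?thesis using grow[of k u] k by simp
    next
      case False
      then have "2 powr (\<gamma> * real n) \<le> 2 powr (\<gamma> * real N)" using gamma_pos by (intro powr_mono mult_left_mono) auto
      with F0[of n u] have "fdens n u \<omega> \<le> 2 powr (\<gamma> * real N)" by (rule order_trans)
      then have "1 + fdens n u \<omega> \<le> (1 + 2 powr (\<gamma> * real N)) * 1" by simp
      also have "\<dots> \<le> B" unfolding B_def using suminf_nonneg[OF \<zeta>s \<zeta>0] by (intro mult_left_mono) (auto simp: add_nonneg_nonneg)
      finally show ?thesis .
    qed
    have inc: "norm (fdens (Suc (n + N)) u \<omega> - fdens (n + N) u \<omega>) \<le> \<zeta> (n + N) * B" for n u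
    proof -
      have "norm (fdens (Suc (n + N)) u \<omega> - fdens (n + N) u \<omega>) \<le> \<zeta> (n + N) * (1 + fdens (n + N) u \<omega>)"
        using step[of "n + N" u] by simp
      also have "\<dots> \<le> \<zeta> (n + N) * B" by (intro mult_left_mono Bn \<zeta>0)
      finally show ?thesis .
    qed
    have "summable (\<lambda>n. \<zeta> (n + N) * B)" using \<zeta>s by (intro summable_mult2) (simp add: summable_iff_shift)
    from Weierstrass_m_test[OF _ this, of UNIV "\<lambda>n u. fdens (Suc (n + N)) u \<omega> - fdens (n + N) u \<omega>"] inc
    have "uniform_limit UNIV (\<lambda>n u. \<Sum>i<n. fdens (Suc (i + N)) u \<omega> - fdens (i + N) u \<omega>)
        (\<lambda>u. suminf (\<lambda>i. fdens (Suc (i + N)) u \<omega> - fdens (i + N) u \<omega>)) sequentially" by simp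
    moreover have "(\<Sum>i<n. fdens (Suc (i + N)) u \<omega> - fdens (i + N) u \<omega>) = fdens (n + N) u \<omega> - fdens N u \<omega>" for n u
      using sum_lessThan_telescope[of "\<lambda>i. fdens (i + N) u \<omega>" n] by simp
    ultimately have "uniform_limit UNIV (\<lambda>n u. fdens (n + N) u \<omega> - fdens N u \<omega>)
        (\<lambda>u. suminf (\<lambda>i. fdens (Suc (i + N)) u \<omega> - fdens (i + N) u \<omega>)) sequentially" by simp
    then have "uniform_limit UNIV (\<lambda>n u. (fdens (n + N) u \<omega> - fdens N u \<omega>) + fdens N u \<omega>)
        (\<lambda>u. suminf (\<lambda>i. fdens (Suc (i + N)) u \<omega> - fdens (i + N) u \<omega>) + fdens N u \<omega>) sequentially"
      by (intro uniform_limit_add uniform_limit_const)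
    then obtain f where "uniform_limit UNIV (\<lambda>n u. fdens (n + N) u \<omega>) f sequentially" by simp
    then have ul: "uniform_limit UNIV (\<lambda>n u. fdens n u \<omega>) f sequentially"
      unfolding uniform_limit_iff by (subst (asm) eventually_sequentially_seg)
    \<comment> \<open>The Hoelder constant \<open>L\<close> depends on \<open>n\<close>, so it gives
      continuity of each stage only; the uniform limit carries this over to
      \<open>f\<close>.\<close>
    have cont: "continuous_on (ball 0 2) (\<lambda>u. fdens n u \<omega>)" for n
      unfolding continuous_on_def
    proof
      fix u :: complex assume u: "u \<in> ball 0 2"
      define L where "L = 2 powr (\<gamma> * real n) * (30 * real (card (Y \<omega> \<inter> near_box n) + 1))"
      have "((\<lambda>w. L * sqrt (cmod (w - u))) \<longlongrightarrow> L * sqrt (cmod (u - u))) (at u within ball 0 2)"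
        by (intro tendsto_intros)
      then have "((\<lambda>w. L * sqrt (cmod (w - u))) \<longlongrightarrow> 0) (at u within ball 0 2)" by simp
      moreover have "eventually (\<lambda>w. norm (fdens n w \<omega> - fdens n u \<omega>) \<le> L * sqrt (cmod (w - u))) (at u within ball 0 2)"
        unfolding eventually_at
      proof (intro exI[of _ 1] conjI ballI impI)
        fix w assume w: "w \<in> ball 0 2" "w \<noteq> u \<and> dist w u < 1"
        then have "\<bar>fdens n w \<omega> - fdens n u \<omega>\<bar> \<le> 2 powr (\<gamma> * real n) * (30 * real (card (Y \<omega> \<inter> near_box n) + 1) * sqrt (cmod (w - u)))"
          using u by (intro fdens_Hoelder fin elim(1)) (auto simp: dist_norm)
        then show "norm (fdens n w \<omega> - fdens n u \<omega>) \<le> L * sqrt (cmod (w - u))" by (simp add: L_def mult.assoc)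
      qed simp
      ultimately have "((\<lambda>w. fdens n w \<omega> - fdens n u \<omega>) \<longlongrightarrow> 0) (at u within ball 0 2)"
        by (rule Lim_null_comparison[rotated])
      then show "((\<lambda>w. fdens n w \<omega>) \<longlongrightarrow> fdens n u \<omega>) (at u within ball 0 2)" by (simp add: LIM_zero_iff)
    qed
    have "continuous_on (ball 0 2) f"
    proof (rule uniform_limit_theorem)
      show "\<forall>\<^sub>F n in sequentially. continuous_on (ball 0 2) (\<lambda>u. fdens n u \<omega>)" using cont by simp
      show "uniform_limit (ball 0 2) (\<lambda>n u. fdens n u \<omega>) f sequentially"
        by (rule uniform_limit_on_subset[OF ul]) simp
    qed simp
    moreover have "\<forall>n u. fdens n u \<omega> \<le> B"
    proof (intro allI)
      fix n u
      show "fdens n u \<omega> \<le> B" using Bn[of n u] by linarith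
    qed
    ultimately show ?case using ul by blast
  qed
qed

section \<open>The vertical projection\<close>

lemma emeasure_cutout_meas_n_fst:
  assumes V [measurable]: "V \<in> sets borel"
  shows "emeasure (cutout_meas_n M Y n \<omega>) (fst -` V) = ennreal Hmeas_const * (\<integral>\<^sup>+u. indicator V u * ennreal (fdens n u \<omega>) \<partial>lborel)"
proof -
  have Vm [measurable]: "(fst -` V :: heis set) \<in> sets borel"
    using measurable_sets[OF borel_measurable_continuous_onI[OF continuous_on_fst[OF continuous_on_id]] V] by simp
  have "emeasure (cutout_meas_n M Y n \<omega>) (fst -` V) =
    ennreal (2 powr (\<gamma> * real n)) * (\<integral>\<^sup>+y. indicator (fst -` V) y * indicator (cutout_set_n Y n \<omega>) y \<partial>Hmeas)"
    by (simp add: emeasure_cutout_meas_n cutout_beta_eq)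
  also have "(\<integral>\<^sup>+y. indicator (fst -` V) y * indicator (cutout_set_n Y n \<omega>) y \<partial>Hmeas)
    = ennreal Hmeas_const * (\<integral>\<^sup>+u. \<integral>\<^sup>+t. indicator (fst -` V) (u, t) * indicator (cutout_set_n Y n \<omega>) (u, t) \<partial>lborel \<partial>lborel)"
    by (rule nn_integral_Hmeas) measurable
  also have "(\<integral>\<^sup>+u. \<integral>\<^sup>+t. indicator (fst -` V) (u, t) * indicator (cutout_set_n Y n \<omega>) (u, t) \<partial>lborel \<partial>lborel)
    = (\<integral>\<^sup>+u. indicator V u * ennreal (measure lborel (fib0 Y n u UNIV \<omega>)) \<partial>lborel)"
  proof (rule nn_integral_cong)
    fix u
    have [measurable]: "fib0 Y n u UNIV \<omega> \<in> sets borel" by (rule fib0_borel) simp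
    have "(\<integral>\<^sup>+t. indicator (fst -` V) (u, t) * indicator (cutout_set_n Y n \<omega>) (u, t) \<partial>lborel)
      = (\<integral>\<^sup>+t. indicator V u * indicator (fib0 Y n u UNIV \<omega>) t \<partial>lborel)"
      by (intro nn_integral_cong) (auto simp: indicator_def fib0_def)
    also have "\<dots> = indicator V u * emeasure lborel (fib0 Y n u UNIV \<omega>)"
      by (rule nn_integral_cmult_indicator) simp
    finally show "(\<integral>\<^sup>+t. indicator (fst -` V) (u, t) * indicator (cutout_set_n Y n \<omega>) (u, t) \<partial>lborel)
      = indicator V u * ennreal (measure lborel (fib0 Y n u UNIV \<omega>))"
      unfolding emeasure_eq_measure2[OF fmeasurable_fib(1)[of UNIV, simplified]] .
  qed
  also have "ennreal (2 powr (\<gamma> * real n)) * (ennreal Hmeas_const * (\<integral>\<^sup>+u. indicator V u * ennreal (measure lborel (fib0 Y n u UNIV \<omega>)) \<partial>lborel))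
    = ennreal Hmeas_const * (ennreal (2 powr (\<gamma> * real n)) * (\<integral>\<^sup>+u. indicator V u * ennreal (measure lborel (fib0 Y n u UNIV \<omega>)) \<partial>lborel))"
    by (simp only: mult_ac)
  also have "ennreal (2 powr (\<gamma> * real n)) * (\<integral>\<^sup>+u. indicator V u * ennreal (measure lborel (fib0 Y n u UNIV \<omega>)) \<partial>lborel)
    = (\<integral>\<^sup>+u. ennreal (2 powr (\<gamma> * real n)) * (indicator V u * ennreal (measure lborel (fib0 Y n u UNIV \<omega>))) \<partial>lborel)"
  proof (rule nn_integral_cmult[symmetric])
    have "(\<lambda>u. emeasure lborel (Pair u -` cutout_set_n Y n \<omega>)) \<in> borel_measurable (lborel :: complex measure)"
      by (rule lborel.measurable_emeasure_Pair) (simp only: lborel_prod sets_lborel cutout_set_n_borel)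
    moreover have "Pair u -` cutout_set_n Y n \<omega> = fib0 Y n u UNIV \<omega>" for u by (auto simp: fib0_def)
    ultimately have [measurable]: "(\<lambda>u. ennreal (measure lborel (fib0 Y n u UNIV \<omega>))) \<in> borel_measurable lborel"
      unfolding emeasure_eq_measure2[OF fmeasurable_fib(1)[of UNIV, simplified], symmetric] by simp
    show "(\<lambda>u. indicator V u * ennreal (measure lborel (fib0 Y n u UNIV \<omega>))) \<in> borel_measurable lborel" by measurable
  qed
  also have "\<dots> = (\<integral>\<^sup>+u. indicator V u * ennreal (fdens n u \<omega>) \<partial>lborel)"
    by (intro nn_integral_cong) (simp add: fdens_def ennreal_mult mult_ac)
  finally show ?thesis .
qed

text \<open>The density bound passes to the weak limit on open sets; outer regularity of Lebesgue
  measure then transfers it to null sets.\<close>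

lemma projection_absolutely_continuous:
  assumes B: "\<And>n u. fdens n u \<omega> \<le> B"
    and \<mu>: "sets \<mu> = sets borel" "finite_measure \<mu>" "weak_star_conv (\<lambda>n. cutout_meas_n M Y n \<omega>) \<mu>"
  shows "absolutely_continuous lborel (distr \<mu> (lborel :: complex measure) fst)"
proof -
  have sp: "space \<mu> = UNIV" using sets_eq_imp_space_eq[OF \<mu>(1)] by simp
  have fstm: "fst \<in> measurable \<mu> (lborel :: complex measure)"
    unfolding measurable_lborel1 measurable_lborel2 measurable_cong_sets[OF \<mu>(1) refl] by (intro borel_measurable_continuous_onI continuous_intros)
  have B0: "0 \<le> B" using B[of 0 0] fdens_nonneg[of 0 0 \<omega>] by linarith
  have bound: "emeasure \<mu> (fst -` V) \<le> ennreal (Hmeas_const * B) * emeasure lborel V" if V: "open V" for V :: "complex set"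
  proof -
    have "emeasure \<mu> (fst -` V) \<le> liminf (\<lambda>n. emeasure (cutout_meas_n M Y n \<omega>) (fst -` V))"
      by (intro weak_star_conv_open_liminf \<mu> finite_cutout_meas_n open_vimage V continuous_intros) simp_all
    also have "\<dots> \<le> liminf (\<lambda>n. ennreal (Hmeas_const * B) * emeasure lborel V)"
    proof (rule Liminf_mono, rule always_eventually, rule allI)
      fix n
      have "emeasure (cutout_meas_n M Y n \<omega>) (fst -` V) \<le> ennreal Hmeas_const * (\<integral>\<^sup>+u. ennreal B * indicator V u \<partial>lborel)"
        using V B B0 by (subst emeasure_cutout_meas_n_fst)
          (auto intro!: mult_left_mono nn_integral_mono ennreal_leI simp: indicator_def)
      also have "\<dots> = ennreal (Hmeas_const * B) * emeasure lborel V"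
        using V B0 Hmeas_const_pos by (simp add: nn_integral_cmult_indicator ennreal_mult mult.assoc)
      finally show "emeasure (cutout_meas_n M Y n \<omega>) (fst -` V) \<le> ennreal (Hmeas_const * B) * emeasure lborel V" .
    qed
    finally show ?thesis by (simp add: Liminf_const)
  qed
  show ?thesis
    unfolding absolutely_continuous_def
  proof
    fix N :: "complex set" assume N: "N \<in> null_sets lborel"
    then have Nm: "N \<in> sets borel" and N0: "emeasure lborel N = 0" by auto
    have "emeasure (distr \<mu> lborel fst) N \<le> 0"
    proof (rule ennreal_le_epsilon)
      fix e :: real assume e: "e > 0"
      define d where "d = e / (Hmeas_const * B + 1)"
      have pos: "Hmeas_const * B + 1 > 0" using B0 Hmeas_const_pos by (simp add: add_nonneg_pos)
      then have d: "d > 0" using e by (simp add: d_def)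
      obtain V where V: "open V" "N \<subseteq> V" "emeasure lborel (V - N) < ennreal d"
        by (rule outer_regular_lborel[OF Nm d])
      have "emeasure lborel V \<le> emeasure lborel N + emeasure lborel (V - N)"
        using V Nm emeasure_subadditive[of N lborel "V - N"] by (simp add: Un_absorb1)
      then have Vd: "emeasure lborel V \<le> ennreal d" using V(3) N0 by simp
      have "emeasure (distr \<mu> lborel fst) N = emeasure \<mu> (fst -` N)"
        using Nm fstm by (subst emeasure_distr) (auto simp: sp)
      also have "\<dots> \<le> emeasure \<mu> (fst -` V)"
      proof (rule emeasure_mono)
        show "fst -` V \<in> sets \<mu>" unfolding \<mu>(1) by (intro borel_open open_vimage V continuous_intros)
      qed (use V in auto)
      also have "\<dots> \<le> ennreal (Hmeas_const * B) * emeasure lborel V" by (rule bound[OF V(1)])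
      also have "\<dots> \<le> ennreal (Hmeas_const * B) * ennreal d" by (intro mult_left_mono Vd) auto
      also have "\<dots> = ennreal (Hmeas_const * B * d)" using B0 Hmeas_const_pos d by (simp add: ennreal_mult)
      also have "\<dots> \<le> ennreal e"
      proof (rule ennreal_leI)
        have "Hmeas_const * B * d \<le> (Hmeas_const * B + 1) * d" using d by (intro mult_right_mono) auto
        then show "Hmeas_const * B * d \<le> e" using pos by (simp add: d_def)
      qed
      finally show "emeasure (distr \<mu> lborel fst) N \<le> 0 + ennreal e" by simp
    qed
    then show "N \<in> null_sets (distr \<mu> lborel fst)" using Nm by (intro null_setsI) auto
  qed
qed

text \<open>If the limit density vanished identically, uniform convergence on the unit disc would
  force the total masses to \<open>0\<close>. Where it is positive, the fibre of every stage is
  nonempty, and nested compactness yields a point of the cut-out set above.\<close>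

lemma projection_interior_nonempty:
  assumes ul: "uniform_limit UNIV (\<lambda>n u. fdens n u \<omega>) f sequentially" and cont: "continuous_on (ball 0 2) f"
    and \<mu>: "sets \<mu> = sets borel" "finite_measure \<mu>" "weak_star_conv (\<lambda>n. cutout_meas_n M Y n \<omega>) \<mu>"
    and nz: "emeasure \<mu> (space \<mu>) \<noteq> 0"
  shows "interior (fst ` cutout_set Y \<omega>) \<noteq> {}"
proof -
  have sp: "space \<mu> = UNIV" using sets_eq_imp_space_eq[OF \<mu>(1)] by simp
  have lim: "(\<lambda>n. fdens n u \<omega>) \<longlonglongrightarrow> f u" for u by (rule tendsto_uniform_limitI[OF ul]) simp
  have f0: "0 \<le> f u" for u by (rule LIMSEQ_le_const[OF lim]) auto
  have "\<exists>u. f u > 0"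
  proof (rule ccontr)
    assume "\<not> (\<exists>u. f u > 0)"
    then have fz: "f u = 0" for u using f0[of u] order_le_less by metis
    have "emeasure \<mu> UNIV \<le> 0"
    proof (rule ennreal_le_epsilon)
      fix e :: real assume e: "e > 0"
      define A where "A = Hmeas_const * measure lborel (cball (0::complex) 1)"
      define d where "d = e / (A + 1)"
      have A0: "A \<ge> 0" using Hmeas_const_pos by (simp add: A_def)
      then have d: "d > 0" using e by (simp add: d_def)
      have "emeasure \<mu> (fst -` UNIV) \<le> liminf (\<lambda>n. emeasure (cutout_meas_n M Y n \<omega>) (fst -` (UNIV :: complex set)))"
        by (intro weak_star_conv_open_liminf \<mu> finite_cutout_meas_n open_vimage continuous_intros) simp_all
      also have "\<dots> \<le> liminf (\<lambda>n. ennreal e)"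
      proof (rule Liminf_mono)
        have "eventually (\<lambda>n. \<forall>u. fdens n u \<omega> < d) sequentially"
          using uniform_limitD[OF ul d] by eventually_elim (simp add: fz)
        then show "eventually (\<lambda>n. emeasure (cutout_meas_n M Y n \<omega>) (fst -` (UNIV :: complex set)) \<le> ennreal e) sequentially"
        proof eventually_elim
          case (elim n)
          have "emeasure (cutout_meas_n M Y n \<omega>) (fst -` (UNIV :: complex set))
            \<le> ennreal Hmeas_const * (\<integral>\<^sup>+u. ennreal d * indicator (cball (0::complex) 1) u \<partial>lborel)"
            unfolding emeasure_cutout_meas_n_fst[OF sets.top[of borel, unfolded space_borel]]
          proof (intro mult_left_mono nn_integral_mono)
            fix u
            show "indicator UNIV u * ennreal (fdens n u \<omega>) \<le> ennreal d * indicator (cball 0 1) u"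
            proof (cases "cmod u \<le> 1")
              case True
              then show ?thesis using elim[rule_format, of u] by (auto simp: indicator_def intro: ennreal_leI)
            qed (simp add: fdens_zero)
          qed auto
          also have "\<dots> = ennreal Hmeas_const * (ennreal d * emeasure lborel (cball (0::complex) 1))"
            by (simp add: nn_integral_cmult_indicator)
          also have "\<dots> = ennreal (A * d)"
            using Hmeas_const_pos d emeasure_lborel_cball_finite[of "0::complex" 1]
            by (simp add: A_def emeasure_eq_ennreal_measure top.not_eq_extremum mult_ac flip: ennreal_mult)
          also have "\<dots> \<le> ennreal e"
          proof (rule ennreal_leI)
            have "A * d \<le> (A + 1) * d" using d by (intro mult_right_mono) auto
            then show "A * d \<le> e" using A0 by (simp add: d_def)
          qed
          finally show ?case .
        qed
      qed
      finally show "emeasure \<mu> UNIV \<le> 0 + ennreal e" by (simp add: Liminf_const)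
    qed
    then show False using nz sp by simp
  qed
  then obtain u0 where u0: "f u0 > 0" by blast
  have "cmod u0 \<le> 1"
  proof (rule ccontr)
    assume "\<not> cmod u0 \<le> 1"
    then have "(\<lambda>n. fdens n u0 \<omega>) = (\<lambda>n. 0)" by (simp add: fdens_zero)
    then have "f u0 = 0" using lim[of u0] LIMSEQ_const_iff by metis
    then show False using u0 by simp
  qed
  then have u0b: "u0 \<in> ball 0 2" by simp
  define W where "W = ball 0 2 \<inter> f -` {0<..}"
  have "open W" unfolding W_def using cont by (intro continuous_open_preimage) auto
  moreover have "u0 \<in> W" using u0 u0b by (simp add: W_def)
  moreover have "W \<subseteq> fst ` cutout_set Y \<omega>"
  proof
    fix u assume "u \<in> W"
    then have "f u > 0" by (simp add: W_def)
    from order_tendstoD(1)[OF lim this] have "eventually (\<lambda>n. fdens n u \<omega> > 0) sequentially" .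
    then obtain N where N: "\<And>n. n \<ge> N \<Longrightarrow> fdens n u \<omega> > 0" by (auto simp: eventually_sequentially)
    have ne: "cutout_set_n Y n \<omega> \<inter> fst -` {u} \<noteq> {}" for n
    proof -
      have "fib0 Y (max n N) u UNIV \<omega> \<noteq> {}" using N[of "max n N"] by (auto simp: fdens_def)
      then obtain t where "(u, t) \<in> cutout_set_n Y (max n N) \<omega>" by (auto simp: fib0_def)
      then have "(u, t) \<in> cutout_set_n Y n \<omega>" using cutout_set_n_decreasing[of n "max n N" Y \<omega>] by auto
      then show ?thesis by auto
    qed
    have cl: "closed (fst -` {u} :: heis set)" by (intro closed_vimage continuous_intros)
    have "\<Inter>(range (\<lambda>n. cutout_set_n Y n \<omega> \<inter> fst -` {u})) \<noteq> {}"
    proof (rule compact_nest)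
      show "compact (cutout_set_n Y n \<omega> \<inter> fst -` {u})" for n
        by (intro compact_Int_closed compact_cutout_set_n cl)
      show "cutout_set_n Y n \<omega> \<inter> fst -` {u} \<subseteq> cutout_set_n Y m \<omega> \<inter> fst -` {u}" if "m \<le> n" for m n
        by (intro Int_mono cutout_set_n_decreasing that order_refl)
    qed (rule ne)
    then obtain p where "\<And>n. p \<in> cutout_set_n Y n \<omega>" "fst p = u" by blast
    then show "u \<in> fst ` cutout_set Y \<omega>" unfolding cutout_set_eq_INT by blast
  qed
  ultimately show ?thesis using interior_maximal by blast
qed

text \<open>The projected cut-out set is compact and carries the whole mass, so the energy bound
  applies to it and meets the covering bound; the same set attains the infimum in
  \<open>measure_dim\<close>.\<close>

lemma projection_dimension:
  assumes upper: "hausdorff_dim (fst ` cutout_set Y \<omega>) \<le> 4 - \<gamma>"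
    and lower: "\<forall>\<mu> A. sets \<mu> = sets borel \<and> finite_measure \<mu> \<and> weak_star_conv (\<lambda>n. cutout_meas_n M Y n \<omega>) \<mu> \<and>
      A \<in> sets borel \<and> emeasure (distr \<mu> (borel :: complex measure) fst) A > 0 \<longrightarrow> 4 - \<gamma> \<le> hausdorff_dim A"
    and \<mu>: "sets \<mu> = sets borel" "finite_measure \<mu>" "weak_star_conv (\<lambda>n. cutout_meas_n M Y n \<omega>) \<mu>"
    and nz: "emeasure \<mu> (space \<mu>) \<noteq> 0"
  shows "measure_dim (distr \<mu> (borel :: complex measure) fst) = 4 - \<gamma>"
    and "hausdorff_dim (fst ` cutout_set Y \<omega>) = 4 - \<gamma>"
proof -
  let ?\<kappa> = "distr \<mu> (borel :: complex measure) fst" and ?P = "fst ` cutout_set Y \<omega>"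
  have sp: "space \<mu> = UNIV" using sets_eq_imp_space_eq[OF \<mu>(1)] by simp
  have fstm: "fst \<in> measurable \<mu> (borel :: complex measure)"
    unfolding measurable_cong_sets[OF \<mu>(1) refl] by (intro borel_measurable_continuous_onI continuous_intros)
  have Pm: "?P \<in> sets borel"
    by (intro borel_compact compact_continuous_image compact_cutout_set continuous_intros)
  have Em: "cutout_set Y \<omega> \<in> sets \<mu>" unfolding \<mu>(1) by (intro borel_compact compact_cutout_set)
  have "emeasure \<mu> UNIV \<le> emeasure \<mu> (cutout_set Y \<omega>) + emeasure \<mu> (- cutout_set Y \<omega>)"
    using emeasure_subadditive[OF Em, of "- cutout_set Y \<omega>"] Em by (simp add: \<mu>(1) Compl_partition)
  also have "\<dots> = emeasure \<mu> (cutout_set Y \<omega>)" using weak_limit_concentrated[OF \<mu>(3,1,2)] by simp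
  also have "\<dots> \<le> emeasure \<mu> (fst -` ?P)"
  proof (rule emeasure_mono)
    show "fst -` ?P \<in> sets \<mu>" using measurable_sets[OF fstm Pm] by (simp add: sp)
  qed auto
  also have "\<dots> = emeasure ?\<kappa> ?P" using Pm fstm by (subst emeasure_distr) (auto simp: sp)
  finally have pos: "emeasure ?\<kappa> ?P > 0" using nz sp by (auto simp: zero_less_iff_neq_zero)
  show dim: "hausdorff_dim ?P = 4 - \<gamma>" using upper lower \<mu> Pm pos by (intro antisym) auto
  show "measure_dim ?\<kappa> = 4 - \<gamma>"
    unfolding measure_dim_def
  proof (rule cInf_eq_minimum)
    show "4 - \<gamma> \<in> {hausdorff_dim A |A. A \<in> sets ?\<kappa> \<and> 0 < emeasure ?\<kappa> A}" using dim Pm pos by force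
    show "4 - \<gamma> \<le> x" if "x \<in> {hausdorff_dim A |A. A \<in> sets ?\<kappa> \<and> 0 < emeasure ?\<kappa> A}" for x
      using that lower \<mu> by auto
  qed
qed

end

theorem theorem4p3:
  fixes M :: "'w measure" and Y :: "'w \<Rightarrow> (heis \<times> real) set"
    and \<gamma> \<beta> :: real and \<mu> :: "'w \<Rightarrow> heis measure"
  assumes "0 < \<gamma>" and "\<gamma> < 4" and "\<beta> = 4 - \<gamma>"
    and "poisson_pp M Y (cutout_intensity \<gamma>)"
    and "AE \<omega> in M. sets (\<mu> \<omega>) = sets borel \<and> finite_measure (\<mu> \<omega>) \<and>
           weak_star_conv (\<lambda>n. cutout_meas_n M Y n \<omega>) (\<mu> \<omega>)"
  shows "AE \<omega> in M. emeasure (\<mu> \<omega>) (space (\<mu> \<omega>)) \<noteq> 0 \<longrightarrow>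
           (\<beta> > 2 \<longrightarrow> absolutely_continuous lborel (distr (\<mu> \<omega>) (lborel :: complex measure) fst)
                      \<and> interior (fst ` cutout_set Y \<omega>) \<noteq> {}) \<and>
           (\<beta> \<le> 2 \<longrightarrow> measure_dim (distr (\<mu> \<omega>) (borel :: complex measure) fst) = \<beta>
                      \<and> hausdorff_dim (fst ` cutout_set Y \<omega>) = \<beta>)"
proof -
  interpret poisson_cutout M Y \<gamma> by unfold_locales fact+
  show ?thesis
  proof (cases "\<beta> > 2")
    case True
    then have "\<gamma> < 2" using assms(3) by simp
    from AE_fdens_uniform[OF this] assms(5) show ?thesis
    proof eventually_elim
      case (elim \<omega>)
      then show ?case
        using True projection_absolutely_continuous[of \<omega>] projection_interior_nonempty[of \<omega>] by auto
    qed
  next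
    case False
    then have "2 \<le> \<gamma>" using assms(3) by simp
    from AE_hausdorff_dim_le[OF less_imp_le[OF assms(2)]] AE_hausdorff_dim_ge[OF this assms(2)] assms(5) show ?thesis
    proof eventually_elim
      case (elim \<omega>)
      then show ?case using False projection_dimension[OF elim(1,2), of "\<mu> \<omega>"] assms(3) by auto
    qed
  qed
qed

end
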